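(* There are exactly $780617$ candidate quatroids, forming $126$ orbits under $\mathfrak S_8$. Of these, exactly $779777$ ($125$ orbits) are representable over $\mathbb C$, and exactly $778937$ ($124$ orbits) are representable over $\mathbb R$, and likewise exactly $778937$ ($124$ orbits) over $\mathbb Q$. In particular, the stratification of $\mathcal P$ into the nonempty loci $\mathcal S_{\mathcal Q}$ consists of $779777$ strata, of which $544748$ ($76$ orbits) are indexed by Bézoutian quatroids.
   Context: For a field $\mathbb K$, let $\mathcal P_{\mathbb K}\subset(\mathbb P^2_{\mathbb K})^8$ be the set of ordered $8$-tuples of pairwise distinct points, and $\mathcal P=\mathcal P_{\mathbb C}$. A conic is an irreducible plane quadric. A pair $\mathcal Q=(\mathcal I,\mathcal J)$ consists of a set $\mathcal I$ of $3$-subsets and a set $\mathcal J$ of $6$-subsets of $\{1,\dots,8\}$. A configuration $\mathbf p\in\mathcal P_{\mathbb K}$ represents $\mathcal Q$ over $\mathbb K$ if the triples of points of $\mathbf p$ lying on a line are exactly those indexed by $\mathcal I$ and the sextuples of points of $\mathbf p$ lying on a conic are exactly those indexed by $\mathcal J$. $\mathcal Q$ is representable over $\mathbb K$ if such $\mathbf p$ exists; $\mathcal S_{\mathcal Q}\subset\mathcal P$ is the set of configurations representing $\mathcal Q$ over $\mathbb C$. The group $\mathfrak S_8$ acts on pairs by permuting $\{1,\dots,8\}$. A pair satisfies Bézout's weak criteria if (1) $|I\cap J|\le2$ for all $I\in\mathcal I$, $J\in\mathcal J$; (2) whenever distinct $I_1,I_2\in\mathcal I$ have $|I_1\cap I_2|>1$,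 every $3$-subset of $I_1\cup I_2$ is in $\mathcal I$; (3) whenever distinct $J_1,J_2\in\mathcal J$ have $|J_1\cap J_2|>4$, every $6$-subset of $J_1\cup J_2$ is in $\mathcal J$. A pair is matroidal if there is $\mathbf p\in\mathcal P$ whose collinear triples are exactly those indexed by $\mathcal I$. A candidate quatroid is a matroidal pair satisfying Bézout's weak criteria. A pair is Bézoutian if it satisfies Bézout's weak criteria, any two distinct elements of $\mathcal I$ meet in at most one element, and any two distinct elements of $\mathcal J$ meet in at most four elements. *)

theory Defs
  imports
    "HOL-Analysis.Cartesian_Space"
    "HOL-Computational_Algebra.Polynomial"
    "HOL-Library.Disjoint_Sets"
    "HOL-Algebra.Group_Action"
    "HOL-Algebra.Sym_Groups"
begin

definition proj_plane :: "('k::field ^ 3) set set" where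
  "proj_plane = {P. vec.subspace P \<and> vec.dim P = 1}"

definition proj_lines :: "('k::field ^ 3) set set" where
  "proj_lines = {W. vec.subspace W \<and> vec.dim W = 2}"

definition collinear_points :: "('k::field ^ 3) set set \<Rightarrow> bool" where
  "collinear_points S \<longleftrightarrow> (\<exists>W\<in>proj_lines. \<forall>P\<in>S. P \<subseteq> W)"

(* The ring K[x,y,z] is rendered as K[x][y][z], so x is the innermost variable. *)

abbreviation const3 :: "'k::field \<Rightarrow> 'k poly poly poly" where
  "const3 a \<equiv> [:[:[:a:]:]:]"

abbreviation var_x :: "'k::field poly poly poly" where
  "var_x \<equiv> [:[:[:0, 1:]:]:]"

abbreviation var_y :: "'k::field poly poly poly" where
  "var_y \<equiv> [:[:0, 1:]:]"

abbreviation var_z :: "'k::field poly poly poly" where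
  "var_z \<equiv> [:0, 1:]"

definition eval3 :: "'k::field poly poly poly \<Rightarrow> 'k ^ 3 \<Rightarrow> 'k" where
  "eval3 F v = poly (poly (poly F [:[:v $ 3:]:]) [:v $ 2:]) (v $ 1)"

(* Homogeneous of degree 2. The zero form is included; irreducibility rules it out below. *)
definition ternary_quadratic_form :: "'k::field poly poly poly \<Rightarrow> bool" where
  "ternary_quadratic_form F \<longleftrightarrow> (\<exists>a b c d e f.
     F = const3 a * var_x ^ 2 + const3 b * var_y ^ 2 + const3 c * var_z ^ 2
       + const3 d * (var_x * var_y) + const3 e * (var_x * var_z) + const3 f * (var_y * var_z))"

(* Irreducibility is over K itself. A form that is irreducible over K but not over its
   algebraic closure is, in characteristic 0, a product of two conjugate lines, and so has at
   most one K-rational zero; it never carries six distinct points. *)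
definition conic_form :: "'k::field poly poly poly \<Rightarrow> bool" where
  "conic_form F \<longleftrightarrow> ternary_quadratic_form F \<and> irreducible F"

definition on_common_conic :: "('k::field ^ 3) set set \<Rightarrow> bool" where
  "on_common_conic S \<longleftrightarrow> (\<exists>F. conic_form F \<and> (\<forall>P\<in>S. \<forall>v\<in>P. eval3 F v = 0))"

(* Tuples are extensional functions on {1..8}, so that distinct functions are distinct
   configurations. *)
definition configurations :: "(nat \<Rightarrow> ('k::field ^ 3) set) set" where
  "configurations = {p \<in> {1..8} \<rightarrow>\<^sub>E proj_plane. inj_on p {1..8}}"

definition collinear_triples :: "(nat \<Rightarrow> ('k::field ^ 3) set) \<Rightarrow> nat set set" where
  "collinear_triples p = {I. I \<subseteq> {1..8} \<and> card I = 3 \<and> collinear_points (p ` I)}"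

definition conic_sextuples :: "(nat \<Rightarrow> ('k::field ^ 3) set) \<Rightarrow> nat set set" where
  "conic_sextuples p = {J. J \<subseteq> {1..8} \<and> card J = 6 \<and> on_common_conic (p ` J)}"

type_synonym pair = "nat set set \<times> nat set set"

definition pairs :: "pair set" where
  "pairs = {(\<I>, \<J>). (\<forall>I\<in>\<I>. I \<subseteq> {1..8} \<and> card I = 3) \<and> (\<forall>J\<in>\<J>. J \<subseteq> {1..8} \<and> card J = 6)}"

definition represents :: "(nat \<Rightarrow> ('k::field ^ 3) set) \<Rightarrow> pair \<Rightarrow> bool" where
  "represents p Q \<longleftrightarrow> collinear_triples p = fst Q \<and> conic_sextuples p = snd Q"

definition representable_over :: "'k::field itself \<Rightarrow> pair \<Rightarrow> bool" where
  "representable_over _ Q \<longleftrightarrow>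
     (\<exists>p \<in> (configurations :: (nat \<Rightarrow> ('k ^ 3) set) set). represents p Q)"

definition stratum :: "pair \<Rightarrow> (nat \<Rightarrow> (complex ^ 3) set) set" where
  "stratum Q = {p \<in> configurations. represents p Q}"

definition strata :: "(nat \<Rightarrow> (complex ^ 3) set) set set" where
  "strata = {stratum Q | Q. Q \<in> pairs \<and> stratum Q \<noteq> {}}"

definition act :: "(nat \<Rightarrow> nat) \<Rightarrow> pair \<Rightarrow> pair" where
  "act \<sigma> Q = ((`) \<sigma> ` fst Q, (`) \<sigma> ` snd Q)"

abbreviation S8_orbits :: "pair set \<Rightarrow> pair set set" where
  "S8_orbits E \<equiv> orbits (sym_group 8) E act"

definition bezout_weak :: "pair \<Rightarrow> bool" where
  "bezout_weak Q \<longleftrightarrow> (case Q of (\<I>, \<J>) \<Rightarrow>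
     (\<forall>I\<in>\<I>. \<forall>J\<in>\<J>. card (I \<inter> J) \<le> 2) \<and>
     (\<forall>I1\<in>\<I>. \<forall>I2\<in>\<I>. I1 \<noteq> I2 \<and> card (I1 \<inter> I2) > 1 \<longrightarrow>
        (\<forall>I. I \<subseteq> I1 \<union> I2 \<and> card I = 3 \<longrightarrow> I \<in> \<I>)) \<and>
     (\<forall>J1\<in>\<J>. \<forall>J2\<in>\<J>. J1 \<noteq> J2 \<and> card (J1 \<inter> J2) > 4 \<longrightarrow>
        (\<forall>J. J \<subseteq> J1 \<union> J2 \<and> card J = 6 \<longrightarrow> J \<in> \<J>)))"

definition matroidal :: "pair \<Rightarrow> bool" where
  "matroidal Q \<longleftrightarrow>
     (\<exists>p \<in> (configurations :: (nat \<Rightarrow> (complex ^ 3) set) set). collinear_triples p = fst Q)"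

definition candidate_quatroids :: "pair set" where
  "candidate_quatroids = {Q \<in> pairs. matroidal Q \<and> bezout_weak Q}"

definition bezoutian :: "pair \<Rightarrow> bool" where
  "bezoutian Q \<longleftrightarrow> bezout_weak Q \<and>
     (\<forall>I1\<in>fst Q. \<forall>I2\<in>fst Q. I1 \<noteq> I2 \<longrightarrow> card (I1 \<inter> I2) \<le> 1) \<and>
     (\<forall>J1\<in>snd Q. \<forall>J2\<in>snd Q. J1 \<noteq> J2 \<longrightarrow> card (J1 \<inter> J2) \<le> 4)"

end

theory Submission
  imports Defs
begin

text \<open>
  A pair satisfying Bezout's weak criteria is the same as a set of lines (maximal subsets of at least three
  indices) and conics (maximal subsets of at least six) in which two lines share at most one point, a line and
  a conic at most two, and two conics at most four. Such systems fall into 128 classes under permutations.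
  That the 128 representatives suffice follows by induction on the number of lines and conics, once every
  one-element extension of every representative has been identified with a representative; an integer
  invariant separates the classes. The class sizes N j satisfy the linear recurrence obtained by counting
  in two ways the pairs of a system in class j and one of its elements.

  In coordinates, three points are collinear if a determinant (bracket) vanishes, and six points, no three of
  them collinear, lie on an irreducible conic if an identity between brackets holds. This makes it a finite
  computation that 124 classes are represented by integer points. Of the remaining four, two contain the Fano
  plane, which needs 2 = 0; one contains the MacLane configuration, which needs a primitive cube root of
  unity; and one consists of the six vertices of a complete quadrilateral and two more points, with three conics
  through these two points and two pairs of opposite vertices, which again forces 2 = 0.
\<close>

text \<open>All finite checks are run by the simplifier as plain rewriting, and this shapes the
  executable definitions: cardinalities are unary, tests are nested conditionals of which only the
  condition is rewritten until it is decided, and subsets are tuples of eight bits. A conic is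
  stored as the complement of its point set. Lines and conics thus become one kind of object, told
  apart by cardinality, and permutations act on both alike. The class sizes come from a recurrence
  rather than from automorphism groups because its coefficients, the numbers of extensions from one
  class into another, are read off the same certificates that prove the list of representatives
  complete. The recurrence is triangular in the number of elements, so induction from the empty
  system solves it. The sizes add up to 782537; the two Fano classes account for 240 + 1680 of them,
  the quadrilateral and the MacLane class for 840 each, whence 780617, 779777 and 778937.\<close>

section \<open>The table of classes\<close>

text \<open>Maps defined on {1..8}. In this form the simplifier looks up a value in one step.\<close>

datatype 'a oct = Oct 'a 'a 'a 'a 'a 'a 'a 'a

fun oct_list :: "'a oct \<Rightarrow> 'a list" where
  "oct_list (Oct a b c d e f g h) = [a, b, c, d, e, f, g, h]"

definition ap :: "nat \<Rightarrow> 'a oct \<Rightarrow> 'a" where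
  "ap i v = oct_list v ! (i - 1)"

lemma ap_simps:
  "ap 1 (Oct a b c d e f g h) = a" "ap 2 (Oct a b c d e f g h) = b"
  "ap 3 (Oct a b c d e f g h) = c" "ap 4 (Oct a b c d e f g h) = d"
  "ap 5 (Oct a b c d e f g h) = e" "ap 6 (Oct a b c d e f g h) = f"
  "ap 7 (Oct a b c d e f g h) = g" "ap 8 (Oct a b c d e f g h) = h"
  by (simp_all add: ap_def)

section \<open>Subsets of {1..8} as bit vectors and their compatibility\<close>

fun bits :: "nat list \<Rightarrow> bool oct" where
  "bits xs = Oct (1 \<in> set xs) (2 \<in> set xs) (3 \<in> set xs) (4 \<in> set xs)
                 (5 \<in> set xs) (6 \<in> set xs) (7 \<in> set xs) (8 \<in> set xs)"

text \<open>Unary counting: \<open>compat_sizes\<close> is then decided by matching on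
  \<open>Suc\<close>, and the many thousand compatibility tests involve no numeral
  arithmetic.\<close>

primrec bsuc :: "bool \<Rightarrow> nat \<Rightarrow> nat" where
  "bsuc True n = Suc n" | "bsuc False n = n"

lemma bsuc_simps: "bsuc True n = Suc n" "bsuc False n = n" by simp_all

fun size_oct :: "bool oct \<Rightarrow> nat" where
  "size_oct (Oct a b c d e f g h) =
     bsuc a (bsuc b (bsuc c (bsuc d (bsuc e (bsuc f (bsuc g (bsuc h 0)))))))"

primrec bsuc2 :: "bool \<Rightarrow> bool \<Rightarrow> nat \<Rightarrow> nat" where
  "bsuc2 True b n = bsuc b n" | "bsuc2 False b n = n"

lemma bsuc2_simps: "bsuc2 True True n = Suc n" "bsuc2 True False n = n" "bsuc2 False b n = n"
  by simp_all

fun size_inter :: "bool oct \<Rightarrow> bool oct \<Rightarrow> nat" where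
  "size_inter (Oct a b c d e f g h) (Oct a' b' c' d' e' f' g' h') =
     bsuc2 a a' (bsuc2 b b' (bsuc2 c c' (bsuc2 d d' (bsuc2 e e' (bsuc2 f f' (bsuc2 g g' (bsuc2 h h' 0)))))))"

text \<open>The arguments are the cardinalities of A, B and A \<inter> B. A set of at least three indices stands for a
  line, a set of at most two for the conic through the points of its complement.\<close>

fun compat_sizes :: "nat \<Rightarrow> nat \<Rightarrow> nat \<Rightarrow> bool" where
  "compat_sizes (Suc (Suc (Suc m))) (Suc (Suc (Suc n))) c = (c \<le> Suc 0)"
| "compat_sizes (Suc (Suc (Suc m))) n c = (Suc m \<le> c)"
| "compat_sizes m (Suc (Suc (Suc n))) c = (Suc n \<le> c)"
| "compat_sizes (Suc (Suc 0)) (Suc (Suc 0)) 0 = True"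
| "compat_sizes m n c = False"

text \<open>A nested conditional instead of a conjunction: under \<open>if_weak_cong\<close> only
  the condition is rewritten until it is decided, so evaluation stops at the first incompatible
  element. The same form recurs in the checkers below.\<close>

primrec all_compat :: "(nat \<times> bool oct) list \<Rightarrow> nat \<Rightarrow> bool oct \<Rightarrow> bool" where
  "all_compat [] m A = True"
| "all_compat (B # Bs) m A = (if compat_sizes m (fst B) (size_inter A (snd B)) then all_compat Bs m A else False)"

definition is_ext :: "(nat \<times> bool oct) list \<Rightarrow> bool oct \<Rightarrow> bool" where
  "is_ext K A = all_compat K (size_oct A) A"

definition with_size :: "bool oct \<Rightarrow> nat \<times> bool oct" where
  "with_size A = (size_oct A, A)"

text \<open>The bit vectors are written out in a fixed order, and \<open>exts\<close> relies on this
  order: its entries carry no copy of the set that they certify.\<close>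

fun octs4 :: "bool \<Rightarrow> bool \<Rightarrow> bool \<Rightarrow> bool \<Rightarrow> bool oct list" where
  "octs4 a b c d =
    [Oct a b c d True True True True, Oct a b c d True True True False, Oct a b c d True True False True, Oct a b c d True True False False,
     Oct a b c d True False True True, Oct a b c d True False True False, Oct a b c d True False False True, Oct a b c d True False False False,
     Oct a b c d False True True True, Oct a b c d False True True False, Oct a b c d False True False True, Oct a b c d False True False False,
     Oct a b c d False False True True, Oct a b c d False False True False, Oct a b c d False False False True, Oct a b c d False False False False]"

primrec select :: "('a \<Rightarrow> bool) \<Rightarrow> 'a list \<Rightarrow> 'a list" where
  "select P [] = []"
| "select P (x # xs) = (if P x then x # select P xs else select P xs)"

fun select16 :: "(bool oct \<Rightarrow> bool) \<Rightarrow> bool \<Rightarrow> bool \<Rightarrow> bool oct list" where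
  "select16 P a b = select P (octs4 a b True True) @ select P (octs4 a b True False) @ select P (octs4 a b False True) @ select P (octs4 a b False False)"

fun select_octs :: "(bool oct \<Rightarrow> bool) \<Rightarrow> bool oct list" where
  "select_octs P = select16 P True True @ select16 P True False @ select16 P False True @ select16 P False False"

section \<open>Representatives and certificates of extensions\<close>

text \<open>The preimage of A under the map i \<mapsto> ap i \<pi>.\<close>

fun preimage_oct :: "nat oct \<Rightarrow> bool oct \<Rightarrow> bool oct" where
  "preimage_oct (Oct a b c d e f g h) A = Oct (ap a A) (ap b A) (ap c A) (ap d A) (ap e A) (ap f A) (ap g A) (ap h A)"

primrec list_mem :: "'a \<Rightarrow> 'a list \<Rightarrow> bool" where
  "list_mem x [] = False"
| "list_mem x (y # ys) = (if x = y then True else list_mem x ys)"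

primrec distinct8 :: "nat list \<Rightarrow> bool" where
  "distinct8 [] = True"
| "distinct8 (x # xs) = (if list_mem x xs then False else if list_mem x [1,2,3,4,5,6,7,8] then distinct8 xs else False)"

text \<open>Ordered by the number of elements. \<open>[[]]\<close> is the system whose only conic
  carries all eight points. The exceptional entries are 119 (quadrilateral with three conics), 121
  and 123 (Fano plane, in 123 with the eighth point on one of its lines) and 127 (MacLane).\<close>

definition reps :: "nat list list list" where
  "reps = [
    [],
    [[]],
    [[1]],
    [[1,2]],
    [[1,2,3]],
    [[1,2,3,4]],
    [[1,2,3,4,5]],
    [[1,2,3,4,5,6]],
    [[1,2,3,4,5,6,7]],
    [[1,2,3,4,5,6,7,8]],
    [[1],[1,2,3]],
    [[1,2],[1,2,3]],
    [[1,2],[3,4]],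
    [[1,2],[1,3,4]],
    [[1,2],[1,2,3,4]],
    [[1,2,3],[1,4,5]],
    [[1,2,3],[4,5,6]],
    [[1,2,3],[1,4,5,6]],
    [[1,2,3],[4,5,6,7]],
    [[1,2,3],[1,4,5,6,7]],
    [[1,2,3],[4,5,6,7,8]],
    [[1,2,3],[1,4,5,6,7,8]],
    [[1,2,3,4],[1,5,6,7]],
    [[1,2,3,4],[5,6,7,8]],
    [[1,2,3,4],[1,5,6,7,8]],
    [[1],[1,2,3],[1,4,5]],
    [[1,2],[1,2,3],[3,4]],
    [[1,2],[1,2,3],[1,4,5]],
    [[1,2],[3,4],[1,2,3,4]],
    [[1,2],[3,4],[1,3,5]],
    [[1,2],[3,4],[5,6]],
    [[1,2],[1,3,4],[2,3,5]],
    [[1,2],[1,3,4],[1,5,6]],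
    [[1,2],[1,3,4],[2,5,6]],
    [[1,2],[1,3,4],[1,2,5,6]],
    [[1,2,3],[1,4,5],[2,4,6]],
    [[1,2,3],[1,4,5],[1,6,7]],
    [[1,2,3],[1,4,5],[2,6,7]],
    [[1,2,3],[1,4,5],[2,4,6,7]],
    [[1,2,3],[1,4,5],[6,7,8]],
    [[1,2,3],[1,4,5],[1,6,7,8]],
    [[1,2,3],[1,4,5],[2,6,7,8]],
    [[1,2,3],[1,4,5],[2,4,6,7,8]],
    [[1,2,3],[4,5,6],[1,4,7,8]],
    [[1,2,3],[1,4,5,6],[2,4,7,8]],
    [[1],[1,2,3],[1,4,5],[1,6,7]],
    [[1,2],[1,2,3],[3,4],[1,4,5]],
    [[1,2],[1,2,3],[1,4,5],[2,4,6]],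
    [[1,2],[1,2,3],[1,4,5],[1,6,7]],
    [[1,2],[1,2,3],[1,4,5],[2,6,7]],
    [[1,2],[3,4],[1,3,5],[2,4,5]],
    [[1,2],[3,4],[1,3,5],[2,3,6]],
    [[1,2],[3,4],[1,3,5],[2,4,6]],
    [[1,2],[3,4],[1,3,5],[5,6]],
    [[1,2],[3,4],[5,6],[7,8]],
    [[1,2],[1,3,4],[2,3,5],[2,4,6]],
    [[1,2],[1,3,4],[2,3,5],[1,6,7]],
    [[1,2],[1,3,4],[2,3,5],[1,2,6,7]],
    [[1,2],[1,3,4],[1,5,6],[1,7,8]],
    [[1,2],[1,3,4],[1,5,6],[2,7,8]],
    [[1,2],[1,3,4],[1,5,6],[1,2,7,8]],
    [[1,2],[1,3,4],[2,5,6],[1,2,7,8]],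
    [[1,2,3],[1,4,5],[2,4,6],[3,5,6]],
    [[1,2,3],[1,4,5],[2,4,6],[3,4,7]],
    [[1,2,3],[1,4,5],[2,4,6],[3,5,7]],
    [[1,2,3],[1,4,5],[2,4,6],[3,5,6,7]],
    [[1,2,3],[1,4,5],[2,4,6],[1,7,8]],
    [[1,2,3],[1,4,5],[2,4,6],[3,7,8]],
    [[1,2,3],[1,4,5],[2,4,6],[3,4,7,8]],
    [[1,2,3],[1,4,5],[2,4,6],[3,5,7,8]],
    [[1,2,3],[1,4,5],[2,4,6],[3,5,6,7,8]],
    [[1,2,3],[1,4,5],[1,6,7],[2,4,6,8]],
    [[1,2,3],[1,4,5],[2,6,7],[4,6,8]],
    [[1,2,3],[1,4,5],[2,6,7],[3,4,6,8]],
    [[1,2,3],[1,4,5],[2,4,6,7],[3,5,6,8]],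
    [[1,2],[1,2,3],[3,4],[1,4,5],[2,4,6]],
    [[1,2],[1,2,3],[1,4,5],[2,4,6],[2,5,7]],
    [[1,2],[1,2,3],[1,4,5],[2,4,6],[1,7,8]],
    [[1,2],[3,4],[1,3,5],[2,4,5],[2,3,6]],
    [[1,2],[3,4],[1,3,5],[2,4,5],[5,6]],
    [[1,2],[3,4],[1,3,5],[2,3,6],[1,4,7]],
    [[1,2],[3,4],[1,3,5],[2,4,6],[5,6]],
    [[1,2],[1,3,4],[2,3,5],[2,4,6],[1,5,6]],
    [[1,2],[1,3,4],[2,3,5],[2,4,6],[1,5,7]],
    [[1,2],[1,3,4],[2,3,5],[2,4,6],[1,7,8]],
    [[1,2],[1,3,4],[2,3,5],[2,4,6],[2,7,8]],
    [[1,2],[1,3,4],[2,3,5],[2,4,6],[1,2,7,8]],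
    [[1,2],[1,3,4],[2,3,5],[1,6,7],[2,6,8]],
    [[1,2,3],[1,4,5],[2,4,6],[3,5,6],[3,4,7]],
    [[1,2,3],[1,4,5],[2,4,6],[3,5,6],[1,7,8]],
    [[1,2,3],[1,4,5],[2,4,6],[3,5,6],[3,4,7,8]],
    [[1,2,3],[1,4,5],[2,4,6],[3,4,7],[5,6,7]],
    [[1,2,3],[1,4,5],[2,4,6],[3,4,7],[2,5,8]],
    [[1,2,3],[1,4,5],[2,4,6],[3,4,7],[5,6,8]],
    [[1,2,3],[1,4,5],[2,4,6],[3,4,7],[3,5,6,8]],
    [[1,2,3],[1,4,5],[2,4,6],[3,4,7],[5,6,7,8]],
    [[1,2,3],[1,4,5],[2,4,6],[3,5,7],[3,6,8]],
    [[1,2,3],[1,4,5],[2,4,6],[3,5,7],[6,7,8]],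
    [[1,2,3],[1,4,5],[2,4,6],[3,5,7],[1,6,7,8]],
    [[1,2,3],[1,4,5],[2,4,6],[3,5,6,7],[1,7,8]],
    [[1,2,3],[1,4,5],[1,6,7],[2,4,6,8],[3,5,7,8]],
    [[1,2,3],[1,4,5],[2,6,7],[4,6,8],[3,5,7,8]],
    [[1,2],[1,2,3],[1,4,5],[2,4,6],[2,5,7],[1,6,7]],
    [[1,2],[1,2,3],[1,4,5],[2,4,6],[2,5,7],[1,6,8]],
    [[1,2],[3,4],[1,3,5],[2,4,5],[2,3,6],[1,4,6]],
    [[1,2],[3,4],[1,3,5],[2,4,5],[2,3,6],[5,6]],
    [[1,2],[3,4],[1,3,5],[2,4,5],[2,3,6],[1,4,7]],
    [[1,2],[3,4],[1,3,5],[2,3,6],[1,4,7],[2,4,8]],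
    [[1,2],[1,3,4],[2,3,5],[2,4,6],[1,5,6],[1,7,8]],
    [[1,2],[1,3,4],[2,3,5],[2,4,6],[1,5,6],[1,2,7,8]],
    [[1,2],[1,3,4],[2,3,5],[2,4,6],[1,5,7],[1,6,8]],
    [[1,2,3],[1,4,5],[2,4,6],[3,5,6],[3,4,7],[2,5,7]],
    [[1,2,3],[1,4,5],[2,4,6],[3,5,6],[3,4,7],[2,5,8]],
    [[1,2,3],[1,4,5],[2,4,6],[3,5,6],[3,4,7],[1,7,8]],
    [[1,2,3],[1,4,5],[2,4,6],[3,5,6],[3,4,7],[2,5,7,8]],
    [[1,2,3],[1,4,5],[2,4,6],[3,4,7],[5,6,7],[2,5,8]],
    [[1,2,3],[1,4,5],[2,4,6],[3,4,7],[2,5,8],[6,7,8]],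
    [[1,2,3],[1,4,5],[2,4,6],[3,4,7],[2,5,8],[1,6,7,8]],
    [[1,2,3],[1,4,5],[2,4,6],[3,5,7],[3,6,8],[4,7,8]],
    [[1,2],[3,4],[1,3,5],[2,4,5],[2,3,6],[1,4,6],[5,6]],
    [[1,2],[1,3,4],[2,3,5],[2,4,6],[1,5,7],[1,6,8],[2,7,8]],
    [[1,2,3],[1,4,5],[2,4,6],[3,5,6],[3,4,7],[2,5,7],[1,6,7]],
    [[1,2,3],[1,4,5],[2,4,6],[3,5,6],[3,4,7],[2,5,7],[1,6,8]],
    [[1,2,3],[1,4,5],[2,4,6],[3,5,6],[3,4,7],[2,5,7],[1,6,7,8]],
    [[1,2,3],[1,4,5],[2,4,6],[3,5,6],[3,4,7],[2,5,8],[1,7,8]],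
    [[1,2,3],[1,4,5],[2,4,6],[3,5,6],[3,4,7],[2,5,8],[1,6,7,8]],
    [[1,2,3],[1,4,5],[2,4,6],[3,4,7],[5,6,7],[2,5,8],[3,6,8]],
    [[1,2,3],[1,4,5],[2,4,6],[3,4,7],[5,6,7],[2,5,8],[3,6,8],[1,7,8]]]"

definition rep :: "nat \<Rightarrow> bool oct list" where
  "rep i = map bits (reps ! i)"

primrec list_subset :: "'a list \<Rightarrow> 'a list \<Rightarrow> bool" where
  "list_subset [] ys = True"
| "list_subset (x # xs) ys = (if list_mem x ys then list_subset xs ys else False)"

text \<open>The test of lengths is what turns the inclusion checked by \<open>list_subset\<close>
  into an equality of systems; see \<open>cert_okD\<close>.\<close>

fun cert_ok :: "bool oct list \<Rightarrow> bool oct \<Rightarrow> (nat \<times> nat oct) \<Rightarrow> bool" where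
  "cert_ok K A (j, \<pi>) = (if j < 128 then
       if distinct8 (oct_list \<pi>) then if length (rep j) = Suc (length K) then list_subset (map (preimage_oct \<pi>) (rep j)) (A # K) else False
       else False else False)"

fun certs_ok :: "bool oct list \<Rightarrow> bool oct list \<Rightarrow> (nat \<times> nat oct) list \<Rightarrow> bool" where
  "certs_ok K [] [] = True"
| "certs_ok K (A # As) (c # cs) = (if cert_ok K A c then certs_ok K As cs else False)"
| "certs_ok K _ _ = False"

definition row_ok :: "nat \<Rightarrow> (nat \<times> nat oct) list \<Rightarrow> bool" where
  "row_ok i cs = certs_ok (rep i) (select_octs (is_ext (map with_size (rep i)))) cs"

section \<open>Evaluation of the certificates by rewriting\<close>

lemma length_reps: "length reps = 128"
  by (simp add: reps_def)

text \<open>Comparing both lists entry by entry turns this one equation into \<open>rep_eqs\<close>,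
  a rewrite rule for \<open>rep i\<close> at each of the 128 numerals, so that no list has to be
  traversed to find an entry.\<close>

lemma map_rep: "map rep [0..<128] = map (map bits) reps"
  by (rule nth_equalityI) (simp_all add: length_reps rep_def)

lemma upt128: "[0..<128::nat] = [0, 1, 2, 3, 4, 5, 6, 7, 8, 9, 10, 11, 12, 13, 14, 15, 16, 17, 18, 19, 20, 21, 22, 23, 24, 25, 26,
      27, 28, 29, 30, 31, 32, 33, 34, 35, 36, 37, 38, 39, 40, 41, 42, 43, 44, 45, 46, 47, 48, 49, 50, 51,
      52, 53, 54, 55, 56, 57, 58, 59, 60, 61, 62, 63, 64, 65, 66, 67, 68, 69, 70, 71, 72, 73, 74, 75, 76,
      77, 78, 79, 80, 81, 82, 83, 84, 85, 86, 87, 88, 89, 90, 91, 92, 93, 94, 95, 96, 97, 98, 99, 100,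
      101, 102, 103, 104, 105, 106, 107, 108, 109, 110, 111, 112, 113, 114, 115, 116, 117, 118, 119, 120,
      121, 122, 123, 124, 125, 126, 127]"
  by (simp add: upt_conv_Cons)

lemma nat_num_simps:
  "((1::nat) = 1) = True" "((1::nat) = numeral (num.Bit0 n)) = False" "((1::nat) = numeral (num.Bit1 n)) = False"
  "(numeral (num.Bit0 n) = (1::nat)) = False" "(numeral (num.Bit1 n) = (1::nat)) = False"
  "(numeral m = (numeral n :: nat)) = (m = n)"
  by simp_all

lemmas bits_simps = bits.simps list.set insert_iff empty_iff nat_num_simps num.inject num.distinct simp_thms
lemmas rep_eqs = map_rep[simplified upt128 reps_def list.map list.inject bits_simps]

lemma Suc_le_0: "Suc n \<le> 0 \<longleftrightarrow> False"
  by simp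

lemma nat_less_128: "0 < (128::nat)" "1 < (128::nat)" "(numeral n < (128::nat)) = (n < num.Bit0 (num.Bit0 (num.Bit0 (num.Bit0 (num.Bit0 (num.Bit0 (num.Bit0 num.One)))))))"
  by simp_all

text \<open>Just the equations that evaluate \<open>row_ok\<close>, to be used with
  \<open>simp only\<close>: the number of rewriting steps is so large that the rule set has to stay
  small.\<close>

lemmas eval_rules = row_ok_def rep_eqs octs4.simps select.simps select16.simps select_octs.simps append.simps all_compat.simps compat_sizes.simps size_oct.simps size_inter.simps with_size_def
  is_ext_def fst_conv snd_conv bsuc_simps bsuc2_simps le0 Suc_le_mono Suc_le_0 certs_ok.simps cert_ok.simps distinct8.simps
  list_mem.simps oct.inject preimage_oct.simps ap_simps list.map list.size list_subset.simps oct_list.simps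
  nat_less_128 less_num_simps le_num_simps nat_num_simps num.inject num.distinct simp_thms if_True if_False
  nat.inject nat.distinct add_0_right add_Suc_right

text \<open>The k-th entry (j, \<pi>) of row i concerns the k-th set A compatible with rep i, in the order of
  select_octs: the permutation i \<mapsto> ap i \<pi> maps the extension of rep i by A to rep j.\<close>

definition exts :: "(nat \<times> nat oct) list list" where
  "exts = [[(9,Oct 1 2 3 4 5 6 7 8), (8,Oct 1 2 3 4 5 6 7 8), (8,Oct 1 2 3 4 5 6 8 7), (7,Oct 1 2 3 4 5 6 7 8),
    (8,Oct 1 2 3 4 5 8 6 7), (7,Oct 1 2 3 4 5 7 6 8), (7,Oct 1 2 3 4 5 7 8 6), (6,Oct 1 2 3 4 5 6 7 8),
    (8,Oct 1 2 3 4 8 5 6 7), (7,Oct 1 2 3 4 7 5 6 8), (7,Oct 1 2 3 4 7 5 8 6), (6,Oct 1 2 3 4 6 5 7 8),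
    (7,Oct 1 2 3 4 7 8 5 6), (6,Oct 1 2 3 4 6 7 5 8), (6,Oct 1 2 3 4 6 7 8 5), (5,Oct 1 2 3 4 5 6 7 8),
    (8,Oct 1 2 3 8 4 5 6 7), (7,Oct 1 2 3 7 4 5 6 8), (7,Oct 1 2 3 7 4 5 8 6), (6,Oct 1 2 3 6 4 5 7 8),
    (7,Oct 1 2 3 7 4 8 5 6), (6,Oct 1 2 3 6 4 7 5 8), (6,Oct 1 2 3 6 4 7 8 5), (5,Oct 1 2 3 5 4 6 7 8),
    (7,Oct 1 2 3 7 8 4 5 6), (6,Oct 1 2 3 6 7 4 5 8), (6,Oct 1 2 3 6 7 4 8 5), (5,Oct 1 2 3 5 6 4 7 8),
    (6,Oct 1 2 3 6 7 8 4 5), (5,Oct 1 2 3 5 6 7 4 8), (5,Oct 1 2 3 5 6 7 8 4), (4,Oct 1 2 3 4 5 6 7 8),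
    (8,Oct 1 2 8 3 4 5 6 7), (7,Oct 1 2 7 3 4 5 6 8), (7,Oct 1 2 7 3 4 5 8 6), (6,Oct 1 2 6 3 4 5 7 8),
    (7,Oct 1 2 7 3 4 8 5 6), (6,Oct 1 2 6 3 4 7 5 8), (6,Oct 1 2 6 3 4 7 8 5), (5,Oct 1 2 5 3 4 6 7 8),
    (7,Oct 1 2 7 3 8 4 5 6), (6,Oct 1 2 6 3 7 4 5 8), (6,Oct 1 2 6 3 7 4 8 5), (5,Oct 1 2 5 3 6 4 7 8),
    (6,Oct 1 2 6 3 7 8 4 5), (5,Oct 1 2 5 3 6 7 4 8), (5,Oct 1 2 5 3 6 7 8 4), (4,Oct 1 2 4 3 5 6 7 8),
    (7,Oct 1 2 7 8 3 4 5 6), (6,Oct 1 2 6 7 3 4 5 8), (6,Oct 1 2 6 7 3 4 8 5), (5,Oct 1 2 5 6 3 4 7 8),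
    (6,Oct 1 2 6 7 3 8 4 5), (5,Oct 1 2 5 6 3 7 4 8), (5,Oct 1 2 5 6 3 7 8 4), (4,Oct 1 2 4 5 3 6 7 8),
    (6,Oct 1 2 6 7 8 3 4 5), (5,Oct 1 2 5 6 7 3 4 8), (5,Oct 1 2 5 6 7 3 8 4), (4,Oct 1 2 4 5 6 3 7 8),
    (5,Oct 1 2 5 6 7 8 3 4), (4,Oct 1 2 4 5 6 7 3 8), (4,Oct 1 2 4 5 6 7 8 3), (3,Oct 1 2 3 4 5 6 7 8),
    (8,Oct 1 8 2 3 4 5 6 7), (7,Oct 1 7 2 3 4 5 6 8), (7,Oct 1 7 2 3 4 5 8 6), (6,Oct 1 6 2 3 4 5 7 8),
    (7,Oct 1 7 2 3 4 8 5 6), (6,Oct 1 6 2 3 4 7 5 8), (6,Oct 1 6 2 3 4 7 8 5), (5,Oct 1 5 2 3 4 6 7 8),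
    (7,Oct 1 7 2 3 8 4 5 6), (6,Oct 1 6 2 3 7 4 5 8), (6,Oct 1 6 2 3 7 4 8 5), (5,Oct 1 5 2 3 6 4 7 8),
    (6,Oct 1 6 2 3 7 8 4 5), (5,Oct 1 5 2 3 6 7 4 8), (5,Oct 1 5 2 3 6 7 8 4), (4,Oct 1 4 2 3 5 6 7 8),
    (7,Oct 1 7 2 8 3 4 5 6), (6,Oct 1 6 2 7 3 4 5 8), (6,Oct 1 6 2 7 3 4 8 5), (5,Oct 1 5 2 6 3 4 7 8),
    (6,Oct 1 6 2 7 3 8 4 5), (5,Oct 1 5 2 6 3 7 4 8), (5,Oct 1 5 2 6 3 7 8 4), (4,Oct 1 4 2 5 3 6 7 8),
    (6,Oct 1 6 2 7 8 3 4 5), (5,Oct 1 5 2 6 7 3 4 8), (5,Oct 1 5 2 6 7 3 8 4), (4,Oct 1 4 2 5 6 3 7 8),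
    (5,Oct 1 5 2 6 7 8 3 4), (4,Oct 1 4 2 5 6 7 3 8), (4,Oct 1 4 2 5 6 7 8 3), (3,Oct 1 3 2 4 5 6 7 8),
    (7,Oct 1 7 8 2 3 4 5 6), (6,Oct 1 6 7 2 3 4 5 8), (6,Oct 1 6 7 2 3 4 8 5), (5,Oct 1 5 6 2 3 4 7 8),
    (6,Oct 1 6 7 2 3 8 4 5), (5,Oct 1 5 6 2 3 7 4 8), (5,Oct 1 5 6 2 3 7 8 4), (4,Oct 1 4 5 2 3 6 7 8),
    (6,Oct 1 6 7 2 8 3 4 5), (5,Oct 1 5 6 2 7 3 4 8), (5,Oct 1 5 6 2 7 3 8 4), (4,Oct 1 4 5 2 6 3 7 8),
    (5,Oct 1 5 6 2 7 8 3 4), (4,Oct 1 4 5 2 6 7 3 8), (4,Oct 1 4 5 2 6 7 8 3), (3,Oct 1 3 4 2 5 6 7 8),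
    (6,Oct 1 6 7 8 2 3 4 5), (5,Oct 1 5 6 7 2 3 4 8), (5,Oct 1 5 6 7 2 3 8 4), (4,Oct 1 4 5 6 2 3 7 8),
    (5,Oct 1 5 6 7 2 8 3 4), (4,Oct 1 4 5 6 2 7 3 8), (4,Oct 1 4 5 6 2 7 8 3), (3,Oct 1 3 4 5 2 6 7 8),
    (5,Oct 1 5 6 7 8 2 3 4), (4,Oct 1 4 5 6 7 2 3 8), (4,Oct 1 4 5 6 7 2 8 3), (3,Oct 1 3 4 5 6 2 7 8),
    (4,Oct 1 4 5 6 7 8 2 3), (3,Oct 1 3 4 5 6 7 2 8), (3,Oct 1 3 4 5 6 7 8 2), (2,Oct 1 2 3 4 5 6 7 8),
    (8,Oct 8 1 2 3 4 5 6 7), (7,Oct 7 1 2 3 4 5 6 8), (7,Oct 7 1 2 3 4 5 8 6), (6,Oct 6 1 2 3 4 5 7 8),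
    (7,Oct 7 1 2 3 4 8 5 6), (6,Oct 6 1 2 3 4 7 5 8), (6,Oct 6 1 2 3 4 7 8 5), (5,Oct 5 1 2 3 4 6 7 8),
    (7,Oct 7 1 2 3 8 4 5 6), (6,Oct 6 1 2 3 7 4 5 8), (6,Oct 6 1 2 3 7 4 8 5), (5,Oct 5 1 2 3 6 4 7 8),
    (6,Oct 6 1 2 3 7 8 4 5), (5,Oct 5 1 2 3 6 7 4 8), (5,Oct 5 1 2 3 6 7 8 4), (4,Oct 4 1 2 3 5 6 7 8),
    (7,Oct 7 1 2 8 3 4 5 6), (6,Oct 6 1 2 7 3 4 5 8), (6,Oct 6 1 2 7 3 4 8 5), (5,Oct 5 1 2 6 3 4 7 8),
    (6,Oct 6 1 2 7 3 8 4 5), (5,Oct 5 1 2 6 3 7 4 8), (5,Oct 5 1 2 6 3 7 8 4), (4,Oct 4 1 2 5 3 6 7 8),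
    (6,Oct 6 1 2 7 8 3 4 5), (5,Oct 5 1 2 6 7 3 4 8), (5,Oct 5 1 2 6 7 3 8 4), (4,Oct 4 1 2 5 6 3 7 8),
    (5,Oct 5 1 2 6 7 8 3 4), (4,Oct 4 1 2 5 6 7 3 8), (4,Oct 4 1 2 5 6 7 8 3), (3,Oct 3 1 2 4 5 6 7 8),
    (7,Oct 7 1 8 2 3 4 5 6), (6,Oct 6 1 7 2 3 4 5 8), (6,Oct 6 1 7 2 3 4 8 5), (5,Oct 5 1 6 2 3 4 7 8),
    (6,Oct 6 1 7 2 3 8 4 5), (5,Oct 5 1 6 2 3 7 4 8), (5,Oct 5 1 6 2 3 7 8 4), (4,Oct 4 1 5 2 3 6 7 8),
    (6,Oct 6 1 7 2 8 3 4 5), (5,Oct 5 1 6 2 7 3 4 8), (5,Oct 5 1 6 2 7 3 8 4), (4,Oct 4 1 5 2 6 3 7 8),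
    (5,Oct 5 1 6 2 7 8 3 4), (4,Oct 4 1 5 2 6 7 3 8), (4,Oct 4 1 5 2 6 7 8 3), (3,Oct 3 1 4 2 5 6 7 8),
    (6,Oct 6 1 7 8 2 3 4 5), (5,Oct 5 1 6 7 2 3 4 8), (5,Oct 5 1 6 7 2 3 8 4), (4,Oct 4 1 5 6 2 3 7 8),
    (5,Oct 5 1 6 7 2 8 3 4), (4,Oct 4 1 5 6 2 7 3 8), (4,Oct 4 1 5 6 2 7 8 3), (3,Oct 3 1 4 5 2 6 7 8),
    (5,Oct 5 1 6 7 8 2 3 4), (4,Oct 4 1 5 6 7 2 3 8), (4,Oct 4 1 5 6 7 2 8 3), (3,Oct 3 1 4 5 6 2 7 8),
    (4,Oct 4 1 5 6 7 8 2 3), (3,Oct 3 1 4 5 6 7 2 8), (3,Oct 3 1 4 5 6 7 8 2), (2,Oct 2 1 3 4 5 6 7 8),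
    (7,Oct 7 8 1 2 3 4 5 6), (6,Oct 6 7 1 2 3 4 5 8), (6,Oct 6 7 1 2 3 4 8 5), (5,Oct 5 6 1 2 3 4 7 8),
    (6,Oct 6 7 1 2 3 8 4 5), (5,Oct 5 6 1 2 3 7 4 8), (5,Oct 5 6 1 2 3 7 8 4), (4,Oct 4 5 1 2 3 6 7 8),
    (6,Oct 6 7 1 2 8 3 4 5), (5,Oct 5 6 1 2 7 3 4 8), (5,Oct 5 6 1 2 7 3 8 4), (4,Oct 4 5 1 2 6 3 7 8),
    (5,Oct 5 6 1 2 7 8 3 4), (4,Oct 4 5 1 2 6 7 3 8), (4,Oct 4 5 1 2 6 7 8 3), (3,Oct 3 4 1 2 5 6 7 8),
    (6,Oct 6 7 1 8 2 3 4 5), (5,Oct 5 6 1 7 2 3 4 8), (5,Oct 5 6 1 7 2 3 8 4), (4,Oct 4 5 1 6 2 3 7 8),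
    (5,Oct 5 6 1 7 2 8 3 4), (4,Oct 4 5 1 6 2 7 3 8), (4,Oct 4 5 1 6 2 7 8 3), (3,Oct 3 4 1 5 2 6 7 8),
    (5,Oct 5 6 1 7 8 2 3 4), (4,Oct 4 5 1 6 7 2 3 8), (4,Oct 4 5 1 6 7 2 8 3), (3,Oct 3 4 1 5 6 2 7 8),
    (4,Oct 4 5 1 6 7 8 2 3), (3,Oct 3 4 1 5 6 7 2 8), (3,Oct 3 4 1 5 6 7 8 2), (2,Oct 2 3 1 4 5 6 7 8),
    (6,Oct 6 7 8 1 2 3 4 5), (5,Oct 5 6 7 1 2 3 4 8), (5,Oct 5 6 7 1 2 3 8 4), (4,Oct 4 5 6 1 2 3 7 8),
    (5,Oct 5 6 7 1 2 8 3 4), (4,Oct 4 5 6 1 2 7 3 8), (4,Oct 4 5 6 1 2 7 8 3), (3,Oct 3 4 5 1 2 6 7 8),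
    (5,Oct 5 6 7 1 8 2 3 4), (4,Oct 4 5 6 1 7 2 3 8), (4,Oct 4 5 6 1 7 2 8 3), (3,Oct 3 4 5 1 6 2 7 8),
    (4,Oct 4 5 6 1 7 8 2 3), (3,Oct 3 4 5 1 6 7 2 8), (3,Oct 3 4 5 1 6 7 8 2), (2,Oct 2 3 4 1 5 6 7 8),
    (5,Oct 5 6 7 8 1 2 3 4), (4,Oct 4 5 6 7 1 2 3 8), (4,Oct 4 5 6 7 1 2 8 3), (3,Oct 3 4 5 6 1 2 7 8),
    (4,Oct 4 5 6 7 1 8 2 3), (3,Oct 3 4 5 6 1 7 2 8), (3,Oct 3 4 5 6 1 7 8 2), (2,Oct 2 3 4 5 1 6 7 8),
    (4,Oct 4 5 6 7 8 1 2 3), (3,Oct 3 4 5 6 7 1 2 8), (3,Oct 3 4 5 6 7 1 8 2), (2,Oct 2 3 4 5 6 1 7 8),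
    (3,Oct 3 4 5 6 7 8 1 2), (2,Oct 2 3 4 5 6 7 1 8), (2,Oct 2 3 4 5 6 7 8 1), (1,Oct 1 2 3 4 5 6 7 8)],
    [],
    [(10,Oct 1 2 3 4 5 6 7 8), (10,Oct 1 2 4 3 5 6 7 8), (10,Oct 1 2 4 5 3 6 7 8), (10,Oct 1 2 4 5 6 3 7 8),
    (10,Oct 1 2 4 5 6 7 3 8), (10,Oct 1 2 4 5 6 7 8 3), (10,Oct 1 4 2 3 5 6 7 8), (10,Oct 1 4 2 5 3 6 7 8),
    (10,Oct 1 4 2 5 6 3 7 8), (10,Oct 1 4 2 5 6 7 3 8), (10,Oct 1 4 2 5 6 7 8 3), (10,Oct 1 4 5 2 3 6 7 8),
    (10,Oct 1 4 5 2 6 3 7 8), (10,Oct 1 4 5 2 6 7 3 8), (10,Oct 1 4 5 2 6 7 8 3), (10,Oct 1 4 5 6 2 3 7 8),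
    (10,Oct 1 4 5 6 2 7 3 8), (10,Oct 1 4 5 6 2 7 8 3), (10,Oct 1 4 5 6 7 2 3 8), (10,Oct 1 4 5 6 7 2 8 3),
    (10,Oct 1 4 5 6 7 8 2 3)],
    [(14,Oct 1 2 3 4 5 6 7 8), (14,Oct 1 2 3 5 4 6 7 8), (14,Oct 1 2 3 5 6 4 7 8), (14,Oct 1 2 3 5 6 7 4 8),
    (14,Oct 1 2 3 5 6 7 8 4), (11,Oct 1 2 3 4 5 6 7 8), (14,Oct 1 2 5 3 4 6 7 8), (14,Oct 1 2 5 3 6 4 7 8),
    (14,Oct 1 2 5 3 6 7 4 8), (14,Oct 1 2 5 3 6 7 8 4), (11,Oct 1 2 4 3 5 6 7 8), (14,Oct 1 2 5 6 3 4 7 8),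
    (14,Oct 1 2 5 6 3 7 4 8), (14,Oct 1 2 5 6 3 7 8 4), (11,Oct 1 2 4 5 3 6 7 8), (14,Oct 1 2 5 6 7 3 4 8),
    (14,Oct 1 2 5 6 7 3 8 4), (11,Oct 1 2 4 5 6 3 7 8), (14,Oct 1 2 5 6 7 8 3 4), (11,Oct 1 2 4 5 6 7 3 8),
    (11,Oct 1 2 4 5 6 7 8 3), (13,Oct 1 2 3 4 5 6 7 8), (13,Oct 1 2 3 5 4 6 7 8), (13,Oct 1 2 3 5 6 4 7 8),
    (13,Oct 1 2 3 5 6 7 4 8), (13,Oct 1 2 3 5 6 7 8 4), (13,Oct 1 2 5 3 4 6 7 8), (13,Oct 1 2 5 3 6 4 7 8),
    (13,Oct 1 2 5 3 6 7 4 8), (13,Oct 1 2 5 3 6 7 8 4), (13,Oct 1 2 5 6 3 4 7 8), (13,Oct 1 2 5 6 3 7 4 8),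
    (13,Oct 1 2 5 6 3 7 8 4), (13,Oct 1 2 5 6 7 3 4 8), (13,Oct 1 2 5 6 7 3 8 4), (13,Oct 1 2 5 6 7 8 3 4),
    (13,Oct 2 1 3 4 5 6 7 8), (13,Oct 2 1 3 5 4 6 7 8), (13,Oct 2 1 3 5 6 4 7 8), (13,Oct 2 1 3 5 6 7 4 8),
    (13,Oct 2 1 3 5 6 7 8 4), (13,Oct 2 1 5 3 4 6 7 8), (13,Oct 2 1 5 3 6 4 7 8), (13,Oct 2 1 5 3 6 7 4 8),
    (13,Oct 2 1 5 3 6 7 8 4), (13,Oct 2 1 5 6 3 4 7 8), (13,Oct 2 1 5 6 3 7 4 8), (13,Oct 2 1 5 6 3 7 8 4),
    (13,Oct 2 1 5 6 7 3 4 8), (13,Oct 2 1 5 6 7 3 8 4), (13,Oct 2 1 5 6 7 8 3 4), (12,Oct 1 2 3 4 5 6 7 8),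
    (12,Oct 1 2 3 5 4 6 7 8), (12,Oct 1 2 3 5 6 4 7 8), (12,Oct 1 2 3 5 6 7 4 8), (12,Oct 1 2 3 5 6 7 8 4),
    (12,Oct 1 2 5 3 4 6 7 8), (12,Oct 1 2 5 3 6 4 7 8), (12,Oct 1 2 5 3 6 7 4 8), (12,Oct 1 2 5 3 6 7 8 4),
    (12,Oct 1 2 5 6 3 4 7 8), (12,Oct 1 2 5 6 3 7 4 8), (12,Oct 1 2 5 6 3 7 8 4), (12,Oct 1 2 5 6 7 3 4 8),
    (12,Oct 1 2 5 6 7 3 8 4), (12,Oct 1 2 5 6 7 8 3 4)],
    [(11,Oct 1 2 3 4 5 6 7 8), (11,Oct 1 3 2 4 5 6 7 8), (21,Oct 1 2 3 4 5 6 7 8), (19,Oct 1 2 3 4 5 6 7 8),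
    (19,Oct 1 2 3 4 5 6 8 7), (17,Oct 1 2 3 4 5 6 7 8), (19,Oct 1 2 3 4 5 8 6 7), (17,Oct 1 2 3 4 5 7 6 8),
    (17,Oct 1 2 3 4 5 7 8 6), (15,Oct 1 2 3 4 5 6 7 8), (19,Oct 1 2 3 4 8 5 6 7), (17,Oct 1 2 3 4 7 5 6 8),
    (17,Oct 1 2 3 4 7 5 8 6), (15,Oct 1 2 3 4 6 5 7 8), (17,Oct 1 2 3 4 7 8 5 6), (15,Oct 1 2 3 4 6 7 5 8),
    (15,Oct 1 2 3 4 6 7 8 5), (13,Oct 1 3 4 2 5 6 7 8), (19,Oct 1 2 3 8 4 5 6 7), (17,Oct 1 2 3 7 4 5 6 8),
    (17,Oct 1 2 3 7 4 5 8 6), (15,Oct 1 2 3 6 4 5 7 8), (17,Oct 1 2 3 7 4 8 5 6), (15,Oct 1 2 3 6 4 7 5 8),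
    (15,Oct 1 2 3 6 4 7 8 5), (13,Oct 1 3 4 5 2 6 7 8), (17,Oct 1 2 3 7 8 4 5 6), (15,Oct 1 2 3 6 7 4 5 8),
    (15,Oct 1 2 3 6 7 4 8 5), (13,Oct 1 3 4 5 6 2 7 8), (15,Oct 1 2 3 6 7 8 4 5), (13,Oct 1 3 4 5 6 7 2 8),
    (13,Oct 1 3 4 5 6 7 8 2), (10,Oct 1 2 3 4 5 6 7 8), (11,Oct 3 1 2 4 5 6 7 8), (21,Oct 2 1 3 4 5 6 7 8),
    (19,Oct 2 1 3 4 5 6 7 8), (19,Oct 2 1 3 4 5 6 8 7), (17,Oct 2 1 3 4 5 6 7 8), (19,Oct 2 1 3 4 5 8 6 7),
    (17,Oct 2 1 3 4 5 7 6 8), (17,Oct 2 1 3 4 5 7 8 6), (15,Oct 2 1 3 4 5 6 7 8), (19,Oct 2 1 3 4 8 5 6 7),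
    (17,Oct 2 1 3 4 7 5 6 8), (17,Oct 2 1 3 4 7 5 8 6), (15,Oct 2 1 3 4 6 5 7 8), (17,Oct 2 1 3 4 7 8 5 6),
    (15,Oct 2 1 3 4 6 7 5 8), (15,Oct 2 1 3 4 6 7 8 5), (13,Oct 3 1 4 2 5 6 7 8), (19,Oct 2 1 3 8 4 5 6 7),
    (17,Oct 2 1 3 7 4 5 6 8), (17,Oct 2 1 3 7 4 5 8 6), (15,Oct 2 1 3 6 4 5 7 8), (17,Oct 2 1 3 7 4 8 5 6),
    (15,Oct 2 1 3 6 4 7 5 8), (15,Oct 2 1 3 6 4 7 8 5), (13,Oct 3 1 4 5 2 6 7 8), (17,Oct 2 1 3 7 8 4 5 6),
    (15,Oct 2 1 3 6 7 4 5 8), (15,Oct 2 1 3 6 7 4 8 5), (13,Oct 3 1 4 5 6 2 7 8), (15,Oct 2 1 3 6 7 8 4 5),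
    (13,Oct 3 1 4 5 6 7 2 8), (13,Oct 3 1 4 5 6 7 8 2), (10,Oct 2 1 3 4 5 6 7 8), (21,Oct 2 3 1 4 5 6 7 8),
    (19,Oct 2 3 1 4 5 6 7 8), (19,Oct 2 3 1 4 5 6 8 7), (17,Oct 2 3 1 4 5 6 7 8), (19,Oct 2 3 1 4 5 8 6 7),
    (17,Oct 2 3 1 4 5 7 6 8), (17,Oct 2 3 1 4 5 7 8 6), (15,Oct 2 3 1 4 5 6 7 8), (19,Oct 2 3 1 4 8 5 6 7),
    (17,Oct 2 3 1 4 7 5 6 8), (17,Oct 2 3 1 4 7 5 8 6), (15,Oct 2 3 1 4 6 5 7 8), (17,Oct 2 3 1 4 7 8 5 6),
    (15,Oct 2 3 1 4 6 7 5 8), (15,Oct 2 3 1 4 6 7 8 5), (13,Oct 3 4 1 2 5 6 7 8), (19,Oct 2 3 1 8 4 5 6 7),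
    (17,Oct 2 3 1 7 4 5 6 8), (17,Oct 2 3 1 7 4 5 8 6), (15,Oct 2 3 1 6 4 5 7 8), (17,Oct 2 3 1 7 4 8 5 6),
    (15,Oct 2 3 1 6 4 7 5 8), (15,Oct 2 3 1 6 4 7 8 5), (13,Oct 3 4 1 5 2 6 7 8), (17,Oct 2 3 1 7 8 4 5 6),
    (15,Oct 2 3 1 6 7 4 5 8), (15,Oct 2 3 1 6 7 4 8 5), (13,Oct 3 4 1 5 6 2 7 8), (15,Oct 2 3 1 6 7 8 4 5),
    (13,Oct 3 4 1 5 6 7 2 8), (13,Oct 3 4 1 5 6 7 8 2), (10,Oct 2 3 1 4 5 6 7 8), (20,Oct 1 2 3 4 5 6 7 8),
    (18,Oct 1 2 3 4 5 6 7 8), (18,Oct 1 2 3 4 5 6 8 7), (16,Oct 1 2 3 4 5 6 7 8), (18,Oct 1 2 3 4 5 8 6 7),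
    (16,Oct 1 2 3 4 5 7 6 8), (16,Oct 1 2 3 4 5 7 8 6), (18,Oct 1 2 3 4 8 5 6 7), (16,Oct 1 2 3 4 7 5 6 8),
    (16,Oct 1 2 3 4 7 5 8 6), (16,Oct 1 2 3 4 7 8 5 6), (18,Oct 1 2 3 8 4 5 6 7), (16,Oct 1 2 3 7 4 5 6 8),
    (16,Oct 1 2 3 7 4 5 8 6), (16,Oct 1 2 3 7 4 8 5 6), (16,Oct 1 2 3 7 8 4 5 6)],
    [(14,Oct 1 2 3 4 5 6 7 8), (14,Oct 1 3 2 4 5 6 7 8), (14,Oct 1 3 4 2 5 6 7 8), (24,Oct 1 2 3 4 5 6 7 8),
    (22,Oct 1 2 3 4 5 6 7 8), (22,Oct 1 2 3 4 5 6 8 7), (17,Oct 1 4 5 6 2 3 7 8), (22,Oct 1 2 3 4 5 8 6 7),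
    (17,Oct 1 4 5 6 2 7 3 8), (17,Oct 1 4 5 6 2 7 8 3), (22,Oct 1 2 3 4 8 5 6 7), (17,Oct 1 4 5 6 7 2 3 8),
    (17,Oct 1 4 5 6 7 2 8 3), (17,Oct 1 4 5 6 7 8 2 3), (14,Oct 3 1 2 4 5 6 7 8), (14,Oct 3 1 4 2 5 6 7 8),
    (24,Oct 2 1 3 4 5 6 7 8), (22,Oct 2 1 3 4 5 6 7 8), (22,Oct 2 1 3 4 5 6 8 7), (17,Oct 4 1 5 6 2 3 7 8),
    (22,Oct 2 1 3 4 5 8 6 7), (17,Oct 4 1 5 6 2 7 3 8), (17,Oct 4 1 5 6 2 7 8 3), (22,Oct 2 1 3 4 8 5 6 7),
    (17,Oct 4 1 5 6 7 2 3 8), (17,Oct 4 1 5 6 7 2 8 3), (17,Oct 4 1 5 6 7 8 2 3), (14,Oct 3 4 1 2 5 6 7 8),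
    (24,Oct 2 3 1 4 5 6 7 8), (22,Oct 2 3 1 4 5 6 7 8), (22,Oct 2 3 1 4 5 6 8 7), (17,Oct 4 5 1 6 2 3 7 8),
    (22,Oct 2 3 1 4 5 8 6 7), (17,Oct 4 5 1 6 2 7 3 8), (17,Oct 4 5 1 6 2 7 8 3), (22,Oct 2 3 1 4 8 5 6 7),
    (17,Oct 4 5 1 6 7 2 3 8), (17,Oct 4 5 1 6 7 2 8 3), (17,Oct 4 5 1 6 7 8 2 3), (24,Oct 2 3 4 1 5 6 7 8),
    (22,Oct 2 3 4 1 5 6 7 8), (22,Oct 2 3 4 1 5 6 8 7), (17,Oct 4 5 6 1 2 3 7 8), (22,Oct 2 3 4 1 5 8 6 7),
    (17,Oct 4 5 6 1 2 7 3 8), (17,Oct 4 5 6 1 2 7 8 3), (22,Oct 2 3 4 1 8 5 6 7), (17,Oct 4 5 6 1 7 2 3 8),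
    (17,Oct 4 5 6 1 7 2 8 3), (17,Oct 4 5 6 1 7 8 2 3), (23,Oct 1 2 3 4 5 6 7 8), (18,Oct 4 5 6 7 1 2 3 8),
    (18,Oct 4 5 6 7 1 2 8 3), (18,Oct 4 5 6 7 1 8 2 3), (18,Oct 4 5 6 7 8 1 2 3)],
    [(24,Oct 1 5 6 7 8 2 3 4), (19,Oct 1 4 5 6 7 2 3 8), (19,Oct 1 4 5 6 7 2 8 3), (19,Oct 1 4 5 6 7 8 2 3),
    (24,Oct 5 1 6 7 8 2 3 4), (19,Oct 4 1 5 6 7 2 3 8), (19,Oct 4 1 5 6 7 2 8 3), (19,Oct 4 1 5 6 7 8 2 3),
    (24,Oct 5 6 1 7 8 2 3 4), (19,Oct 4 5 1 6 7 2 3 8), (19,Oct 4 5 1 6 7 2 8 3), (19,Oct 4 5 1 6 7 8 2 3),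
    (24,Oct 5 6 7 1 8 2 3 4), (19,Oct 4 5 6 1 7 2 3 8), (19,Oct 4 5 6 1 7 2 8 3), (19,Oct 4 5 6 1 7 8 2 3),
    (24,Oct 5 6 7 8 1 2 3 4), (19,Oct 4 5 6 7 1 2 3 8), (19,Oct 4 5 6 7 1 2 8 3), (19,Oct 4 5 6 7 1 8 2 3),
    (20,Oct 4 5 6 7 8 1 2 3)],
    [(21,Oct 1 4 5 6 7 8 2 3), (21,Oct 4 1 5 6 7 8 2 3), (21,Oct 4 5 1 6 7 8 2 3), (21,Oct 4 5 6 1 7 8 2 3),
    (21,Oct 4 5 6 7 1 8 2 3), (21,Oct 4 5 6 7 8 1 2 3)],
    [],
    [],
    [(25,Oct 1 2 3 4 5 6 7 8), (25,Oct 1 2 3 4 6 5 7 8), (25,Oct 1 2 3 4 6 7 5 8), (25,Oct 1 2 3 4 6 7 8 5),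
    (25,Oct 1 2 3 6 4 5 7 8), (25,Oct 1 2 3 6 4 7 5 8), (25,Oct 1 2 3 6 4 7 8 5), (25,Oct 1 2 3 6 7 4 5 8),
    (25,Oct 1 2 3 6 7 4 8 5), (25,Oct 1 2 3 6 7 8 4 5)],
    [(27,Oct 1 2 3 4 5 6 7 8), (27,Oct 1 2 3 4 6 5 7 8), (27,Oct 1 2 3 4 6 7 5 8), (27,Oct 1 2 3 4 6 7 8 5),
    (27,Oct 1 2 3 6 4 5 7 8), (27,Oct 1 2 3 6 4 7 5 8), (27,Oct 1 2 3 6 4 7 8 5), (27,Oct 1 2 3 6 7 4 5 8),
    (27,Oct 1 2 3 6 7 4 8 5), (27,Oct 1 2 3 6 7 8 4 5), (27,Oct 2 1 3 4 5 6 7 8), (27,Oct 2 1 3 4 6 5 7 8),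
    (27,Oct 2 1 3 4 6 7 5 8), (27,Oct 2 1 3 4 6 7 8 5), (27,Oct 2 1 3 6 4 5 7 8), (27,Oct 2 1 3 6 4 7 5 8),
    (27,Oct 2 1 3 6 4 7 8 5), (27,Oct 2 1 3 6 7 4 5 8), (27,Oct 2 1 3 6 7 4 8 5), (27,Oct 2 1 3 6 7 8 4 5),
    (26,Oct 1 2 3 4 5 6 7 8), (26,Oct 1 2 3 5 4 6 7 8), (26,Oct 1 2 3 5 6 4 7 8), (26,Oct 1 2 3 5 6 7 4 8),
    (26,Oct 1 2 3 5 6 7 8 4)],
    [(28,Oct 1 2 3 4 5 6 7 8), (26,Oct 1 2 3 4 5 6 7 8), (26,Oct 1 2 4 3 5 6 7 8), (26,Oct 3 4 1 2 5 6 7 8),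
    (29,Oct 1 2 3 4 5 6 7 8), (29,Oct 1 2 3 4 6 5 7 8), (29,Oct 1 2 3 4 6 7 5 8), (29,Oct 1 2 3 4 6 7 8 5),
    (29,Oct 1 2 4 3 5 6 7 8), (29,Oct 1 2 4 3 6 5 7 8), (29,Oct 1 2 4 3 6 7 5 8), (29,Oct 1 2 4 3 6 7 8 5),
    (26,Oct 4 3 1 2 5 6 7 8), (29,Oct 2 1 3 4 5 6 7 8), (29,Oct 2 1 3 4 6 5 7 8), (29,Oct 2 1 3 4 6 7 5 8),
    (29,Oct 2 1 3 4 6 7 8 5), (29,Oct 2 1 4 3 5 6 7 8), (29,Oct 2 1 4 3 6 5 7 8), (29,Oct 2 1 4 3 6 7 5 8),
    (29,Oct 2 1 4 3 6 7 8 5), (30,Oct 1 2 3 4 5 6 7 8), (30,Oct 1 2 3 4 5 7 6 8), (30,Oct 1 2 3 4 5 7 8 6),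
    (30,Oct 1 2 3 4 7 5 6 8), (30,Oct 1 2 3 4 7 5 8 6), (30,Oct 1 2 3 4 7 8 5 6)],
    [(34,Oct 1 2 3 4 5 6 7 8), (34,Oct 1 2 3 4 5 7 6 8), (34,Oct 1 2 3 4 5 7 8 6), (27,Oct 1 2 4 5 3 6 7 8),
    (34,Oct 1 2 3 4 7 5 6 8), (34,Oct 1 2 3 4 7 5 8 6), (27,Oct 1 2 4 5 6 3 7 8), (34,Oct 1 2 3 4 7 8 5 6),
    (27,Oct 1 2 4 5 6 7 3 8), (27,Oct 1 2 4 5 6 7 8 3), (32,Oct 1 2 3 4 5 6 7 8), (32,Oct 1 2 3 4 5 7 6 8),
    (32,Oct 1 2 3 4 5 7 8 6), (32,Oct 1 2 3 4 7 5 6 8), (32,Oct 1 2 3 4 7 5 8 6), (32,Oct 1 2 3 4 7 8 5 6),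
    (31,Oct 1 2 3 4 5 6 7 8), (31,Oct 1 2 3 4 6 5 7 8), (31,Oct 1 2 3 4 6 7 5 8), (31,Oct 1 2 3 4 6 7 8 5),
    (31,Oct 1 2 4 3 5 6 7 8), (31,Oct 1 2 4 3 6 5 7 8), (31,Oct 1 2 4 3 6 7 5 8), (31,Oct 1 2 4 3 6 7 8 5),
    (33,Oct 1 2 3 4 5 6 7 8), (33,Oct 1 2 3 4 5 7 6 8), (33,Oct 1 2 3 4 5 7 8 6), (33,Oct 1 2 3 4 7 5 6 8),
    (33,Oct 1 2 3 4 7 5 8 6), (33,Oct 1 2 3 4 7 8 5 6), (26,Oct 3 4 1 2 5 6 7 8), (29,Oct 1 2 3 5 4 6 7 8),
    (29,Oct 1 2 3 5 6 4 7 8), (29,Oct 1 2 3 5 6 7 4 8), (29,Oct 1 2 3 5 6 7 8 4), (29,Oct 1 2 5 3 4 6 7 8),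
    (29,Oct 1 2 5 3 6 4 7 8), (29,Oct 1 2 5 3 6 7 4 8), (29,Oct 1 2 5 3 6 7 8 4)],
    [(34,Oct 1 2 5 6 3 4 7 8), (34,Oct 1 2 5 6 3 7 4 8), (34,Oct 1 2 5 6 3 7 8 4), (34,Oct 1 2 5 6 7 3 4 8),
    (34,Oct 1 2 5 6 7 3 8 4), (34,Oct 1 2 5 6 7 8 3 4), (34,Oct 2 1 5 6 3 4 7 8), (34,Oct 2 1 5 6 3 7 4 8),
    (34,Oct 2 1 5 6 3 7 8 4), (34,Oct 2 1 5 6 7 3 4 8), (34,Oct 2 1 5 6 7 3 8 4), (34,Oct 2 1 5 6 7 8 3 4),
    (28,Oct 1 2 3 4 5 6 7 8)],
    [(27,Oct 1 2 3 4 5 6 7 8), (27,Oct 1 3 2 4 5 6 7 8), (27,Oct 1 4 5 2 3 6 7 8), (27,Oct 1 4 5 3 2 6 7 8),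
    (40,Oct 1 2 3 4 5 6 7 8), (36,Oct 1 2 3 4 5 6 7 8), (36,Oct 1 2 3 4 5 6 8 7), (32,Oct 1 3 4 5 6 2 7 8),
    (36,Oct 1 2 3 4 5 8 6 7), (32,Oct 1 3 4 5 6 7 2 8), (32,Oct 1 3 4 5 6 7 8 2), (25,Oct 1 2 3 4 5 6 7 8),
    (42,Oct 1 2 3 4 5 6 7 8), (38,Oct 1 2 3 4 5 6 7 8), (38,Oct 1 2 3 4 5 6 8 7), (35,Oct 1 2 3 4 5 6 7 8),
    (38,Oct 1 2 3 4 5 8 6 7), (35,Oct 1 2 3 4 5 7 6 8), (35,Oct 1 2 3 4 5 7 8 6), (31,Oct 3 1 4 2 5 6 7 8),
    (42,Oct 1 2 3 5 4 6 7 8), (38,Oct 1 2 3 5 4 6 7 8), (38,Oct 1 2 3 5 4 6 8 7), (35,Oct 1 2 3 5 4 6 7 8),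
    (38,Oct 1 2 3 5 4 8 6 7), (35,Oct 1 2 3 5 4 7 6 8), (35,Oct 1 2 3 5 4 7 8 6), (31,Oct 3 1 4 5 2 6 7 8),
    (41,Oct 1 2 3 4 5 6 7 8), (37,Oct 1 2 3 4 5 6 7 8), (37,Oct 1 2 3 4 5 6 8 7), (37,Oct 1 2 3 4 5 8 6 7),
    (42,Oct 1 3 2 4 5 6 7 8), (38,Oct 1 3 2 4 5 6 7 8), (38,Oct 1 3 2 4 5 6 8 7), (35,Oct 1 3 2 4 5 6 7 8),
    (38,Oct 1 3 2 4 5 8 6 7), (35,Oct 1 3 2 4 5 7 6 8), (35,Oct 1 3 2 4 5 7 8 6), (31,Oct 3 4 1 2 5 6 7 8),
    (42,Oct 1 3 2 5 4 6 7 8), (38,Oct 1 3 2 5 4 6 7 8), (38,Oct 1 3 2 5 4 6 8 7), (35,Oct 1 3 2 5 4 6 7 8),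
    (38,Oct 1 3 2 5 4 8 6 7), (35,Oct 1 3 2 5 4 7 6 8), (35,Oct 1 3 2 5 4 7 8 6), (31,Oct 3 4 1 5 2 6 7 8),
    (41,Oct 1 3 2 4 5 6 7 8), (37,Oct 1 3 2 4 5 6 7 8), (37,Oct 1 3 2 4 5 6 8 7), (37,Oct 1 3 2 4 5 8 6 7),
    (41,Oct 1 4 5 2 3 6 7 8), (37,Oct 1 4 5 2 3 6 7 8), (37,Oct 1 4 5 2 3 6 8 7), (37,Oct 1 4 5 2 3 8 6 7),
    (41,Oct 1 4 5 3 2 6 7 8), (37,Oct 1 4 5 3 2 6 7 8), (37,Oct 1 4 5 3 2 6 8 7), (37,Oct 1 4 5 3 2 8 6 7),
    (39,Oct 1 2 3 4 5 6 7 8)],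
    [(43,Oct 1 2 3 4 5 6 7 8), (37,Oct 1 4 5 2 6 7 3 8), (37,Oct 1 4 5 2 6 7 8 3), (33,Oct 1 3 4 2 5 6 7 8),
    (43,Oct 1 2 3 5 4 6 7 8), (37,Oct 1 4 5 6 2 7 3 8), (37,Oct 1 4 5 6 2 7 8 3), (33,Oct 1 3 4 5 2 6 7 8),
    (43,Oct 1 2 3 5 6 4 7 8), (37,Oct 1 4 5 6 7 2 3 8), (37,Oct 1 4 5 6 7 2 8 3), (33,Oct 1 3 4 5 6 2 7 8),
    (39,Oct 1 2 3 6 7 8 4 5), (43,Oct 2 1 3 4 5 6 7 8), (37,Oct 4 1 5 2 6 7 3 8), (37,Oct 4 1 5 2 6 7 8 3),
    (33,Oct 3 1 4 2 5 6 7 8), (43,Oct 2 1 3 5 4 6 7 8), (37,Oct 4 1 5 6 2 7 3 8), (37,Oct 4 1 5 6 2 7 8 3),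
    (33,Oct 3 1 4 5 2 6 7 8), (43,Oct 2 1 3 5 6 4 7 8), (37,Oct 4 1 5 6 7 2 3 8), (37,Oct 4 1 5 6 7 2 8 3),
    (33,Oct 3 1 4 5 6 2 7 8), (39,Oct 2 1 3 6 7 8 4 5), (43,Oct 2 3 1 4 5 6 7 8), (37,Oct 4 5 1 2 6 7 3 8),
    (37,Oct 4 5 1 2 6 7 8 3), (33,Oct 3 4 1 2 5 6 7 8), (43,Oct 2 3 1 5 4 6 7 8), (37,Oct 4 5 1 6 2 7 3 8),
    (37,Oct 4 5 1 6 2 7 8 3), (33,Oct 3 4 1 5 2 6 7 8), (43,Oct 2 3 1 5 6 4 7 8), (37,Oct 4 5 1 6 7 2 3 8),
    (37,Oct 4 5 1 6 7 2 8 3), (33,Oct 3 4 1 5 6 2 7 8), (39,Oct 2 3 1 6 7 8 4 5), (39,Oct 6 7 8 1 2 3 4 5),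
    (39,Oct 6 7 8 2 1 3 4 5), (39,Oct 6 7 8 2 3 1 4 5)],
    [(34,Oct 1 3 4 2 5 6 7 8), (34,Oct 1 3 4 5 2 6 7 8), (34,Oct 1 3 4 5 6 2 7 8), (40,Oct 1 2 3 6 7 8 4 5),
    (44,Oct 1 2 3 4 5 6 7 8), (38,Oct 2 1 3 4 6 7 5 8), (38,Oct 2 1 3 4 6 7 8 5), (44,Oct 1 2 3 5 4 6 7 8),
    (38,Oct 2 1 3 6 4 7 5 8), (38,Oct 2 1 3 6 4 7 8 5), (44,Oct 1 2 3 5 6 4 7 8), (38,Oct 2 1 3 6 7 4 5 8),
    (38,Oct 2 1 3 6 7 4 8 5), (41,Oct 2 1 3 6 7 8 4 5), (44,Oct 1 3 2 4 5 6 7 8), (38,Oct 2 3 1 4 6 7 5 8),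
    (38,Oct 2 3 1 4 6 7 8 5), (44,Oct 1 3 2 5 4 6 7 8), (38,Oct 2 3 1 6 4 7 5 8), (38,Oct 2 3 1 6 4 7 8 5),
    (44,Oct 1 3 2 5 6 4 7 8), (38,Oct 2 3 1 6 7 4 5 8), (38,Oct 2 3 1 6 7 4 8 5), (41,Oct 2 3 1 6 7 8 4 5),
    (43,Oct 1 2 3 4 7 8 5 6), (43,Oct 1 2 3 7 4 8 5 6), (43,Oct 1 2 3 7 8 4 5 6)],
    [(41,Oct 1 4 5 2 6 7 8 3), (41,Oct 1 4 5 6 2 7 8 3), (41,Oct 1 4 5 6 7 2 8 3), (41,Oct 1 4 5 6 7 8 2 3),
    (41,Oct 4 1 5 2 6 7 8 3), (41,Oct 4 1 5 6 2 7 8 3), (41,Oct 4 1 5 6 7 2 8 3), (41,Oct 4 1 5 6 7 8 2 3),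
    (41,Oct 4 5 1 2 6 7 8 3), (41,Oct 4 5 1 6 2 7 8 3), (41,Oct 4 5 1 6 7 2 8 3), (41,Oct 4 5 1 6 7 8 2 3)],
    [(42,Oct 2 1 3 4 6 7 8 5), (42,Oct 2 1 3 6 4 7 8 5), (42,Oct 2 1 3 6 7 4 8 5), (42,Oct 2 1 3 6 7 8 4 5),
    (42,Oct 2 3 1 4 6 7 8 5), (42,Oct 2 3 1 6 4 7 8 5), (42,Oct 2 3 1 6 7 4 8 5), (42,Oct 2 3 1 6 7 8 4 5)],
    [],
    [],
    [(44,Oct 4 1 5 6 2 7 8 3), (44,Oct 4 1 5 6 7 2 8 3), (44,Oct 4 1 5 6 7 8 2 3), (44,Oct 4 5 1 6 2 7 8 3),
    (44,Oct 4 5 1 6 7 2 8 3), (44,Oct 4 5 1 6 7 8 2 3), (44,Oct 4 5 6 1 2 7 8 3), (44,Oct 4 5 6 1 7 2 8 3),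
    (44,Oct 4 5 6 1 7 8 2 3)],
    [],
    [],
    [(45,Oct 1 2 3 4 5 6 7 8), (45,Oct 1 2 3 4 5 6 8 7), (45,Oct 1 2 3 4 5 8 6 7)],
    [(46,Oct 1 2 3 4 5 6 7 8), (46,Oct 1 2 3 4 6 5 7 8), (46,Oct 1 2 3 4 6 7 5 8), (46,Oct 1 2 3 4 6 7 8 5),
    (46,Oct 2 1 3 4 5 6 7 8), (46,Oct 2 1 3 4 6 5 7 8), (46,Oct 2 1 3 4 6 7 5 8), (46,Oct 2 1 3 4 6 7 8 5)],
    [(48,Oct 1 2 3 4 5 6 7 8), (48,Oct 1 2 3 4 5 6 8 7), (48,Oct 1 2 3 4 5 8 6 7), (47,Oct 1 2 3 4 5 6 7 8),
    (47,Oct 1 2 3 4 5 7 6 8), (47,Oct 1 2 3 4 5 7 8 6), (47,Oct 1 2 3 5 4 6 7 8), (47,Oct 1 2 3 5 4 7 6 8),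
    (47,Oct 1 2 3 5 4 7 8 6), (49,Oct 1 2 3 4 5 6 7 8), (49,Oct 1 2 3 4 5 6 8 7), (49,Oct 1 2 3 4 5 8 6 7),
    (46,Oct 1 2 3 4 5 6 7 8), (46,Oct 1 2 3 5 4 6 7 8)],
    [],
    [(46,Oct 1 2 4 3 5 6 7 8), (51,Oct 3 4 1 2 5 6 7 8), (51,Oct 3 4 1 2 5 7 6 8), (51,Oct 3 4 1 2 5 7 8 6),
    (46,Oct 4 3 1 2 5 6 7 8), (51,Oct 1 2 3 4 5 6 7 8), (51,Oct 1 2 3 4 5 7 6 8), (51,Oct 1 2 3 4 5 7 8 6),
    (50,Oct 1 2 3 4 5 6 7 8), (52,Oct 1 2 3 4 5 6 7 8), (52,Oct 1 2 3 4 5 7 6 8), (52,Oct 1 2 3 4 5 7 8 6),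
    (53,Oct 1 2 3 4 5 6 7 8), (53,Oct 1 2 3 4 5 7 6 8), (53,Oct 1 2 3 4 5 7 8 6)],
    [(53,Oct 1 2 3 4 5 6 7 8), (53,Oct 1 2 3 4 6 5 7 8), (53,Oct 1 2 4 3 5 6 7 8), (53,Oct 1 2 4 3 6 5 7 8),
    (53,Oct 2 1 3 4 5 6 7 8), (53,Oct 2 1 3 4 6 5 7 8), (53,Oct 2 1 4 3 5 6 7 8), (53,Oct 2 1 4 3 6 5 7 8),
    (54,Oct 1 2 3 4 5 6 7 8)],
    [(57,Oct 1 2 3 4 5 6 7 8), (57,Oct 1 2 3 4 5 6 8 7), (47,Oct 1 2 4 5 6 3 7 8), (57,Oct 1 2 3 4 5 8 6 7),
    (47,Oct 1 2 4 5 6 7 3 8), (47,Oct 1 2 4 5 6 7 8 3), (55,Oct 2 1 3 5 4 6 7 8), (55,Oct 2 1 3 5 4 7 6 8),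
    (55,Oct 2 1 3 5 4 7 8 6), (56,Oct 1 2 3 4 5 6 7 8), (56,Oct 1 2 3 4 5 6 8 7), (56,Oct 1 2 3 4 5 8 6 7),
    (55,Oct 1 2 3 4 5 6 7 8), (55,Oct 1 2 3 4 5 7 6 8), (55,Oct 1 2 3 4 5 7 8 6), (56,Oct 2 1 3 5 4 6 7 8),
    (56,Oct 2 1 3 5 4 6 8 7), (56,Oct 2 1 3 5 4 8 6 7), (46,Oct 3 4 1 2 5 6 7 8), (46,Oct 4 3 1 5 2 6 7 8),
    (51,Oct 1 2 3 5 6 4 7 8), (51,Oct 1 2 3 5 6 7 4 8), (51,Oct 1 2 3 5 6 7 8 4), (50,Oct 1 2 5 3 4 6 7 8)],
    [(60,Oct 1 2 3 4 5 6 7 8), (48,Oct 1 2 4 5 6 7 3 8), (48,Oct 1 2 4 5 6 7 8 3), (58,Oct 1 2 3 4 5 6 7 8),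
    (55,Oct 2 1 3 5 4 6 7 8), (55,Oct 2 1 3 5 6 4 7 8), (56,Oct 1 2 3 4 6 7 5 8), (56,Oct 1 2 3 4 6 7 8 5),
    (55,Oct 2 1 5 3 4 6 7 8), (55,Oct 2 1 5 3 6 4 7 8), (56,Oct 1 2 4 3 6 7 5 8), (56,Oct 1 2 4 3 6 7 8 5),
    (56,Oct 1 2 6 7 3 4 5 8), (56,Oct 1 2 6 7 3 4 8 5), (56,Oct 1 2 6 7 4 3 5 8), (56,Oct 1 2 6 7 4 3 8 5),
    (59,Oct 1 2 3 4 5 6 7 8), (51,Oct 3 4 1 5 2 6 7 8), (51,Oct 3 4 1 5 6 2 7 8), (51,Oct 3 4 5 1 2 6 7 8),
    (51,Oct 3 4 5 1 6 2 7 8)],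
    [(61,Oct 1 2 3 4 5 6 7 8), (49,Oct 1 2 4 5 6 7 3 8), (49,Oct 1 2 4 5 6 7 8 3), (56,Oct 1 2 6 7 3 5 4 8),
    (56,Oct 1 2 6 7 3 5 8 4), (56,Oct 1 2 6 7 5 3 4 8), (56,Oct 1 2 6 7 5 3 8 4), (59,Oct 1 2 3 4 7 8 5 6),
    (56,Oct 2 1 3 5 6 7 4 8), (56,Oct 2 1 3 5 6 7 8 4), (56,Oct 2 1 5 3 6 7 4 8), (56,Oct 2 1 5 3 6 7 8 4),
    (59,Oct 2 1 7 8 3 4 5 6), (52,Oct 1 2 3 5 4 6 7 8), (52,Oct 1 2 3 5 6 4 7 8), (52,Oct 1 2 5 3 4 6 7 8),
    (52,Oct 1 2 5 3 6 4 7 8)],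
    [(60,Oct 1 2 3 4 7 8 5 6), (57,Oct 1 2 3 4 6 7 5 8), (57,Oct 1 2 3 4 6 7 8 5), (57,Oct 1 2 4 3 6 7 5 8),
    (57,Oct 1 2 4 3 6 7 8 5), (61,Oct 1 2 3 4 7 8 5 6)],
    [(47,Oct 1 2 3 4 5 6 7 8), (47,Oct 1 4 5 2 3 6 7 8), (68,Oct 4 1 5 2 6 3 7 8), (63,Oct 4 1 5 2 6 3 7 8),
    (63,Oct 4 1 5 2 6 3 8 7), (55,Oct 2 3 5 4 6 1 7 8), (66,Oct 1 2 3 4 5 6 7 8), (47,Oct 4 1 5 2 6 3 7 8),
    (68,Oct 1 4 5 2 3 6 7 8), (63,Oct 1 4 5 2 3 6 7 8), (63,Oct 1 4 5 2 3 6 8 7), (55,Oct 3 2 5 4 1 6 7 8),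
    (66,Oct 2 1 3 4 6 5 7 8), (68,Oct 1 2 3 4 5 6 7 8), (63,Oct 1 2 3 4 5 6 7 8), (63,Oct 1 2 3 4 5 6 8 7),
    (55,Oct 3 4 1 2 5 6 7 8), (70,Oct 1 2 3 4 5 6 7 8), (65,Oct 1 2 3 4 5 6 7 8), (65,Oct 1 2 3 4 5 6 8 7),
    (62,Oct 1 2 3 4 5 6 7 8), (69,Oct 1 2 3 4 5 6 7 8), (64,Oct 1 2 3 4 5 6 7 8), (64,Oct 1 2 3 4 5 6 8 7),
    (69,Oct 2 1 3 4 6 5 7 8), (64,Oct 2 1 3 4 6 5 7 8), (64,Oct 2 1 3 4 6 5 8 7), (67,Oct 1 2 3 4 5 6 7 8),
    (66,Oct 2 4 6 1 3 5 7 8), (69,Oct 2 4 6 1 3 5 7 8), (64,Oct 2 4 6 1 3 5 7 8), (64,Oct 2 4 6 1 3 5 8 7),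
    (67,Oct 1 4 5 2 3 6 7 8), (67,Oct 4 1 5 2 6 3 7 8)],
    [(48,Oct 1 2 3 4 5 6 7 8), (48,Oct 1 3 2 4 5 6 7 8), (48,Oct 1 4 5 2 3 6 7 8), (48,Oct 1 4 5 3 2 6 7 8),
    (48,Oct 1 4 5 6 7 2 3 8), (48,Oct 1 4 5 6 7 3 2 8), (58,Oct 1 3 4 5 6 7 8 2), (45,Oct 1 2 3 4 5 6 7 8),
    (71,Oct 1 2 3 4 5 6 7 8), (63,Oct 4 1 5 2 6 3 7 8), (71,Oct 1 2 3 4 5 7 6 8), (63,Oct 4 1 5 2 6 7 3 8),
    (66,Oct 1 2 3 4 5 7 8 6), (71,Oct 1 2 3 5 4 6 7 8), (63,Oct 4 1 5 6 2 3 7 8), (71,Oct 1 2 3 5 4 7 6 8),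
    (63,Oct 4 1 5 6 2 7 3 8), (66,Oct 1 2 3 5 4 7 8 6), (66,Oct 1 2 3 7 8 4 5 6), (66,Oct 1 2 3 7 8 5 4 6),
    (71,Oct 1 3 2 4 5 6 7 8), (63,Oct 4 5 1 2 6 3 7 8), (71,Oct 1 3 2 4 5 7 6 8), (63,Oct 4 5 1 2 6 7 3 8),
    (66,Oct 1 3 2 4 5 7 8 6), (71,Oct 1 3 2 5 4 6 7 8), (63,Oct 4 5 1 6 2 3 7 8), (71,Oct 1 3 2 5 4 7 6 8),
    (63,Oct 4 5 1 6 2 7 3 8), (66,Oct 1 3 2 5 4 7 8 6), (66,Oct 1 3 2 7 8 4 5 6), (66,Oct 1 3 2 7 8 5 4 6),
    (66,Oct 1 7 8 2 3 4 5 6), (66,Oct 1 7 8 2 3 5 4 6), (66,Oct 1 7 8 3 2 4 5 6), (66,Oct 1 7 8 3 2 5 4 6)],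
    [(49,Oct 1 2 3 4 5 6 7 8), (66,Oct 1 2 3 7 8 4 6 5), (56,Oct 1 3 4 6 7 2 5 8), (66,Oct 1 2 3 7 8 6 4 5),
    (56,Oct 1 3 4 6 7 5 2 8), (66,Oct 2 1 3 4 6 7 8 5), (56,Oct 3 1 4 2 5 6 7 8), (66,Oct 2 1 3 6 4 7 8 5),
    (56,Oct 3 1 4 5 2 6 7 8), (73,Oct 1 2 3 4 5 6 7 8), (64,Oct 2 3 1 4 6 5 7 8), (73,Oct 1 2 3 4 5 7 6 8),
    (64,Oct 2 3 1 4 6 7 5 8), (67,Oct 1 3 2 4 5 7 8 6), (73,Oct 1 2 3 5 4 6 7 8), (64,Oct 2 3 1 6 4 5 7 8),
    (73,Oct 1 2 3 5 4 7 6 8), (64,Oct 2 3 1 6 4 7 5 8), (67,Oct 1 3 2 5 4 7 8 6), (67,Oct 3 1 2 7 8 4 5 6),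
    (67,Oct 3 1 2 7 8 5 4 6), (72,Oct 1 2 3 4 5 6 7 8), (72,Oct 1 2 3 4 5 7 6 8), (72,Oct 1 2 3 5 4 6 7 8),
    (72,Oct 1 2 3 5 4 7 6 8)],
    [(71,Oct 1 2 3 4 5 6 8 7), (71,Oct 1 2 3 4 5 8 6 7), (57,Oct 3 1 4 2 5 6 7 8), (68,Oct 1 4 5 3 2 7 8 6),
    (68,Oct 1 3 2 4 5 7 8 6), (74,Oct 1 2 3 4 5 6 7 8), (65,Oct 1 3 2 5 4 6 7 8), (74,Oct 1 2 3 4 5 7 6 8),
    (65,Oct 1 3 2 5 4 7 6 8), (69,Oct 1 3 2 5 4 7 8 6), (73,Oct 1 3 2 4 5 6 8 7), (73,Oct 1 3 2 4 5 8 6 7),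
    (73,Oct 1 4 5 3 2 6 8 7), (73,Oct 1 4 5 3 2 8 6 7)],
    [(59,Oct 1 3 4 5 6 2 7 8), (59,Oct 1 3 4 5 6 7 2 8), (59,Oct 1 3 4 5 6 7 8 2), (67,Oct 4 1 5 2 6 3 7 8),
    (67,Oct 4 1 5 2 6 7 3 8), (67,Oct 4 1 5 2 6 7 8 3), (67,Oct 4 1 5 6 2 3 7 8), (67,Oct 4 1 5 6 2 7 3 8),
    (67,Oct 4 1 5 6 2 7 8 3), (67,Oct 4 5 1 2 6 3 7 8), (67,Oct 4 5 1 2 6 7 3 8), (67,Oct 4 5 1 2 6 7 8 3),
    (67,Oct 4 5 1 6 2 3 7 8), (67,Oct 4 5 1 6 2 7 3 8), (67,Oct 4 5 1 6 2 7 8 3)],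
    [(60,Oct 1 3 4 5 6 2 7 8), (60,Oct 1 3 4 5 6 7 2 8), (60,Oct 1 3 4 5 6 7 8 2), (68,Oct 4 1 5 2 6 3 7 8),
    (68,Oct 4 1 5 2 6 7 3 8), (68,Oct 4 1 5 2 6 7 8 3), (68,Oct 4 1 5 6 2 3 7 8), (68,Oct 4 1 5 6 2 7 3 8),
    (68,Oct 4 1 5 6 2 7 8 3), (68,Oct 4 5 1 2 6 3 7 8), (68,Oct 4 5 1 2 6 7 3 8), (68,Oct 4 5 1 2 6 7 8 3),
    (68,Oct 4 5 1 6 2 3 7 8), (68,Oct 4 5 1 6 2 7 3 8), (68,Oct 4 5 1 6 2 7 8 3)],
    [(69,Oct 2 3 1 4 6 5 7 8), (69,Oct 2 3 1 4 6 7 5 8), (69,Oct 2 3 1 4 6 7 8 5), (69,Oct 2 3 1 6 4 5 7 8),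
    (69,Oct 2 3 1 6 4 7 5 8), (69,Oct 2 3 1 6 4 7 8 5)],
    [(70,Oct 1 3 2 5 4 6 7 8), (70,Oct 1 3 2 5 4 7 6 8), (70,Oct 1 3 2 5 4 7 8 6)],
    [(61,Oct 1 3 4 2 5 6 7 8), (73,Oct 4 1 5 6 2 7 3 8), (73,Oct 4 1 5 6 2 7 8 3), (73,Oct 4 1 5 6 7 2 3 8),
    (73,Oct 4 1 5 6 7 2 8 3), (73,Oct 4 5 1 6 2 7 3 8), (73,Oct 4 5 1 6 2 7 8 3), (73,Oct 4 5 1 6 7 2 3 8),
    (73,Oct 4 5 1 6 7 2 8 3)],
    [(74,Oct 2 3 1 6 4 7 5 8), (74,Oct 2 3 1 6 4 7 8 5), (74,Oct 2 3 1 6 7 4 5 8), (74,Oct 2 3 1 6 7 4 8 5)],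
    [],
    [(75,Oct 1 2 3 4 5 6 7 8), (75,Oct 1 2 3 4 5 7 6 8), (75,Oct 1 2 3 4 5 7 8 6)],
    [(76,Oct 2 1 3 4 6 5 7 8), (76,Oct 2 1 3 4 6 5 8 7), (77,Oct 1 2 3 4 5 6 7 8), (76,Oct 1 2 3 4 5 6 7 8),
    (76,Oct 1 2 3 4 5 6 8 7), (77,Oct 2 1 3 4 6 5 7 8), (75,Oct 1 2 3 4 5 6 7 8)],
    [(76,Oct 2 1 3 4 6 5 7 8), (76,Oct 2 1 3 4 6 7 5 8), (77,Oct 1 2 3 4 5 7 8 6), (76,Oct 2 1 3 6 4 5 7 8),
    (76,Oct 2 1 3 6 4 7 5 8), (77,Oct 1 2 3 5 4 7 8 6), (77,Oct 1 2 3 7 8 4 5 6), (77,Oct 1 2 3 7 8 5 4 6)],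
    [(77,Oct 1 2 3 7 8 4 6 5), (77,Oct 1 2 3 7 8 6 4 5), (77,Oct 2 1 3 4 6 7 8 5), (77,Oct 2 1 3 6 4 7 8 5)],
    [(78,Oct 2 1 4 3 5 6 7 8), (78,Oct 2 1 4 3 5 7 6 8), (78,Oct 2 1 4 3 5 7 8 6), (78,Oct 1 2 3 4 5 6 7 8),
    (78,Oct 1 2 3 4 5 7 6 8), (78,Oct 1 2 3 4 5 7 8 6), (79,Oct 1 2 3 4 5 6 7 8), (79,Oct 1 2 3 4 5 7 6 8),
    (79,Oct 1 2 3 4 5 7 8 6)],
    [(75,Oct 1 2 4 3 5 6 7 8), (78,Oct 2 1 3 4 6 5 7 8), (80,Oct 1 2 3 4 5 6 7 8), (80,Oct 1 2 3 4 5 6 8 7),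
    (78,Oct 1 2 3 4 5 6 7 8), (80,Oct 2 1 3 4 6 5 7 8), (80,Oct 2 1 3 4 6 5 8 7), (79,Oct 1 2 5 6 3 4 7 8)],
    [(80,Oct 1 2 4 3 7 6 5 8), (80,Oct 1 2 4 3 7 6 8 5), (80,Oct 2 1 3 4 6 7 5 8), (80,Oct 2 1 3 4 6 7 8 5),
    (81,Oct 1 2 3 4 5 6 7 8)],
    [(79,Oct 5 6 1 2 3 4 7 8), (79,Oct 1 2 5 6 3 4 7 8), (79,Oct 1 2 3 4 5 6 7 8), (81,Oct 1 2 3 4 5 6 7 8)],
    [],
    [(86,Oct 1 2 3 4 5 6 7 8), (76,Oct 1 2 4 5 6 7 3 8), (76,Oct 1 2 4 5 6 7 8 3), (82,Oct 1 2 3 4 5 6 7 8),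
    (83,Oct 1 2 3 4 5 6 7 8), (83,Oct 1 2 3 4 5 6 8 7), (83,Oct 1 2 4 3 6 5 7 8), (83,Oct 1 2 4 3 6 5 8 7),
    (84,Oct 1 2 3 4 5 6 7 8), (85,Oct 1 2 3 4 5 6 7 8), (75,Oct 3 4 1 2 5 6 7 8), (78,Oct 1 2 3 5 6 4 7 8),
    (78,Oct 1 2 5 3 4 6 7 8)],
    [(77,Oct 1 2 4 5 6 7 8 3), (85,Oct 2 1 3 5 4 7 8 6), (83,Oct 1 2 4 3 6 5 7 8), (83,Oct 1 2 4 3 6 7 5 8),
    (84,Oct 1 2 3 4 5 7 8 6), (87,Oct 1 2 3 4 5 6 7 8), (87,Oct 1 2 3 4 5 7 6 8), (80,Oct 1 2 3 5 6 4 7 8),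
    (80,Oct 1 2 3 5 6 7 4 8)],
    [(86,Oct 2 1 3 5 4 7 8 6), (86,Oct 1 2 3 4 5 7 8 6)],
    [(85,Oct 2 1 3 5 4 6 7 8), (85,Oct 2 1 3 5 6 4 7 8), (85,Oct 2 1 3 5 7 8 4 6), (85,Oct 2 1 3 5 7 8 6 4),
    (85,Oct 2 1 5 3 4 6 7 8), (85,Oct 2 1 5 3 6 4 7 8), (85,Oct 2 1 5 3 7 8 4 6), (85,Oct 2 1 5 3 7 8 6 4),
    (85,Oct 2 1 7 8 3 5 4 6), (85,Oct 2 1 7 8 3 5 6 4), (85,Oct 2 1 7 8 5 3 4 6), (85,Oct 2 1 7 8 5 3 6 4)],
    [(84,Oct 2 1 3 5 4 6 7 8), (84,Oct 2 1 3 5 6 4 7 8), (84,Oct 2 1 5 3 4 6 7 8), (84,Oct 2 1 5 3 6 4 7 8)],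
    [(86,Oct 2 1 3 5 4 6 7 8), (86,Oct 2 1 3 5 6 4 7 8), (86,Oct 2 1 5 3 4 6 7 8), (86,Oct 2 1 5 3 6 4 7 8)],
    [],
    [(90,Oct 3 1 2 5 6 4 7 8), (88,Oct 3 1 2 5 6 4 7 8), (88,Oct 3 1 2 5 6 4 8 7), (82,Oct 1 3 4 5 6 2 7 8),
    (89,Oct 1 2 3 4 5 6 7 8), (90,Oct 1 3 2 5 4 6 7 8), (88,Oct 1 3 2 5 4 6 7 8), (88,Oct 1 3 2 5 4 6 8 7),
    (82,Oct 3 1 4 5 2 6 7 8), (89,Oct 2 1 3 4 6 5 7 8), (90,Oct 1 2 3 4 5 6 7 8), (88,Oct 1 2 3 4 5 6 7 8),
    (88,Oct 1 2 3 4 5 6 8 7), (82,Oct 3 4 1 2 5 6 7 8), (89,Oct 2 3 1 6 4 5 7 8), (89,Oct 2 4 6 1 3 5 7 8),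
    (89,Oct 2 6 4 3 1 5 7 8), (89,Oct 6 2 4 3 5 1 7 8)],
    [(76,Oct 1 4 5 2 3 6 7 8), (94,Oct 3 1 2 4 7 5 6 8), (88,Oct 3 1 2 4 7 5 6 8), (92,Oct 2 1 3 4 6 5 7 8),
    (92,Oct 2 3 1 4 6 7 5 8), (76,Oct 4 1 5 2 6 3 7 8), (94,Oct 1 3 2 4 5 7 6 8), (88,Oct 1 3 2 4 5 7 6 8),
    (92,Oct 1 2 3 4 5 6 7 8), (92,Oct 3 2 1 4 7 6 5 8), (76,Oct 4 5 1 2 6 7 3 8), (94,Oct 1 2 3 4 5 6 7 8),
    (88,Oct 1 2 3 4 5 6 7 8), (92,Oct 1 3 2 4 5 7 6 8), (92,Oct 3 1 2 4 7 5 6 8), (95,Oct 1 2 3 4 5 6 7 8),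
    (91,Oct 1 2 3 4 5 6 7 8), (93,Oct 1 2 3 4 5 6 7 8), (93,Oct 1 3 2 4 5 7 6 8), (93,Oct 3 1 2 4 7 5 6 8)],
    [(98,Oct 1 2 3 4 5 6 7 8), (91,Oct 4 1 5 2 6 3 7 8), (93,Oct 4 1 5 2 6 3 8 7), (93,Oct 4 5 1 6 2 8 3 7),
    (92,Oct 1 2 3 5 4 8 7 6), (83,Oct 3 1 4 5 2 7 6 8), (96,Oct 1 3 2 5 4 7 6 8), (92,Oct 1 3 2 4 5 7 8 6),
    (83,Oct 3 4 1 2 5 6 7 8), (96,Oct 1 2 3 4 5 6 7 8), (96,Oct 1 5 4 3 2 7 6 8), (96,Oct 1 4 5 2 3 6 7 8),
    (97,Oct 1 2 3 4 5 6 7 8)],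
    [(94,Oct 4 1 5 2 6 3 8 7), (99,Oct 1 2 3 4 5 6 7 8), (94,Oct 1 4 5 2 3 6 8 7), (99,Oct 2 1 3 4 6 5 7 8),
    (94,Oct 1 2 3 4 5 6 8 7), (99,Oct 2 4 6 1 3 5 7 8)],
    [(77,Oct 1 2 3 4 5 6 7 8), (77,Oct 1 4 5 2 3 6 7 8), (85,Oct 2 3 5 4 6 1 7 8), (92,Oct 2 4 6 3 1 7 5 8),
    (92,Oct 2 4 6 3 1 7 8 5), (92,Oct 2 3 1 4 6 7 5 8), (92,Oct 2 3 1 4 6 7 8 5), (99,Oct 1 2 3 4 5 6 7 8),
    (99,Oct 1 2 3 4 5 6 8 7), (89,Oct 1 2 3 4 5 6 7 8), (93,Oct 4 5 1 6 2 8 3 7), (93,Oct 4 5 1 6 2 8 7 3),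
    (96,Oct 3 1 2 5 7 4 6 8), (96,Oct 3 1 2 5 7 4 8 6), (96,Oct 3 5 7 1 2 4 6 8), (96,Oct 3 5 7 1 2 4 8 6)],
    [(93,Oct 4 1 5 3 7 2 6 8), (93,Oct 4 1 5 3 7 2 8 6), (93,Oct 1 4 5 3 2 7 6 8), (93,Oct 1 4 5 3 2 7 8 6),
    (84,Oct 3 4 1 2 5 6 7 8), (89,Oct 2 3 1 6 4 5 7 8), (97,Oct 2 4 6 1 3 5 7 8), (97,Oct 2 4 6 1 3 5 8 7)],
    [(94,Oct 4 1 5 3 7 2 6 8), (94,Oct 4 1 5 3 7 2 8 6), (94,Oct 1 4 5 3 2 7 6 8), (94,Oct 1 4 5 3 2 7 8 6),
    (86,Oct 3 4 1 2 5 6 7 8), (90,Oct 1 2 3 4 5 6 7 8), (98,Oct 2 4 6 1 3 5 7 8), (98,Oct 2 4 6 1 3 5 8 7)],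
    [(95,Oct 4 1 5 2 6 3 7 8), (95,Oct 4 1 5 2 6 3 8 7)],
    [],
    [(94,Oct 4 3 7 5 1 6 2 8), (94,Oct 4 5 1 3 7 6 2 8), (94,Oct 4 5 1 6 2 3 7 8), (100,Oct 1 2 3 4 5 6 7 8),
    (95,Oct 4 5 1 6 2 7 3 8), (99,Oct 1 3 2 5 4 7 8 6), (99,Oct 1 3 2 7 8 5 4 6), (99,Oct 1 7 8 3 2 5 4 6)],
    [(87,Oct 1 3 4 6 7 2 5 8), (96,Oct 3 5 7 6 8 4 1 2), (87,Oct 3 1 4 2 5 6 7 8), (96,Oct 5 3 7 4 1 6 8 2),
    (96,Oct 5 4 1 3 7 6 2 8), (96,Oct 4 5 1 6 2 3 7 8), (101,Oct 1 2 3 4 5 6 7 8), (97,Oct 2 3 1 6 4 7 5 8),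
    (97,Oct 2 6 4 3 1 7 8 5), (97,Oct 6 2 4 7 8 3 1 5), (97,Oct 6 7 8 2 4 3 5 1)],
    [(99,Oct 1 2 3 7 8 6 4 5), (99,Oct 2 1 3 6 4 7 8 5), (98,Oct 2 3 1 6 4 7 5 8), (101,Oct 1 2 3 5 4 7 6 8)],
    [(100,Oct 1 2 3 4 5 8 6 7)],
    [],
    [(102,Oct 1 2 3 4 5 6 7 8), (103,Oct 1 2 3 4 5 6 7 8), (103,Oct 1 2 3 5 4 7 6 8)],
    [(103,Oct 1 2 3 5 4 7 6 8), (103,Oct 1 2 3 5 4 7 8 6)],
    [(104,Oct 1 2 3 4 5 6 7 8), (106,Oct 1 2 3 4 5 6 7 8), (106,Oct 1 2 3 4 5 6 8 7), (105,Oct 1 2 3 4 5 6 7 8)],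
    [(105,Oct 2 1 4 3 5 6 7 8), (105,Oct 1 2 3 4 5 6 7 8)],
    [(106,Oct 1 2 3 4 5 6 7 8), (107,Oct 1 2 3 4 5 6 7 8)],
    [],
    [(109,Oct 1 2 3 4 5 6 7 8), (102,Oct 1 2 4 5 6 7 3 8), (102,Oct 1 2 4 5 6 7 8 3), (108,Oct 1 2 3 4 5 6 7 8),
    (108,Oct 2 1 3 5 4 6 7 8), (104,Oct 1 2 3 5 6 4 7 8), (104,Oct 1 2 5 3 4 6 7 8)],
    [(103,Oct 1 2 4 5 6 7 8 3), (110,Oct 1 2 3 4 5 6 7 8), (110,Oct 2 1 3 5 4 7 6 8), (106,Oct 1 2 5 3 4 6 7 8)],
    [(108,Oct 1 2 3 4 5 6 7 8)],
    [(108,Oct 2 1 3 5 4 6 7 8), (110,Oct 2 1 3 5 4 7 6 8), (110,Oct 2 1 3 5 4 7 8 6), (110,Oct 2 1 5 3 7 4 6 8),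
    (110,Oct 2 1 5 3 7 4 8 6)],
    [(109,Oct 1 2 3 4 5 6 7 8)],
    [(110,Oct 1 2 5 7 3 6 8 4), (110,Oct 2 1 5 3 7 6 4 8), (107,Oct 1 2 3 5 6 4 7 8)],
    [(114,Oct 2 1 3 4 6 5 7 8), (111,Oct 2 1 3 4 6 5 7 8), (112,Oct 2 1 3 4 6 5 7 8), (113,Oct 1 2 3 4 5 6 7 8),
    (114,Oct 1 2 3 4 5 6 7 8), (111,Oct 1 2 3 4 5 6 7 8), (112,Oct 1 2 3 4 5 6 7 8), (113,Oct 2 1 3 4 6 5 7 8),
    (102,Oct 4 5 1 2 6 7 3 8), (113,Oct 2 6 4 3 1 5 7 8), (113,Oct 6 2 4 3 5 1 7 8)],
    [(108,Oct 1 3 4 5 6 2 7 8), (113,Oct 1 3 2 5 4 6 7 8), (113,Oct 1 3 2 5 4 6 8 7), (113,Oct 1 2 3 4 5 6 7 8),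
    (113,Oct 1 2 3 4 5 6 8 7)],
    [(114,Oct 3 1 2 5 6 4 7 8), (114,Oct 3 1 2 5 6 4 8 7), (114,Oct 1 3 2 5 4 6 7 8), (114,Oct 1 3 2 5 4 6 8 7),
    (109,Oct 3 4 1 2 5 6 7 8)],
    [(115,Oct 2 1 3 4 6 5 7 8), (115,Oct 2 3 1 4 6 7 5 8), (115,Oct 1 2 3 4 5 6 7 8), (115,Oct 3 2 1 4 7 6 5 8),
    (115,Oct 1 3 2 4 5 7 6 8), (115,Oct 3 1 2 4 7 5 6 8)],
    [(117,Oct 1 2 3 4 5 6 7 8), (113,Oct 3 1 2 4 7 5 6 8), (113,Oct 3 4 7 1 2 5 8 6), (115,Oct 4 5 1 2 6 8 3 7),
    (103,Oct 4 1 5 2 6 3 7 8), (112,Oct 1 2 3 4 5 6 7 8), (115,Oct 1 4 5 2 3 6 8 7), (115,Oct 1 2 3 4 5 6 7 8),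
    (116,Oct 1 2 3 4 5 6 7 8)],
    [(113,Oct 4 2 6 3 7 1 5 8), (116,Oct 2 3 1 4 6 7 5 8), (113,Oct 2 4 6 3 1 7 5 8), (116,Oct 3 2 1 4 7 6 5 8)],
    [(114,Oct 3 1 2 4 7 5 6 8), (117,Oct 2 3 1 4 6 7 5 8), (114,Oct 1 3 2 4 5 7 6 8), (117,Oct 3 2 1 4 7 6 5 8)],
    [],
    [(115,Oct 4 1 5 3 7 2 6 8), (116,Oct 2 6 4 8 5 7 1 3), (115,Oct 1 4 5 3 2 7 8 6), (116,Oct 6 2 4 8 7 5 3 1),
    (110,Oct 3 4 1 2 5 6 7 8), (118,Oct 1 2 3 4 5 6 7 8)],
    [(116,Oct 1 2 3 5 4 8 7 6), (116,Oct 1 3 2 4 5 7 8 6)],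
    [(117,Oct 1 2 3 5 4 8 7 6), (117,Oct 1 3 2 4 5 7 8 6)],
    [(117,Oct 2 4 6 3 1 7 8 5), (117,Oct 2 3 1 4 6 7 8 5)],
    [],
    [],
    [],
    [],
    [(119,Oct 1 2 3 4 5 6 7 8)],
    [(119,Oct 1 2 3 4 5 6 7 8)],
    [],
    [],
    [],
    [],
    [(120,Oct 1 2 3 4 5 6 7 8)],
    [(123,Oct 1 2 3 4 5 6 7 8), (121,Oct 1 2 3 4 5 6 7 8), (122,Oct 1 2 3 4 5 6 7 8), (122,Oct 1 2 3 5 4 7 6 8),
    (122,Oct 7 2 5 3 4 1 6 8)],
    [(125,Oct 1 2 3 4 5 6 7 8), (122,Oct 2 1 3 4 6 5 7 8), (122,Oct 2 3 1 6 4 5 8 7), (124,Oct 1 2 3 4 5 6 7 8),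
    (124,Oct 6 2 4 3 5 1 7 8)],
    [(122,Oct 1 2 3 5 4 7 6 8), (124,Oct 1 2 3 4 5 6 7 8)],
    [(123,Oct 2 1 3 4 6 5 7 8), (125,Oct 2 1 3 4 6 5 7 8)],
    [(124,Oct 2 5 8 1 3 4 7 6), (126,Oct 2 3 1 4 6 7 5 8), (126,Oct 1 2 3 4 5 6 7 8)],
    [(124,Oct 6 2 4 3 5 1 7 8)],
    [(125,Oct 1 2 3 4 5 6 7 8)],
    [(126,Oct 2 1 3 5 8 4 6 7), (126,Oct 1 2 3 5 4 8 7 6), (120,Oct 3 4 1 2 5 6 7 8)],
    [],
    [],
    [],
    [],
    [],
    [],
    [],
    [(127,Oct 1 2 3 4 5 6 7 8)],
    []]"

text \<open>Needed in two ways: the induction in \<open>system_rep\<close> needs that every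
  extension falls into a listed class, and \<open>card_ext_into_rep\<close> needs to know into which
  one.\<close>

lemma exts_ok: "list_all2 row_ok [0..<128] exts"
  by (simp only: upt128 exts_def list_all2_Nil list_all2_Cons eval_rules cong: if_weak_cong)

section \<open>The separating invariant\<close>

primrec degree_oct :: "nat \<Rightarrow> bool oct list \<Rightarrow> int" where
  "degree_oct p [] = 0"
| "degree_oct p (A # K) = (if ap p A then degree_oct p K + 1 else degree_oct p K)"

primrec weight_oct :: "nat list \<Rightarrow> bool oct list \<Rightarrow> bool oct \<Rightarrow> int" where
  "weight_oct [] K A = 1"
| "weight_oct (p # ps) K A =
     (if ap p A then (degree_oct p K)\<^sup>2 + 3 + weight_oct ps K A else weight_oct ps K A)"

text \<open>Sizes of elements and degrees of points are preserved by permutations, hence so is any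
  expression in them; this one takes 128 different values on the representatives. The summand 1 in
  the weight makes the empty set count, so that \<open>[[]]\<close> and \<open>[]\<close>
  differ.\<close>

definition invariant_oct :: "bool oct list \<Rightarrow> int" where
  "invariant_oct K = sum_list (map (\<lambda>A. (weight_oct [1,2,3,4,5,6,7,8] K A)\<^sup>2) K)"

definition invariants :: "int list" where
  "invariants = [0, 1, 25, 81, 169, 289, 441, 625, 841, 1089, 320, 586, 162, 400, 754, 512, 338, 656, 458, 832, 610,
    1040, 800, 578, 976, 1051, 853, 1417, 1291, 649, 243, 947, 1171, 737, 1625, 1083, 1323, 873, 1251,
    681, 1507, 1017, 1451, 1041, 1419, 2752, 1930, 2618, 3258, 2348, 1418, 1666, 1172, 916, 324, 2036,
    1778, 2866, 2928, 1538, 3522, 2596, 1936, 2212, 1690, 2128, 1954, 1462, 2420, 1858, 2352, 2404,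
    1444, 1882, 2320, 3731, 4971, 4641, 3099, 2197, 2793, 1643, 3541, 3235, 2947, 3919, 5275, 2929,
    3757, 2867, 4005, 3155, 3451, 2879, 3989, 3347, 2849, 2297, 3387, 3359, 3869, 2777, 7994, 7604,
    5346, 4272, 4980, 4614, 5578, 8354, 5560, 6144, 5778, 5106, 6416, 5076, 4424, 5686, 4374, 7351,
    8457, 9583, 8365, 9895, 7563, 9045, 7513, 10952]"

lemma invariants_eq: "map invariant_oct (map rep [0..<128]) = invariants"
  by (simp only: upt128 list.map rep_eqs)
     (simp add: invariant_oct_def invariants_def ap_simps ap_simps(1)[simplified])

lemma distinct_invariants: "distinct invariants"
  by (simp add: invariants_def)

section \<open>Class sizes and their recurrence\<close>

text \<open>Found from exts by solving the recurrence of flow_class_sizes.\<close>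

definition class_sizes :: "nat list" where
  "class_sizes = [1, 1, 8, 28, 56, 70, 56, 28, 8, 1, 168, 168, 210, 840, 420, 840, 280, 1680, 280, 840, 56, 168, 560,
    35, 280, 840, 840, 3360, 210, 3360, 420, 3360, 2520, 2520, 5040, 3360, 840, 5040, 10080, 840, 840,
    3360, 3360, 2520, 5040, 840, 6720, 10080, 5040, 5040, 1680, 10080, 5040, 3360, 105, 10080, 20160,
    10080, 840, 2520, 2520, 2520, 840, 6720, 10080, 6720, 10080, 10080, 10080, 10080, 3360, 6720, 5040,
    20160, 10080, 10080, 20160, 20160, 10080, 5040, 20160, 1680, 2520, 20160, 10080, 10080, 10080,
    10080, 5040, 5040, 2520, 3360, 20160, 20160, 20160, 6720, 20160, 10080, 10080, 20160, 3360, 5040,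
    5040, 20160, 2520, 3360, 10080, 5040, 5040, 2520, 20160, 1680, 5040, 20160, 10080, 20160, 20160,
    20160, 3360, 840, 3360, 240, 5040, 1680, 10080, 5040, 6720, 840]"

primrec nodup :: "'a list \<Rightarrow> bool" where
  "nodup [] = True"
| "nodup (x # xs) = (if list_mem x xs then False else nodup xs)"

lemma nodup_reps: "list_all nodup (map rep [0..<128])"
  by (simp only: upt128 list.map rep_eqs list.pred_inject nodup.simps list_mem.simps oct.inject simp_thms if_True if_False
      cong: if_weak_cong)

primrec occ :: "nat \<Rightarrow> nat list \<Rightarrow> nat" where
  "occ j [] = 0"
| "occ j (i # is) = (if i = j then Suc (occ j is) else occ j is)"

fun flow :: "nat \<Rightarrow> nat list \<Rightarrow> nat list list \<Rightarrow> nat" where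
  "flow j (m # ms) (e # es) = m * occ j e + flow j ms es"
| "flow j [] _ = 0"
| "flow j _ [] = 0"

definition flow_ok :: "nat list list \<Rightarrow> nat \<Rightarrow> nat \<Rightarrow> bool" where
  "flow_ok es j m \<longleftrightarrow> m * length (rep j) = flow j class_sizes es"

text \<open>The equation for class 0 is left out: the empty system has no element to remove, so
  there the recurrence says nothing, and the size 1 is found directly in
  \<open>card_sys_class\<close>.\<close>

lemma flow_class_sizes:
  "list_all2 (flow_ok (map (map fst) exts)) [1..<128] (tl class_sizes)"
proof -
  have upt: "[1..<128::nat] = tl [0, 1, 2, 3, 4, 5, 6, 7, 8, 9, 10, 11, 12, 13, 14, 15, 16, 17, 18, 19, 20, 21, 22, 23, 24, 25, 26,
      27, 28, 29, 30, 31, 32, 33, 34, 35, 36, 37, 38, 39, 40, 41, 42, 43, 44, 45, 46, 47, 48, 49, 50, 51,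
      52, 53, 54, 55, 56, 57, 58, 59, 60, 61, 62, 63, 64, 65, 66, 67, 68, 69, 70, 71, 72, 73, 74, 75, 76,
      77, 78, 79, 80, 81, 82, 83, 84, 85, 86, 87, 88, 89, 90, 91, 92, 93, 94, 95, 96, 97, 98, 99, 100,
      101, 102, 103, 104, 105, 106, 107, 108, 109, 110, 111, 112, 113, 114, 115, 116, 117, 118, 119, 120,
      121, 122, 123, 124, 125, 126, 127]"
    by (simp add: upt_conv_Cons)
  show ?thesis
    by (simp only: upt list.sel class_sizes_def exts_def list.map list_all2_Nil list_all2_Cons rep_eqs list.size
          flow_ok_def flow.simps occ.simps fst_conv nat_num_simps num.inject num.distinct simp_thms if_True if_False
          mult_0_right mult_Suc_right add_0_right add_0_left add_Suc_right one_plus_numeral numeral_plus_one one_add_one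
          numeral_plus_numeral add_num_simps
          cong: if_weak_cong)
qed

section \<open>Systems of lines and conics\<close>

lemma list_mem_iff: "list_mem x xs \<longleftrightarrow> x \<in> set xs"
  by (induction xs) auto

lemma nodup_iff: "nodup xs \<longleftrightarrow> distinct xs"
  by (induction xs) (auto simp: list_mem_iff)

lemma list_subset_iff: "list_subset xs ys \<longleftrightarrow> set xs \<subseteq> set ys"
  by (induction xs) (auto simp: list_mem_iff)

lemma select_eq_filter: "select P xs = filter P xs"
  by (induction xs) auto

lemma distinct_rep: "i < 128 \<Longrightarrow> distinct (rep i)"
  using nodup_reps by (auto simp: list_all_iff nodup_iff)

section \<open>Bit vectors as subsets of {1..8}\<close>

definition set_of :: "bool oct \<Rightarrow> nat set" where
  "set_of A = {i \<in> {1..8}. ap i A}"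

lemma atLeastAtMost_1_8: "{1..8::nat} = {1,2,3,4,5,6,7,8}"
  by auto

lemma in_set_of_Oct:
  "(1 \<in> set_of (Oct a b c d e f g h)) = a" "(2 \<in> set_of (Oct a b c d e f g h)) = b"
  "(3 \<in> set_of (Oct a b c d e f g h)) = c" "(4 \<in> set_of (Oct a b c d e f g h)) = d"
  "(5 \<in> set_of (Oct a b c d e f g h)) = e" "(6 \<in> set_of (Oct a b c d e f g h)) = f"
  "(7 \<in> set_of (Oct a b c d e f g h)) = g" "(8 \<in> set_of (Oct a b c d e f g h)) = h"
  by (simp_all only: set_of_def mem_Collect_eq ap_simps) auto

lemma set_of_subset: "set_of A \<subseteq> {1..8}"
  by (auto simp: set_of_def)

lemma finite_set_of [simp]: "finite (set_of A)"
  by (rule finite_subset[OF set_of_subset]) simp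

lemma inj_set_of: "inj set_of"
proof (rule injI)
  fix A B assume eq: "set_of A = set_of B"
  obtain a b c d e f g h where A: "A = Oct a b c d e f g h" by (cases A)
  obtain a' b' c' d' e' f' g' h' where B: "B = Oct a' b' c' d' e' f' g' h'" by (cases B)
  have "\<And>i. (i \<in> set_of A) = (i \<in> set_of B)" using eq by simp
  from this[of 1] this[of 2] this[of 3] this[of 4] this[of 5] this[of 6] this[of 7] this[of 8]
  show "A = B" unfolding A B in_set_of_Oct by simp
qed

lemma range_set_of: "range set_of = Pow {1..8}"
proof
  show "range set_of \<subseteq> Pow {1..8}" using set_of_subset by auto
  show "Pow {1..8} \<subseteq> range set_of"
  proof
    fix S assume S: "S \<in> Pow {1..8::nat}"
    have "S = set_of (Oct (1 \<in> S) (2 \<in> S) (3 \<in> S) (4 \<in> S) (5 \<in> S) (6 \<in> S) (7 \<in> S) (8 \<in> S))"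
      unfolding set_of_def using S unfolding atLeastAtMost_1_8 Pow_def
      by (auto simp: ap_simps ap_simps(1)[simplified])
    thus "S \<in> range set_of" by blast
  qed
qed

lemma sum_1_8: "sum f {1..8::nat} = f 1 + (f 2 + (f 3 + (f 4 + (f 5 + (f 6 + (f 7 + f 8))))))"
  for f :: "nat \<Rightarrow> nat"
  unfolding atLeastAtMost_1_8 by simp

lemma card_eq_sum: "S \<subseteq> {1..8} \<Longrightarrow> card S = (\<Sum>i\<in>{1..8::nat}. of_bool (i \<in> S))"
  by (simp add: sum.If_cases of_bool_def Int_absorb1)

lemma bsuc_eq: "bsuc b n = of_bool b + n" "bsuc2 b c n = of_bool (b \<and> c) + n"
  by (cases b; cases c; simp)+

lemma card_set_of: "card (set_of A) = size_oct A"
  by (cases A) (simp only: card_eq_sum[OF set_of_subset] sum_1_8 in_set_of_Oct size_oct.simps bsuc_eq add_0_right)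

lemma card_set_of_Int: "card (set_of A \<inter> set_of B) = size_inter A B"
proof -
  have "set_of A \<inter> set_of B \<subseteq> {1..8}" using set_of_subset by auto
  thus ?thesis
    by (cases A; cases B)
      (simp only: card_eq_sum sum_1_8 in_set_of_Oct size_inter.simps bsuc_eq add_0_right Int_iff)
qed

section \<open>Compatibility of lines and conics\<close>

definition bezout_compat :: "nat set \<Rightarrow> nat set \<Rightarrow> bool" where
  "bezout_compat A B \<longleftrightarrow> compat_sizes (card A) (card B) (card (A \<inter> B))"

text \<open>If A is a line and B the complement of a conic, the two meet in card A - card (A Int B)
  points, and at most two means card A <= card (A Int B) + 2. Two conics with complements A and B
  share 8 - card (A Un B) points; at most four forces disjoint complements of exactly two points
  each.\<close>

lemma compat_sizes_iff: "compat_sizes m n c \<longleftrightarrow> (if 3 \<le> m then if 3 \<le> n then c \<le> 1 else m \<le> c + 2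
    else if 3 \<le> n then n \<le> c + 2 else m = 2 \<and> n = 2 \<and> c = 0)"
  by (cases "(m, n, c)" rule: compat_sizes.cases) auto

lemma bezout_compat_commute: "bezout_compat A B \<longleftrightarrow> bezout_compat B A"
  by (auto simp: bezout_compat_def compat_sizes_iff Int_commute)

text \<open>Irreflexivity guarantees that a set compatible with all elements of a system is not yet
  one of them, so that inserting it really enlarges the system.\<close>

lemma not_compat_self: "\<not> bezout_compat A A"
  by (auto simp: bezout_compat_def compat_sizes_iff)

lemma bezout_compat_image: "inj \<sigma> \<Longrightarrow> bezout_compat (\<sigma> ` A) (\<sigma> ` B) \<longleftrightarrow> bezout_compat A B"
  by (simp add: bezout_compat_def card_image inj_on_subset flip: image_Int)

lemma is_ext_iff: "is_ext (map with_size K) A \<longleftrightarrow> (\<forall>B\<in>set K. bezout_compat (set_of A) (set_of B))"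
proof -
  have "all_compat (map with_size K) (size_oct A) A \<longleftrightarrow> (\<forall>B\<in>set K. bezout_compat (set_of A) (set_of B))"
    by (induction K) (auto simp: with_size_def bezout_compat_def card_set_of card_set_of_Int)
  thus ?thesis by (simp add: is_ext_def)
qed

lemma Oct_mem_octs4: "Oct a b c d e f g h \<in> set (octs4 a b c d)"
  by (cases e; cases f; cases g; cases h) simp_all

lemma Oct_mem_select16: "P (Oct a b c d e f g h) \<Longrightarrow> Oct a b c d e f g h \<in> set (select16 P a b)"
  using Oct_mem_octs4[of a b c d e f g h]
  by (cases c; cases d) (simp_all add: select_eq_filter del: octs4.simps)

lemma set_select_octs: "set (select_octs P) = {A. P A}"
proof -
  have "A \<in> set (select_octs P)" if "P A" for A
  proof -
    obtain a b c d e f g h where A: "A = Oct a b c d e f g h" by (cases A)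
    show ?thesis using Oct_mem_select16[of P a b c d e f g h] that
      by (cases a; cases b) (simp_all add: A del: select16.simps)
  qed
  moreover have "P A" if "A \<in> set (select_octs P)" for A
    using that by (auto simp: select_eq_filter simp del: octs4.simps)
  ultimately show ?thesis by blast
qed

text \<open>A list of 256 values that exhausts a type with 256 elements cannot repeat any, which
  spares a pairwise comparison. Distinctness is needed so that counting positions in a list of
  extensions counts sets.\<close>

lemma distinct_select_octs: "distinct (select_octs P)"
proof -
  let ?all = "select_octs (\<lambda>_. True)"
  have "card (UNIV :: bool oct set) = 2 ^ 8"
    using card_image[OF inj_set_of] by (simp add: range_set_of card_Pow)
  moreover have "length ?all = 2 ^ 8"
    by (simp only: select_octs.simps select16.simps select_eq_filter length_append octs4.simps filter_True simp_thms list.set ball_simps list.size)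
      simp
  ultimately have "distinct ?all"
    by (intro card_distinct) (simp only: set_select_octs UNIV_def)
  moreover have "select_octs P = filter P ?all"
    by (simp only: select_octs.simps select16.simps select_eq_filter filter_append filter_filter simp_thms)
  ultimately show ?thesis
    by (simp only: distinct_filter)
qed

section \<open>Systems up to permutation\<close>

definition systems :: "nat set set set" where
  "systems = {K. K \<subseteq> Pow {1..8} \<and> pairwise bezout_compat K}"

definition sys_iso :: "nat set set \<Rightarrow> nat set set \<Rightarrow> bool" where
  "sys_iso K L \<longleftrightarrow> (\<exists>\<sigma>. \<sigma> permutes {1..8} \<and> (`) \<sigma> ` K = L)"

lemma sys_iso_refl: "sys_iso K K"
  unfolding sys_iso_def by (rule exI[of _ id]) (simp add: permutes_id)

lemma sys_iso_sym: "sys_iso K L \<Longrightarrow> sys_iso L K"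
  unfolding sys_iso_def
proof (elim exE conjE)
  fix \<sigma> :: "nat \<Rightarrow> nat" assume s: "\<sigma> permutes {1..8}" "(`) \<sigma> ` K = L"
  have "(`) (inv_into UNIV \<sigma>) ` L = K"
    using permutes_inv_o(2)[OF s(1)] by (simp add: s(2)[symmetric] image_image image_comp[symmetric] permutes_inverses(2)[OF s(1)])
  thus "\<exists>\<sigma>. \<sigma> permutes {1..8} \<and> (`) \<sigma> ` L = K"
    using permutes_inv[OF s(1)] by blast
qed

lemma sys_iso_trans: "sys_iso K L \<Longrightarrow> sys_iso L M \<Longrightarrow> sys_iso K M"
  unfolding sys_iso_def
proof (elim exE conjE)
  fix \<sigma> \<tau> :: "nat \<Rightarrow> nat"
  assume s: "\<sigma> permutes {1..8}" "(`) \<sigma> ` K = L" "\<tau> permutes {1..8}" "(`) \<tau> ` L = M"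
  have "(`) (\<tau> \<circ> \<sigma>) ` K = M" by (simp add: s(2)[symmetric] s(4)[symmetric] image_image image_comp)
  thus "\<exists>\<sigma>. \<sigma> permutes {1..8} \<and> (`) \<sigma> ` K = M"
    using permutes_compose[OF s(1,3)] by blast
qed

lemma system_image:
  assumes "\<sigma> permutes {1..8}" "K \<in> systems"
  shows "(`) \<sigma> ` K \<in> systems"
proof -
  have "(`) \<sigma> ` K \<subseteq> Pow {1..8}"
    using assms(2) permutes_image[OF assms(1)] by (fastforce simp: systems_def simp del: atLeastAtMost_iff)
  moreover have "bezout_compat (\<sigma> ` A) (\<sigma> ` B)" if "A \<in> K" "B \<in> K" "\<sigma> ` A \<noteq> \<sigma> ` B" for A B
    using assms(2) that unfolding bezout_compat_image[OF permutes_inj[OF assms(1)]] systems_def pairwise_def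
    by blast
  ultimately show ?thesis by (auto simp: systems_def pairwise_def)
qed

lemma sys_iso_system: "sys_iso K L \<Longrightarrow> K \<in> systems \<Longrightarrow> L \<in> systems"
  using system_image by (auto simp: sys_iso_def)

lemma finite_systems: "finite systems"
  by (rule finite_subset[of _ "Pow (Pow {1..8})"]) (auto simp: systems_def)

lemma system_finite: "K \<in> systems \<Longrightarrow> finite K"
  by (rule finite_subset[of _ "Pow {1..8}"]) (auto simp: systems_def)

section \<open>Soundness of the certificates and completeness of the representatives\<close>

definition rep_system :: "nat \<Rightarrow> nat set set" where
  "rep_system i = set_of ` set (rep i)"

lemma card_rep_system: "i < 128 \<Longrightarrow> card (rep_system i) = length (rep i)"
  unfolding rep_system_def
  by (subst card_image) (auto intro: inj_on_subset[OF inj_set_of] simp: distinct_card distinct_rep)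

definition perm_of :: "nat oct \<Rightarrow> nat \<Rightarrow> nat" where
  "perm_of \<pi> i = (if i \<in> {1..8} then ap i \<pi> else i)"

lemma distinct8_iff: "distinct8 xs \<longleftrightarrow> distinct xs \<and> set xs \<subseteq> {1..8}"
  unfolding atLeastAtMost_1_8 by (induction xs) (auto simp: list_mem_iff)

lemma perm_of_permutes:
  assumes "distinct8 (oct_list \<pi>)"
  shows "perm_of \<pi> permutes {1..8}"
proof -
  obtain a b c d e f g h where p: "\<pi> = Oct a b c d e f g h" by (cases \<pi>)
  have len: "length (oct_list \<pi>) = 8" by (simp add: p)
  have d: "distinct (oct_list \<pi>)" "set (oct_list \<pi>) \<subseteq> {1..8}"
    using assms by (auto simp only: distinct8_iff)
  have ap: "ap i \<pi> = oct_list \<pi> ! (i - 1)" for i by (simp add: ap_def)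
  have "perm_of \<pi> ` {1..8} \<subseteq> {1..8}"
  proof
    fix x assume "x \<in> perm_of \<pi> ` {1..8}"
    then obtain i where i: "i \<in> {1..8}" "x = ap i \<pi>" by (auto simp: perm_of_def)
    hence "x \<in> set (oct_list \<pi>)" using len by (auto simp: ap)
    thus "x \<in> {1..8}" using d by blast
  qed
  moreover have inj: "inj_on (perm_of \<pi>) {1..8}"
  proof (rule inj_onI)
    fix i j assume ij: "i \<in> {1..8}" "j \<in> {1..8}" "perm_of \<pi> i = perm_of \<pi> j"
    hence "oct_list \<pi> ! (i - 1) = oct_list \<pi> ! (j - 1)" by (simp add: perm_of_def ap)
    hence "i - 1 = j - 1" using d(1) len ij by (subst (asm) nth_eq_iff_index_eq) auto
    thus "i = j" using ij by auto
  qed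
  ultimately have "perm_of \<pi> ` {1..8} = {1..8}"
    by (intro endo_inj_surj) auto
  thus ?thesis using inj by (intro bij_imp_permutes) (auto simp: bij_betw_def perm_of_def)
qed

lemma ap_preimage_oct: "i \<in> {1..8} \<Longrightarrow> ap i (preimage_oct \<pi> A) = ap (ap i \<pi>) A"
  unfolding atLeastAtMost_1_8
  by (cases \<pi>) (auto simp: ap_simps ap_simps(1)[simplified])

text \<open>Preimages are what the checker computes, since each bit of a preimage is a single
  lookup, whereas an image would need the inverse permutation.\<close>

lemma perm_of_image:
  assumes "distinct8 (oct_list \<pi>)"
  shows "perm_of \<pi> ` set_of (preimage_oct \<pi> A) = set_of A"
proof -
  note p = perm_of_permutes[OF assms]
  have "set_of (preimage_oct \<pi> A) = {i \<in> {1..8}. ap (perm_of \<pi> i) A}"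
    by (auto simp: set_of_def ap_preimage_oct perm_of_def simp del: atLeastAtMost_iff)
  moreover have "perm_of \<pi> ` {i \<in> {1..8}. ap (perm_of \<pi> i) A} = {i \<in> perm_of \<pi> ` {1..8}. ap i A}"
    by auto
  ultimately show ?thesis using permutes_image[OF p] by (simp add: set_of_def)
qed

text \<open>Taking preimages is injective, so \<open>rep j\<close> has as many preimages as
  \<open>A # K\<close> has entries. The checked inclusion is therefore an equality, and the
  permutation carries the extended system onto \<open>rep_system j\<close>.\<close>

lemma cert_okD:
  assumes "cert_ok K A (j, \<pi>)" "distinct K"
  shows "j < 128 \<and> length (rep j) = Suc (length K) \<and> sys_iso (insert (set_of A) (set_of ` set K)) (rep_system j)"
proof -
  have *: "j < 128" "distinct8 (oct_list \<pi>)" "length (rep j) = Suc (length K)"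
    "preimage_oct \<pi> ` set (rep j) \<subseteq> insert A (set K)"
    using assms by (auto split: if_splits simp: list_subset_iff)
  note p = perm_of_permutes[OF *(2)]
  have "inj (preimage_oct \<pi>)"
    by (rule injI) (metis perm_of_image[OF *(2)] inj_set_of[THEN injD])
  hence "card (preimage_oct \<pi> ` set (rep j)) = Suc (length K)"
    using *(1,3) by (simp add: card_image inj_on_subset distinct_card distinct_rep)
  moreover have "card (insert A (set K)) \<le> Suc (length K)"
    by (metis List.finite_set card_insert_le_m1 card_length diff_Suc_1 zero_less_Suc)
  ultimately have "preimage_oct \<pi> ` set (rep j) = insert A (set K)"
    using *(4) by (intro card_seteq) auto
  hence "(`) (perm_of \<pi>) ` (insert (set_of A) (set_of ` set K)) = (`) (perm_of \<pi>) ` set_of ` preimage_oct \<pi> ` set (rep j)"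
    by simp
  also have "\<dots> = rep_system j"
    by (simp add: rep_system_def image_image perm_of_image[OF *(2)])
  finally show ?thesis using * p by (auto simp: sys_iso_def)
qed

declare select_octs.simps [simp del] cert_ok.simps [simp del]

lemma certs_ok_iff:
  "certs_ok K As cs \<longleftrightarrow> length As = length cs \<and> (\<forall>k<length As. cert_ok K (As ! k) (cs ! k))"
  by (induction K As cs rule: certs_ok.induct) (auto simp: less_Suc_eq_0_disj simp del: cert_ok.simps)

definition extensions :: "nat \<Rightarrow> bool oct list" where
  "extensions i = select_octs (is_ext (map with_size (rep i)))"

lemma mem_extensions: "A \<in> set (extensions i) \<longleftrightarrow> (\<forall>B\<in>rep_system i. bezout_compat (set_of A) B)"
  by (simp add: extensions_def set_select_octs is_ext_iff rep_system_def)

lemma length_exts: "length exts = 128"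
  using list_all2_lengthD[OF exts_ok] by simp

lemma
  assumes "i < 128"
  shows length_extensions: "length (extensions i) = length (exts ! i)"
    and nth_exts: "k < length (extensions i) \<Longrightarrow> cert_ok (rep i) (extensions i ! k) (exts ! i ! k)"
  using list_all2_nthD2[OF exts_ok, of i] assms
  by (simp_all add: length_exts row_ok_def extensions_def certs_ok_iff del: select_octs.simps)

lemma extensionD:
  assumes "i < 128" "k < length (extensions i)" "fst (exts ! i ! k) = j"
  shows "j < 128" "length (rep j) = Suc (length (rep i))"
    "sys_iso (insert (set_of (extensions i ! k)) (rep_system i)) (rep_system j)"
proof -
  obtain \<pi> where p: "exts ! i ! k = (j, \<pi>)" using assms(3) by (cases "exts ! i ! k") auto
  have "cert_ok (rep i) (extensions i ! k) (j, \<pi>)" using nth_exts[OF assms(1,2)] by (simp only: p)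
  from cert_okD[OF this distinct_rep[OF assms(1)]]
  show "j < 128" "length (rep j) = Suc (length (rep i))"
    "sys_iso (insert (set_of (extensions i ! k)) (rep_system i)) (rep_system j)"
    by (auto simp: rep_system_def)
qed

lemma extension_in_list:
  assumes "i < 128" "A \<subseteq> {1..8}" "\<forall>B\<in>rep_system i. bezout_compat A B"
  obtains k where "k < length (extensions i)" "A = set_of (extensions i ! k)"
proof -
  obtain A' where A': "A = set_of A'" using assms(2) range_set_of by (metis PowI imageE)
  hence "A' \<in> set (extensions i)" using assms(3) by (simp add: mem_extensions)
  then obtain k where "k < length (extensions i)" "A' = extensions i ! k" by (metis in_set_conv_nth)
  thus ?thesis using that A' by blast
qed

lemma rep_0: "rep 0 = []"
  by (simp add: rep_def reps_def)

text \<open>A single permutation, chosen before A, serves all extensions of K at once; this is what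
  gives a bijection between the extensions of K and those of L in
  \<open>card_ext_into_iso\<close>.\<close>

lemma sys_iso_insert:
  assumes "sys_iso K L"
  obtains \<sigma> where "\<sigma> permutes {1..8}" "(`) \<sigma> ` K = L"
    "\<And>A. sys_iso (insert A K) (insert (\<sigma> ` A) L)"
    "\<And>A. (\<forall>B\<in>L. bezout_compat (\<sigma> ` A) B) \<longleftrightarrow> (\<forall>B\<in>K. bezout_compat A B)"
proof -
  obtain \<sigma> where s: "\<sigma> permutes {1..8}" "(`) \<sigma> ` K = L" using assms by (auto simp: sys_iso_def)
  have "sys_iso (insert A K) (insert (\<sigma> ` A) L)" for A
    unfolding sys_iso_def using s by (intro exI[of _ \<sigma>]) auto
  moreover have "(\<forall>B\<in>L. bezout_compat (\<sigma> ` A) B) \<longleftrightarrow> (\<forall>B\<in>K. bezout_compat A B)" for A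
    using s bezout_compat_image[OF permutes_inj[OF s(1)]] by auto
  ultimately show ?thesis using that s by blast
qed

lemma systems_insert:
  "A \<notin> K \<Longrightarrow> insert A K \<in> systems \<longleftrightarrow> A \<subseteq> {1..8} \<and> (\<forall>B\<in>K. bezout_compat A B) \<and> K \<in> systems"
  by (auto simp: systems_def pairwise_insert bezout_compat_commute)

lemma system_rep:
  assumes "K \<in> systems"
  shows "\<exists>i<128. sys_iso K (rep_system i)"
  using system_finite[OF assms] assms
proof (induction K rule: finite_induct)
  case empty
  have "sys_iso {} (rep_system 0)" by (simp add: rep_system_def rep_0 sys_iso_refl)
  thus ?case by (intro exI[of _ 0]) simp
next
  case (insert A K)
  hence A: "A \<subseteq> {1..8}" "\<forall>B\<in>K. bezout_compat A B" "K \<in> systems" by (auto simp: systems_insert)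
  then obtain i where i: "i < 128" "sys_iso K (rep_system i)" using insert.IH by blast
  obtain \<sigma> where s: "\<sigma> permutes {1..8}" "\<And>A. sys_iso (insert A K) (insert (\<sigma> ` A) (rep_system i))"
    "\<And>A. (\<forall>B\<in>rep_system i. bezout_compat (\<sigma> ` A) B) \<longleftrightarrow> (\<forall>B\<in>K. bezout_compat A B)"
    using sys_iso_insert[OF i(2)] by metis
  have "\<sigma> ` A \<subseteq> {1..8}" using A(1) permutes_image[OF s(1)] by (metis image_mono)
  then obtain k where k: "k < length (extensions i)" "\<sigma> ` A = set_of (extensions i ! k)"
    using extension_in_list[OF i(1)] s(3) A(2) by metis
  show ?case
    using extensionD[OF i(1) k(1) refl] s(2)[of A] sys_iso_trans unfolding k(2) by blast
qed

section \<open>Separation of the representatives\<close>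

definition invariant :: "nat set set \<Rightarrow> int" where
  "invariant K = (\<Sum>A\<in>K. (1 + (\<Sum>p\<in>A. (int (card {B\<in>K. p \<in> B}))\<^sup>2 + 3))\<^sup>2)"

lemma invariant_iso:
  assumes "sys_iso K L"
  shows "invariant K = invariant L"
proof -
  obtain \<sigma> where s: "\<sigma> permutes {1..8}" "(`) \<sigma> ` K = L" using assms by (auto simp: sys_iso_def)
  note inj = permutes_inj[OF s(1)]
  have inj_img: "inj ((`) \<sigma>)" using inj by (metis inj_image_eq_iff injI)
  have deg: "card {B\<in>L. \<sigma> p \<in> B} = card {B\<in>K. p \<in> B}" for p
  proof -
    have "{B\<in>L. \<sigma> p \<in> B} = (`) \<sigma> ` {B\<in>K. p \<in> B}"
    proof
      show "(`) \<sigma> ` {B\<in>K. p \<in> B} \<subseteq> {B\<in>L. \<sigma> p \<in> B}" using s(2) by auto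
      show "{B\<in>L. \<sigma> p \<in> B} \<subseteq> (`) \<sigma> ` {B\<in>K. p \<in> B}"
      proof
        fix B assume "B \<in> {B\<in>L. \<sigma> p \<in> B}"
        then obtain B' where "B' \<in> K" "B = \<sigma> ` B'" "\<sigma> p \<in> \<sigma> ` B'" using s(2) by auto
        thus "B \<in> (`) \<sigma> ` {B\<in>K. p \<in> B}" using inj_image_mem_iff[OF inj] by auto
      qed
    qed
    thus ?thesis by (simp add: card_image inj_on_subset[OF inj_img])
  qed
  show ?thesis
    unfolding invariant_def s(2)[symmetric]
    by (subst sum.reindex[OF inj_on_subset[OF inj_img subset_UNIV]])
      (simp add: sum.reindex inj_on_subset[OF inj] deg[unfolded s(2)[symmetric]])
qed

lemma degree_oct_eq: "distinct K \<Longrightarrow> p \<in> {1..8} \<Longrightarrow>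
    degree_oct p K = int (card {B \<in> set_of ` set K. p \<in> B})"
proof (induction K)
  case (Cons A K)
  have "{B \<in> set_of ` set (A # K). p \<in> B} =
      (if ap p A then insert (set_of A) {B \<in> set_of ` set K. p \<in> B} else {B \<in> set_of ` set K. p \<in> B})"
    using Cons.prems by (auto simp: set_of_def)
  moreover have "set_of A \<notin> set_of ` set K"
    using Cons.prems inj_set_of by (auto dest: injD)
  ultimately show ?case using Cons by simp
qed simp

lemma weight_oct_eq:
  "distinct ps \<Longrightarrow> set ps \<subseteq> {1..8} \<Longrightarrow>
   weight_oct ps K A = 1 + (\<Sum>p\<in>set_of A \<inter> set ps. (degree_oct p K)\<^sup>2 + 3)"
proof (induction ps)
  case (Cons p ps)
  have "set_of A \<inter> set (p # ps) = (if ap p A then insert p (set_of A \<inter> set ps) else set_of A \<inter> set ps)"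
    using Cons.prems by (auto simp: set_of_def)
  thus ?case using Cons by simp
qed simp

lemma invariant_rep_system:
  assumes "i < 128"
  shows "invariant (rep_system i) = invariant_oct (rep i)"
proof -
  have w: "weight_oct [1,2,3,4,5,6,7,8] (rep i) A =
      1 + (\<Sum>p\<in>set_of A. (int (card {B\<in>rep_system i. p \<in> B}))\<^sup>2 + 3)" for A
  proof -
    have "set_of A \<inter> set [1,2,3,4,5,6,7,8] = set_of A" using set_of_subset[of A] unfolding atLeastAtMost_1_8 by auto
    hence "weight_oct [1,2,3,4,5,6,7,8] (rep i) A = 1 + (\<Sum>p\<in>set_of A. (degree_oct p (rep i))\<^sup>2 + 3)"
      by (subst weight_oct_eq) auto
    also have "(\<Sum>p\<in>set_of A. (degree_oct p (rep i))\<^sup>2 + 3) = (\<Sum>p\<in>set_of A. (int (card {B\<in>rep_system i. p \<in> B}))\<^sup>2 + 3)"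
      using set_of_subset[of A] by (intro sum.cong) (auto simp: degree_oct_eq distinct_rep[OF assms] rep_system_def)
    finally show ?thesis .
  qed
  have "invariant_oct (rep i) = (\<Sum>A\<leftarrow>rep i. (1 + (\<Sum>p\<in>set_of A. (int (card {B\<in>rep_system i. p \<in> B}))\<^sup>2 + 3))\<^sup>2)"
    by (simp only: invariant_oct_def w)
  also have "\<dots> = (\<Sum>A\<in>set (rep i). (1 + (\<Sum>p\<in>set_of A. (int (card {B\<in>rep_system i. p \<in> B}))\<^sup>2 + 3))\<^sup>2)"
    by (simp add: sum_list_distinct_conv_sum_set distinct_rep[OF assms])
  also have "\<dots> = invariant (rep_system i)"
    unfolding invariant_def
    by (subst (2) rep_system_def) (simp add: sum.reindex inj_on_subset[OF inj_set_of])
  finally show ?thesis by simp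
qed

lemma sys_iso_rep_unique:
  assumes "i < 128" "j < 128" "sys_iso (rep_system i) (rep_system j)"
  shows "i = j"
proof -
  have "invariants ! k = invariant (rep_system k)" if "k < 128" for k
    using that by (simp add: invariant_rep_system flip: invariants_eq)
  moreover have "length invariants = 128"
    by (simp flip: invariants_eq)
  ultimately show ?thesis
    using assms invariant_iso[OF assms(3)] nth_eq_iff_index_eq[OF distinct_invariants] by auto
qed

section \<open>Counting the isomorphism classes\<close>

definition iso_class :: "nat \<Rightarrow> nat set set set" where
  "iso_class i = {K. sys_iso K (rep_system i)}"

definition sys_class :: "nat \<Rightarrow> nat set set set" where
  "sys_class i = {K \<in> systems. sys_iso K (rep_system i)}"

lemma finite_sys_class: "finite (sys_class i)"
  using finite_systems by (simp add: sys_class_def)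

lemma sys_class_disjoint: "i < 128 \<Longrightarrow> j < 128 \<Longrightarrow> i \<noteq> j \<Longrightarrow> sys_class i \<inter> sys_class j = {}"
  unfolding sys_class_def using sys_iso_rep_unique sys_iso_trans sys_iso_sym by blast

lemma systems_eq_Union: "systems = (\<Union>i<128. sys_class i)"
  using system_rep by (auto simp: sys_class_def)

lemma card_iso: "sys_iso K L \<Longrightarrow> card K = card L"
  by (auto simp: sys_iso_def intro!: card_image[symmetric] inj_onI dest!: permutes_inj simp: inj_image_eq_iff)

lemma card_of_sys_class: "K \<in> sys_class j \<Longrightarrow> j < 128 \<Longrightarrow> card K = length (rep j)"
  by (auto simp: sys_class_def card_iso card_rep_system)

definition ext_into :: "nat set set \<Rightarrow> nat \<Rightarrow> nat set set" where
  "ext_into K j = {A. A \<subseteq> {1..8} \<and> (\<forall>B\<in>K. bezout_compat A B) \<and> sys_iso (insert A K) (rep_system j)}"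

lemma finite_ext_into: "finite (ext_into K j)"
  by (rule finite_subset[of _ "Pow {1..8}"]) (auto simp: ext_into_def)

text \<open>Makes the number of extensions into class j a function of the class of K, that is, a
  well-defined coefficient of the recurrence.\<close>

lemma card_ext_into_iso:
  assumes "sys_iso K L"
  shows "card (ext_into K j) = card (ext_into L j)"
proof -
  obtain \<sigma> where s: "\<sigma> permutes {1..8}" "\<And>A. sys_iso (insert A K) (insert (\<sigma> ` A) L)"
    "\<And>A. (\<forall>B\<in>L. bezout_compat (\<sigma> ` A) B) \<longleftrightarrow> (\<forall>B\<in>K. bezout_compat A B)"
    using sys_iso_insert[OF assms] by metis
  have sub: "\<sigma> ` A \<subseteq> {1..8} \<longleftrightarrow> A \<subseteq> {1..8}" for A
    using permutes_in_image[OF s(1)] by blast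
  have "sys_iso (insert (\<sigma> ` A) L) M \<longleftrightarrow> sys_iso (insert A K) M" for A M
    using s(2) sys_iso_trans sys_iso_sym by blast
  hence mem: "\<sigma> ` A \<in> ext_into L j \<longleftrightarrow> A \<in> ext_into K j" for A
    by (simp only: ext_into_def mem_Collect_eq sub s(3))
  have "(`) \<sigma> ` ext_into K j = ext_into L j"
  proof
    show "ext_into L j \<subseteq> (`) \<sigma> ` ext_into K j"
    proof
      fix B assume B: "B \<in> ext_into L j"
      have "\<sigma> ` (\<sigma> -` B) = B" using permutes_surj[OF s(1)] by (simp add: surj_image_vimage_eq)
      thus "B \<in> (`) \<sigma> ` ext_into K j" using B mem by (metis imageI)
    qed
  qed (use mem in auto)
  moreover have "inj_on ((`) \<sigma>) (ext_into K j)"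
    using permutes_inj[OF s(1)] by (auto simp: inj_on_def inj_image_eq_iff)
  ultimately show ?thesis by (metis card_image)
qed

lemma occ_eq_card: "occ j is = card {k. k < length is \<and> is ! k = j}"
proof (induction "is")
  case (Cons i "is")
  have "{k. k < length (i # is) \<and> (i # is) ! k = j} =
      (if i = j then {0} else {}) \<union> Suc ` {k. k < length is \<and> is ! k = j}"
    by (auto simp: less_Suc_eq_0_disj)
  moreover have "card (\<dots>) = (if i = j then 1 else 0) + card (Suc ` {k. k < length is \<and> is ! k = j})"
    by (subst card_Un_disjoint) auto
  ultimately show ?case using Cons by (simp add: card_image)
qed simp

text \<open>Since no two representatives are isomorphic, the class named by a certificate is the
  only one to which its extension belongs; counting certificates is therefore counting
  extensions.\<close>

lemma card_ext_into_rep: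
  assumes "i < 128" "j < 128"
  shows "card (ext_into (rep_system i) j) = occ j (map fst (exts ! i))"
proof -
  let ?A = "\<lambda>k. set_of (extensions i ! k)"
  note len = length_extensions[OF assms(1)]
  have "ext_into (rep_system i) j = ?A ` {k. k < length (exts ! i) \<and> fst (exts ! i ! k) = j}"
  proof (intro equalityI subsetI)
    fix A assume A: "A \<in> ext_into (rep_system i) j"
    then obtain k where k: "k < length (extensions i)" "A = ?A k"
      using extension_in_list[OF assms(1)] by (auto simp: ext_into_def)
    have "sys_iso (insert A (rep_system i)) (rep_system j)" using A by (simp add: ext_into_def)
    hence "sys_iso (rep_system (fst (exts ! i ! k))) (rep_system j)"
      using sys_iso_trans[OF sys_iso_sym[OF extensionD(3)[OF assms(1) k(1) refl]]] k(2) by simp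
    hence "fst (exts ! i ! k) = j"
      using sys_iso_rep_unique extensionD(1)[OF assms(1) k(1) refl] assms(2) by blast
    thus "A \<in> ?A ` {k. k < length (exts ! i) \<and> fst (exts ! i ! k) = j}" using k len by auto
  next
    fix A assume "A \<in> ?A ` {k. k < length (exts ! i) \<and> fst (exts ! i ! k) = j}"
    then obtain k where k: "k < length (extensions i)" "fst (exts ! i ! k) = j" "A = ?A k"
      using len by auto
    thus "A \<in> ext_into (rep_system i) j"
      using extensionD(3)[OF assms(1) k(1,2)] set_of_subset nth_mem[OF k(1)]
      by (auto simp: ext_into_def mem_extensions)
  qed
  moreover have "inj_on ?A {k. k < length (exts ! i) \<and> fst (exts ! i ! k) = j}"
  proof (rule inj_onI)
    fix k l assume kl: "k \<in> {k. k < length (exts ! i) \<and> fst (exts ! i ! k) = j}"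
      "l \<in> {k. k < length (exts ! i) \<and> fst (exts ! i ! k) = j}" "?A k = ?A l"
    hence "extensions i ! k = extensions i ! l" using inj_set_of by (auto dest: injD)
    thus "k = l"
      using kl len nth_eq_iff_index_eq[OF distinct_select_octs] unfolding extensions_def by auto
  qed
  ultimately have "card (ext_into (rep_system i) j) = card {k. k < length (exts ! i) \<and> fst (exts ! i ! k) = j}"
    by (simp add: card_image)
  also have "{k. k < length (exts ! i) \<and> fst (exts ! i ! k) = j} =
      {k. k < length (map fst (exts ! i)) \<and> map fst (exts ! i) ! k = j}" by auto
  finally show ?thesis by (simp only: occ_eq_card)
qed

text \<open>Counting the pairs (K, A) with K in the j-th class and A in K, once by K and once by the
  smaller system K - {A}.\<close>

lemma flag_count:
  assumes "j < 128"
  shows "card (sys_class j) * length (rep j) = (\<Sum>i<128. card (sys_class i) * occ j (map fst (exts ! i)))"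
proof -
  have "card (sys_class j) * length (rep j) = card (SIGMA K:sys_class j. K)"
    using card_of_sys_class[OF _ assms] system_finite finite_sys_class
    by (subst card_SigmaI) (auto simp: sys_class_def)
  also have "\<dots> = card (SIGMA K:systems. ext_into K j)"
  proof (rule bij_betw_same_card)
    show "bij_betw (\<lambda>(K, A). (K - {A}, A)) (SIGMA K:sys_class j. K) (SIGMA K:systems. ext_into K j)"
    proof (rule bij_betw_byWitness[where f' = "\<lambda>(K, A). (insert A K, A)"])
      show "\<forall>x\<in>(SIGMA K:sys_class j. K). (case case x of (K, A) \<Rightarrow> (K - {A}, A) of (K, A) \<Rightarrow> (insert A K, A)) = x"
        by (auto simp: insert_absorb)
      have *: "A \<notin> K" if "A \<in> ext_into K j" for A K
        using that not_compat_self by (auto simp: ext_into_def)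
      thus "\<forall>x\<in>(SIGMA K:systems. ext_into K j). (case case x of (K, A) \<Rightarrow> (insert A K, A) of (K, A) \<Rightarrow> (K - {A}, A)) = x"
        by auto
      show "(\<lambda>(K, A). (K - {A}, A)) ` (SIGMA K:sys_class j. K) \<subseteq> (SIGMA K:systems. ext_into K j)"
      proof clarsimp
        fix K A assume K: "K \<in> sys_class j" "A \<in> K"
        hence "insert A (K - {A}) \<in> systems" "sys_iso K (rep_system j)" "insert A (K - {A}) = K"
          by (auto simp: sys_class_def insert_absorb)
        thus "K - {A} \<in> systems \<and> A \<in> ext_into (K - {A}) j"
          using systems_insert[of A "K - {A}"] by (auto simp: ext_into_def)
      qed
      show "(\<lambda>(K, A). (insert A K, A)) ` (SIGMA K:systems. ext_into K j) \<subseteq> (SIGMA K:sys_class j. K)"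
        using * systems_insert by (auto simp: ext_into_def sys_class_def)
    qed
  qed
  also have "\<dots> = (\<Sum>K\<in>systems. card (ext_into K j))"
    using finite_systems finite_ext_into by (subst card_SigmaI) auto
  also have "\<dots> = (\<Sum>i<128. \<Sum>K\<in>sys_class i. card (ext_into K j))"
    unfolding systems_eq_Union using finite_sys_class sys_class_disjoint
    by (subst sum.UNION_disjoint) auto
  also have "\<dots> = (\<Sum>i<128. card (sys_class i) * occ j (map fst (exts ! i)))"
  proof (rule sum.cong[OF refl])
    fix i :: nat assume i: "i \<in> {..<128}"
    have "card (ext_into K j) = occ j (map fst (exts ! i))" if "K \<in> sys_class i" for K
      using that card_ext_into_iso[of K "rep_system i" j] card_ext_into_rep[of i j] i assms
      by (auto simp: sys_class_def)
    thus "(\<Sum>K\<in>sys_class i. card (ext_into K j)) = card (sys_class i) * occ j (map fst (exts ! i))"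
      by simp
  qed
  finally show ?thesis .
qed

lemma flow_eq_sum: "length ms = length es \<Longrightarrow> flow j ms es = (\<Sum>i<length es. ms ! i * occ j (es ! i))"
proof (induction ms es rule: list_induct2)
  case (Cons m ms e es)
  thus ?case by (simp add: sum.lessThan_Suc_shift del: sum.lessThan_Suc)
qed simp

text \<open>Makes the recurrence triangular: class j receives contributions only from classes with
  one element less, whose sizes are known by induction in \<open>card_sys_class\<close>.\<close>

lemma occ_nonzeroD:
  assumes "i < 128" "occ j (map fst (exts ! i)) \<noteq> 0"
  shows "length (rep j) = Suc (length (rep i))"
proof -
  have "{k. k < length (map fst (exts ! i)) \<and> map fst (exts ! i) ! k = j} \<noteq> {}"
    using assms(2) unfolding occ_eq_card by (metis card.empty)
  then obtain k where "k < length (exts ! i)" "fst (exts ! i ! k) = j" by auto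
  thus ?thesis using extensionD(2)[OF assms(1), of k] length_extensions[OF assms(1)] by auto
qed

lemma length_class_sizes: "length class_sizes = 128"
  by (simp add: class_sizes_def)

lemma card_sys_class:
  assumes "j < 128"
  shows "card (sys_class j) = class_sizes ! j"
  using assms
proof (induction "length (rep j)" arbitrary: j rule: less_induct)
  case less
  show ?case
  proof (cases "j = 0")
    case True
    have "sys_class 0 = {{}}"
      by (auto simp: sys_class_def sys_iso_def rep_system_def rep_0 systems_def intro: permutes_id)
    thus ?thesis using True by (simp add: class_sizes_def)
  next
    case False
    \<comment> \<open>Class 0 is the only one with an empty representative; away from it the factor
      \<open>length (rep j)\<close> is nonzero and can be cancelled at the end.\<close>
    have "rep j \<noteq> []"
    proof
      assume "rep j = []"
      hence "sys_iso (rep_system j) (rep_system 0)" by (simp add: rep_system_def rep_0 sys_iso_refl)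
      thus False using sys_iso_rep_unique less.prems False by simp
    qed
    have "card (sys_class i) * occ j (map fst (exts ! i)) = class_sizes ! i * occ j (map fst (exts ! i))"
      if "i < 128" for i
      using less.hyps[of i] occ_nonzeroD[OF that] that by (cases "occ j (map fst (exts ! i)) = 0") auto
    hence "card (sys_class j) * length (rep j) = (\<Sum>i<128. class_sizes ! i * occ j (map fst (exts ! i)))"
      using flag_count[OF less.prems] by (metis (no_types, lifting) lessThan_iff sum.cong)
    also have "\<dots> = flow j class_sizes (map (map fst) exts)"
      by (subst flow_eq_sum) (auto simp: length_exts length_class_sizes)
    also have "\<dots> = class_sizes ! j * length (rep j)"
    proof -
      have "flow_ok (map (map fst) exts) ([1..<128] ! (j - 1)) (tl class_sizes ! (j - 1))"
        by (rule list_all2_nthD[OF flow_class_sizes]) (use False less.prems in simp)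
      moreover have "[1..<128] ! (j - 1) = j" using False less.prems by (subst nth_upt) auto
      moreover have "tl class_sizes ! (j - 1) = class_sizes ! j"
        using False less.prems by (subst nth_tl) (auto simp: length_class_sizes)
      ultimately show ?thesis by (simp only: flow_ok_def)
    qed
    finally show ?thesis using \<open>rep j \<noteq> []\<close> by simp
  qed
qed

lemma class_sizes_pos: "list_all (\<lambda>n. n > 0) class_sizes"
  by (simp add: class_sizes_def)

text \<open>Pairwise compatibility inside a representative is not tested directly: a positive class
  size provides some system isomorphic to the representative, and being a system is preserved by
  isomorphism.\<close>

lemma rep_system_in_systems:
  assumes "i < 128"
  shows "rep_system i \<in> systems"
proof -
  have "card (sys_class i) > 0"
    using class_sizes_pos assms by (simp add: card_sys_class list_all_length length_class_sizes)
  then obtain K where "K \<in> sys_class i" by (metis card_gt_0_iff ex_in_conv)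
  thus ?thesis using sys_iso_system by (auto simp: sys_class_def)
qed

section \<open>Systems and pairs\<close>

definition block :: "'a set \<Rightarrow> nat \<Rightarrow> 'a set set \<Rightarrow> 'a set \<Rightarrow> bool" where
  "block X k F B \<longleftrightarrow> B \<subseteq> X \<and> k \<le> card B \<and> (\<forall>I. I \<subseteq> B \<and> card I = k \<longrightarrow> I \<in> F)"

definition max_blocks :: "'a set \<Rightarrow> nat \<Rightarrow> 'a set set \<Rightarrow> 'a set set" where
  "max_blocks X k F = {B. block X k F B \<and> (\<forall>B'. block X k F B' \<and> B \<subseteq> B' \<longrightarrow> B' = B)}"

text \<open>With k = 3 and k = 6 these are conditions (2) and (3) of Bezout's weak criteria, so that
  one argument treats lines and conics.\<close>

definition exchange :: "nat \<Rightarrow> 'a set set \<Rightarrow> bool" where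
  "exchange k F \<longleftrightarrow> (\<forall>I1\<in>F. \<forall>I2\<in>F. I1 \<noteq> I2 \<and> k - 1 \<le> card (I1 \<inter> I2) \<longrightarrow>
     (\<forall>I. I \<subseteq> I1 \<union> I2 \<and> card I = k \<longrightarrow> I \<in> F))"

text \<open>Fix a set D of k - 1 common points and induct on the number of points of S outside D.
  With one such point x, S consists of D and x and lies in B1 or B2. With two, x and y, take a point
  d of D outside S: replacing x or y by d gives two members of F closer to D, which share k - 1
  points and whose union contains S.\<close>

lemma block_Un:
  assumes "finite X" "0 < k" "exchange k F" "block X k F B1" "block X k F B2" "k - 1 \<le> card (B1 \<inter> B2)"
  shows "block X k F (B1 \<union> B2)"
proof -
  have fin: "finite B1" "finite B2" using assms by (auto simp: block_def intro: finite_subset)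
  obtain D where D: "D \<subseteq> B1 \<inter> B2" "card D = k - 1"
    using assms(6) obtain_subset_with_card_n by metis
  have finD: "finite D" using D fin by (auto intro: finite_subset)
  have "S \<in> F" if "S \<subseteq> B1 \<union> B2" "card S = k" for S
    using that
  proof (induction "card (S - D)" arbitrary: S rule: less_induct)
    case less
    have finS: "finite S" using less.prems assms(2) card_ge_0_finite by metis
    have "\<not> S \<subseteq> D" using card_mono[OF finD, of S] less.prems D assms(2) by auto
    then obtain x where x: "x \<in> S" "x \<notin> D" by auto
    show ?case
    proof (cases "S - {x} \<subseteq> D")
      case True
      hence "S - {x} = D" using x finS less.prems D finD by (intro card_subset_eq) auto
      hence "S \<subseteq> B1 \<or> S \<subseteq> B2" using x less.prems D by blast
      thus ?thesis using assms(4,5) less.prems by (auto simp: block_def)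
    next
      case False
      then obtain y where y: "y \<in> S" "y \<noteq> x" "y \<notin> D" by auto
      have "card (S - {x,y}) = k - 2" using x y finS less.prems by (subst card_Diff_subset) auto
      have "\<not> D \<subseteq> S"
      proof
        assume "D \<subseteq> S"
        hence "D \<subseteq> S - {x,y}" using x y by auto
        hence "k - 1 \<le> k - 2" using card_mono[of "S - {x,y}" D] finS D \<open>card (S - {x,y}) = k - 2\<close> by simp
        moreover have "card {x,y} \<le> k" using card_mono[OF finS, of "{x,y}"] x y less.prems by auto
        ultimately show False using y by simp
      qed
      then obtain d where d: "d \<in> D" "d \<notin> S" by auto
      define S1 S2 where "S1 = insert d (S - {x})" and "S2 = insert d (S - {y})"
      have c: "card S1 = k" "card S2 = k"
        using x y d finS less.prems assms(2) by (auto simp: S1_def S2_def)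
      have "S1 - D \<subset> S - D" "S2 - D \<subset> S - D" using x y d by (auto simp: S1_def S2_def)
      hence "card (S1 - D) < card (S - D)" "card (S2 - D) < card (S - D)"
        using finS by (auto intro: psubset_card_mono)
      moreover have "S1 \<subseteq> B1 \<union> B2" "S2 \<subseteq> B1 \<union> B2" using less.prems d D by (auto simp: S1_def S2_def)
      ultimately have F: "S1 \<in> F" "S2 \<in> F" using less.hyps c by blast+
      have "S1 \<inter> S2 = insert d (S - {x,y})" using d by (auto simp: S1_def S2_def)
      hence "card (S1 \<inter> S2) = Suc (k - 2)" using d finS \<open>card (S - {x,y}) = k - 2\<close> by simp
      hence "k - 1 \<le> card (S1 \<inter> S2)" by simp
      moreover have "S1 \<noteq> S2" using x y d by (auto simp: S1_def S2_def)
      moreover have "S \<subseteq> S1 \<union> S2" using y x by (auto simp: S1_def S2_def)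
      ultimately show ?thesis using assms(3) F less.prems(2) unfolding exchange_def
        by blast
    qed
  qed
  moreover have "k \<le> card (B1 \<union> B2)"
    using assms(4) card_mono[of "B1 \<union> B2" B1] fin by (auto simp: block_def)
  ultimately show ?thesis using assms(4,5) by (auto simp: block_def)
qed

lemma max_blocks_Int:
  assumes "finite X" "0 < k" "exchange k F" "B1 \<in> max_blocks X k F" "B2 \<in> max_blocks X k F" "B1 \<noteq> B2"
  shows "card (B1 \<inter> B2) < k - 1"
proof (rule ccontr)
  assume "\<not> ?thesis"
  hence "block X k F (B1 \<union> B2)" using assms by (intro block_Un) (auto simp: max_blocks_def)
  hence "B1 \<union> B2 = B1" "B1 \<union> B2 = B2" using assms by (auto simp: max_blocks_def)
  thus False using assms by simp
qed

lemma in_max_block: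
  assumes "finite X" "I \<in> F" "I \<subseteq> X" "card I = k" "0 < k"
  obtains B where "B \<in> max_blocks X k F" "I \<subseteq> B"
proof -
  have fin: "finite I" using assms finite_subset by metis
  have "block X k F I"
    using assms fin by (auto simp: block_def) (metis card_subset_eq)
  moreover have "finite {B. block X k F B}"
    by (rule finite_subset[of _ "Pow X"]) (use assms in \<open>auto simp: block_def\<close>)
  ultimately obtain B where B: "B \<in> {B. block X k F B}" "I \<subseteq> B" "\<forall>b\<in>{B. block X k F B}. B \<subseteq> b \<longrightarrow> B = b"
    using finite_has_maximal2[of "{B. block X k F B}" I] by auto
  hence "B \<in> max_blocks X k F" by (auto simp: max_blocks_def)
  thus ?thesis using that B by blast
qed

lemma covered_by_max_blocks:
  assumes "finite X" "0 < k" "\<forall>I\<in>F. I \<subseteq> X \<and> card I = k"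
  shows "{I. I \<subseteq> X \<and> card I = k \<and> (\<exists>B\<in>max_blocks X k F. I \<subseteq> B)} = F"
proof (intro equalityI subsetI)
  fix I assume I: "I \<in> F"
  then obtain B where "B \<in> max_blocks X k F" "I \<subseteq> B"
    using in_max_block[of X I F k] assms by blast
  thus "I \<in> {I. I \<subseteq> X \<and> card I = k \<and> (\<exists>B\<in>max_blocks X k F. I \<subseteq> B)}" using assms(3) I by blast
qed (auto simp: max_blocks_def block_def)

text \<open>Any block B lies in a single L: take a k-subset I of B, contained in some L, and
  exchange one of its points for any x in B. The new k-set lies in some M, which shares k - 1 points
  with L, so M = L and x is in L.\<close>

lemma max_blocks_covered:
  assumes "finite X" "1 < k" "\<forall>L\<in>\<L>. L \<subseteq> X \<and> k \<le> card L"
    and int: "\<And>L M. L \<in> \<L> \<Longrightarrow> M \<in> \<L> \<Longrightarrow> L \<noteq> M \<Longrightarrow> card (L \<inter> M) < k - 1"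
  shows "max_blocks X k {I. I \<subseteq> X \<and> card I = k \<and> (\<exists>L\<in>\<L>. I \<subseteq> L)} = \<L>" (is "max_blocks X k ?F = _")
proof -
  have 1: "block X k ?F L" if "L \<in> \<L>" for L
    using assms(3) that unfolding block_def by blast
  have 2: "\<exists>L\<in>\<L>. B \<subseteq> L" if B: "block X k ?F B" for B
  proof -
    have finB: "finite B" using B assms(1) by (auto simp: block_def intro: finite_subset)
    have "k \<le> card B" using B by (simp add: block_def)
    then obtain I where I: "I \<subseteq> B" "card I = k" by (metis obtain_subset_with_card_n)
    then obtain L where L: "L \<in> \<L>" "I \<subseteq> L" using B unfolding block_def by blast
    have finI: "finite I" using I finB finite_subset by blast
    have "x \<in> L" if "x \<in> B" "x \<notin> I" for x
    proof -
      obtain a where a: "a \<in> I" using I assms(2) by fastforce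
      have "card (insert x (I - {a})) = k" "insert x (I - {a}) \<subseteq> B" using that a I finI assms(2) by auto
      then obtain M where M: "M \<in> \<L>" "insert x (I - {a}) \<subseteq> M" using B unfolding block_def by blast
      have "card (I - {a}) \<le> card (L \<inter> M)"
        using L M assms(1,3) by (intro card_mono) (auto intro: finite_subset)
      hence "k - 1 \<le> card (L \<inter> M)" using a I by simp
      hence "L = M" using int[OF L(1) M(1)] by fastforce
      thus ?thesis using M by auto
    qed
    thus ?thesis using L by (intro bexI[of _ L]) auto
  qed
  have 3: "L = M" if "L \<in> \<L>" "M \<in> \<L>" "L \<subseteq> M" for L M
  proof (rule ccontr)
    assume "L \<noteq> M"
    hence "card L < k - 1" using int[OF that(1,2)] that(3) by (simp add: Int_absorb2)
    thus False using assms(3) that by force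
  qed
  show ?thesis
  proof (intro equalityI subsetI)
    fix B assume "B \<in> max_blocks X k ?F"
    hence B: "block X k ?F B" "\<And>B'. block X k ?F B' \<Longrightarrow> B \<subseteq> B' \<Longrightarrow> B' = B" by (auto simp: max_blocks_def)
    obtain L where "L \<in> \<L>" "B \<subseteq> L" using 2[OF B(1)] by blast
    thus "B \<in> \<L>" using B(2)[OF 1] by blast
  next
    fix L assume L: "L \<in> \<L>"
    have "B' = L" if B': "block X k ?F B'" "L \<subseteq> B'" for B'
    proof -
      obtain M where "M \<in> \<L>" "B' \<subseteq> M" using 2[OF B'(1)] by blast
      thus ?thesis using 3[OF L] B'(2) by blast
    qed
    thus "L \<in> max_blocks X k ?F" using 1[OF L] by (auto simp: max_blocks_def)
  qed
qed

section \<open>The bijection between systems and pairs satisfying Bezout's weak criteria\<close>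

definition pair_of :: "nat set set \<Rightarrow> pair" where
  "pair_of K = ({I. I \<subseteq> {1..8} \<and> card I = 3 \<and> (\<exists>L\<in>K. I \<subseteq> L)},
                {J. J \<subseteq> {1..8} \<and> card J = 6 \<and> (\<exists>A\<in>K. card A \<le> 2 \<and> J \<inter> A = {})})"

definition lines :: "nat set set \<Rightarrow> nat set set" where
  "lines K = {L\<in>K. 3 \<le> card L}"

definition conics :: "nat set set \<Rightarrow> nat set set" where
  "conics K = (\<lambda>A. {1..8} - A) ` {A\<in>K. card A \<le> 2}"

definition system_of :: "pair \<Rightarrow> nat set set" where
  "system_of Q = max_blocks {1..8} 3 (fst Q) \<union> (\<lambda>B. {1..8} - B) ` max_blocks {1..8} 6 (snd Q)"

lemma card_compl8: "A \<subseteq> {1..8::nat} \<Longrightarrow> card ({1..8} - A) = 8 - card A"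
  by (subst card_Diff_subset) (auto intro: finite_subset)

lemma system_subset: "K \<in> systems \<Longrightarrow> A \<in> K \<Longrightarrow> A \<subseteq> {1..8}"
  by (auto simp: systems_def)

lemma system_compat: "K \<in> systems \<Longrightarrow> A \<in> K \<Longrightarrow> B \<in> K \<Longrightarrow> A \<noteq> B \<Longrightarrow> bezout_compat A B"
  by (auto simp: systems_def pairwise_def)

lemma finite8: "A \<subseteq> {1..8::nat} \<Longrightarrow> finite A"
  by (rule finite_subset) auto

text \<open>A set that contains a triple has at least three elements and is therefore a line; this
  is why \<open>pair_of\<close> asks for a cardinality only in its second component.\<close>

lemma fst_pair_of: "K \<in> systems \<Longrightarrow>
    fst (pair_of K) = {I. I \<subseteq> {1..8} \<and> card I = 3 \<and> (\<exists>L\<in>lines K. I \<subseteq> L)}"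
proof -
  assume K: "K \<in> systems"
  have "3 \<le> card L" if "L \<in> K" "I \<subseteq> L" "card I = 3" for I L
    using card_mono[OF finite8[OF system_subset[OF K that(1)]] that(2)] that(3) by simp
  hence "(\<exists>L\<in>K. I \<subseteq> L) \<longleftrightarrow> (\<exists>L\<in>lines K. I \<subseteq> L)" if "card I = 3" for I
    using that unfolding lines_def by blast
  thus ?thesis by (auto simp: pair_of_def)
qed

lemma snd_pair_of: "K \<in> systems \<Longrightarrow>
    snd (pair_of K) = {J. J \<subseteq> {1..8} \<and> card J = 6 \<and> (\<exists>C\<in>conics K. J \<subseteq> C)}"
  unfolding pair_of_def conics_def by auto

lemma lines_props:
  assumes "K \<in> systems"
  shows "\<forall>L\<in>lines K. L \<subseteq> {1..8} \<and> 3 \<le> card L"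
    and "L \<in> lines K \<Longrightarrow> M \<in> lines K \<Longrightarrow> L \<noteq> M \<Longrightarrow> card (L \<inter> M) < 3 - 1"
  using assms system_compat[of K L M] by (auto simp: systems_def lines_def bezout_compat_def compat_sizes_iff)

text \<open>Distinct conics of a system leave out disjoint pairs of points, so both have exactly six
  points and they share the other four.\<close>

lemma conics_props:
  assumes "K \<in> systems"
  shows "\<forall>C\<in>conics K. C \<subseteq> {1..8} \<and> 6 \<le> card C"
    and "C \<in> conics K \<Longrightarrow> D \<in> conics K \<Longrightarrow> C \<noteq> D \<Longrightarrow> card (C \<inter> D) < 6 - 1"
proof -
  show "\<forall>C\<in>conics K. C \<subseteq> {1..8} \<and> 6 \<le> card C"
    using card_compl8 assms by (auto simp: conics_def systems_def)
  assume "C \<in> conics K" "D \<in> conics K" "C \<noteq> D"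
  then obtain A B where AB: "A \<in> K" "B \<in> K" "card A \<le> 2" "card B \<le> 2" "C = {1..8} - A" "D = {1..8} - B"
    by (auto simp: conics_def)
  hence "bezout_compat A B" using system_compat[OF assms AB(1,2)] \<open>C \<noteq> D\<close> by auto
  hence "card A = 2" "card B = 2" "card (A \<inter> B) = 0" using AB by (auto simp: bezout_compat_def compat_sizes_iff)
  moreover have "A \<subseteq> {1..8}" "B \<subseteq> {1..8}" using AB assms system_subset by blast+
  ultimately have "card (A \<union> B) = 4" "A \<union> B \<subseteq> {1..8}"
    using card_Un_Int[of A B] finite8 by auto
  moreover have "C \<inter> D = {1..8} - (A \<union> B)" using AB by auto
  ultimately show "card (C \<inter> D) < 6 - 1" using card_compl8[of "A \<union> B"] by simp
qed

lemma system_eq_lines_conics: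
  assumes "K \<in> systems"
  shows "lines K \<union> (\<lambda>C. {1..8} - C) ` conics K = K"
proof -
  have "(\<lambda>C. {1..8} - C) ` conics K = {A\<in>K. card A \<le> 2}"
    using system_subset[OF assms] unfolding conics_def image_image
    by (intro trans[OF image_cong[OF refl] image_ident]) (auto simp: double_diff)
  thus ?thesis by (auto simp: lines_def)
qed

lemma system_of_pair_of:
  assumes "K \<in> systems"
  shows "system_of (pair_of K) = K"
  unfolding system_of_def fst_pair_of[OF assms] snd_pair_of[OF assms]
  by (subst max_blocks_covered[OF _ _ lines_props[OF assms]], simp, simp, assumption+,
      subst max_blocks_covered[OF _ _ conics_props[OF assms]], simp, simp, assumption+,
      rule system_eq_lines_conics[OF assms])

lemma pair_of_in_pairs: "pair_of K \<in> pairs"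
  by (auto simp: pair_of_def pairs_def)

lemma line_conic_Int:
  assumes "K \<in> systems" "L \<in> lines K" "C \<in> conics K"
  shows "card (L \<inter> C) \<le> 2"
proof -
  obtain A where A: "A \<in> K" "card A \<le> 2" "C = {1..8} - A" using assms by (auto simp: conics_def)
  have L: "L \<in> K" "3 \<le> card L" "L \<subseteq> {1..8}" using assms system_subset by (auto simp: lines_def)
  have "bezout_compat L A" using system_compat[OF assms(1) L(1) A(1)] A L by force
  hence "card L \<le> card (L \<inter> A) + 2" using A L by (auto simp: bezout_compat_def compat_sizes_iff)
  moreover have "card L = card (L \<inter> A) + card (L - A)" using finite8[OF L(3)] by (metis card_Int_Diff)
  moreover have "L \<inter> C = L - A" using A L by auto
  ultimately show ?thesis by simp
qed

lemma bezout_weak_pair_of: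
  assumes K: "K \<in> systems"
  shows "bezout_weak (pair_of K)"
proof -
  have 1: "card (I \<inter> J) \<le> 2" if IJ: "I \<in> fst (pair_of K)" "J \<in> snd (pair_of K)" for I J
  proof -
    obtain L C where LC: "L \<in> lines K" "I \<subseteq> L" "C \<in> conics K" "J \<subseteq> C"
      using IJ K by (auto simp: fst_pair_of snd_pair_of)
    have "card (I \<inter> J) \<le> card (L \<inter> C)"
      using LC lines_props(1)[OF K] by (intro card_mono finite_Int disjI1 finite8) auto
    thus ?thesis using line_conic_Int[OF K LC(1,3)] by simp
  qed
  have 2: "I \<in> fst (pair_of K)" if I: "I1 \<in> fst (pair_of K)" "I2 \<in> fst (pair_of K)" "1 < card (I1 \<inter> I2)"
    "I \<subseteq> I1 \<union> I2" "card I = 3" for I I1 I2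
  proof -
    obtain L M where LM: "L \<in> lines K" "I1 \<subseteq> L" "M \<in> lines K" "I2 \<subseteq> M"
      using I K by (auto simp: fst_pair_of)
    have "card (I1 \<inter> I2) \<le> card (L \<inter> M)"
      using LM lines_props(1)[OF K] by (intro card_mono finite_Int) (auto intro: finite8)
    hence "L = M" using lines_props(2)[OF K LM(1,3)] I by fastforce
    thus ?thesis using LM I lines_props(1)[OF K] K by (auto simp: fst_pair_of)
  qed
  have 3: "J \<in> snd (pair_of K)" if J: "J1 \<in> snd (pair_of K)" "J2 \<in> snd (pair_of K)" "4 < card (J1 \<inter> J2)"
    "J \<subseteq> J1 \<union> J2" "card J = 6" for J J1 J2
  proof -
    obtain L M where LM: "L \<in> conics K" "J1 \<subseteq> L" "M \<in> conics K" "J2 \<subseteq> M"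
      using J K by (auto simp: snd_pair_of)
    have "card (J1 \<inter> J2) \<le> card (L \<inter> M)"
      using LM conics_props(1)[OF K] by (intro card_mono finite_Int) (auto intro: finite8)
    hence "L = M" using conics_props(2)[OF K LM(1,3)] J by fastforce
    thus ?thesis using LM J conics_props(1)[OF K] K by (auto simp: snd_pair_of)
  qed
  show ?thesis
    unfolding bezout_weak_def case_prod_beta using 1 2 3 by blast
qed

text \<open>The converse direction, in which all three criteria are needed: (2) and (3) bound the
  intersections of maximal blocks of the same kind through \<open>max_blocks_Int\<close>, and (1)
  bounds those of a line with a conic.\<close>

lemma
  assumes Q: "Q \<in> pairs" "bezout_weak Q"
  shows system_of_in_systems: "system_of Q \<in> systems"
    and pair_of_system_of: "pair_of (system_of Q) = Q"
proof -
  obtain F G where FG: "Q = (F, G)" by (cases Q)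
  let ?L = "max_blocks {1..8::nat} 3 F" and ?C = "max_blocks {1..8::nat} 6 G"
  have F: "\<forall>I\<in>F. I \<subseteq> {1..8} \<and> card I = 3" and G: "\<forall>J\<in>G. J \<subseteq> {1..8} \<and> card J = 6"
    using Q FG by (auto simp: pairs_def)
  note bezout = Q(2)[unfolded FG bezout_weak_def prod.case]
  have bz: "card (I \<inter> J) \<le> 2" if "I \<in> F" "J \<in> G" for I J
    using conjunct1[OF bezout] that by blast
  have "(3 - 1 \<le> c) = (1 < c)" "(6 - 1 \<le> c) = (4 < c)" for c :: nat by auto
  hence exF: "exchange 3 F" and exG: "exchange 6 G"
    using conjunct1[OF conjunct2[OF bezout]] conjunct2[OF conjunct2[OF bezout]]
    by (simp_all only: exchange_def)
  have L: "L \<subseteq> {1..8}" "3 \<le> card L" "\<And>I. I \<subseteq> L \<Longrightarrow> card I = 3 \<Longrightarrow> I \<in> F" if "L \<in> ?L" for L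
    using that by (auto simp: max_blocks_def block_def)
  have C: "C \<subseteq> {1..8}" "6 \<le> card C" "\<And>J. J \<subseteq> C \<Longrightarrow> card J = 6 \<Longrightarrow> J \<in> G" if "C \<in> ?C" for C
    using that by (auto simp: max_blocks_def block_def)
  have LL: "card (L \<inter> M) \<le> 1" if "L \<in> ?L" "M \<in> ?L" "L \<noteq> M" for L M
    using max_blocks_Int[OF _ _ exF that] by simp
  have CC: "card (C \<inter> D) \<le> 4" if "C \<in> ?C" "D \<in> ?C" "C \<noteq> D" for C D
    using max_blocks_Int[OF _ _ exG that] by simp
  \<comment> \<open>Three common points would form a triple I that extends to a sextuple J inside C;
    then I and J share three points, against criterion (1).\<close>
  have LC: "card (L \<inter> C) \<le> 2" if LC: "L \<in> ?L" "C \<in> ?C" for L C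
  proof (rule ccontr)
    assume "\<not> ?thesis"
    hence "3 \<le> card (L \<inter> C)" by simp
    then obtain I where I: "I \<subseteq> L \<inter> C" "card I = 3" using obtain_subset_with_card_n by metis
    have "finite C" using finite8 C(1)[OF LC(2)] .
    then obtain J where J: "I \<subseteq> J" "J \<subseteq> C" "card J = 6"
      using exists_subset_between[of I 6 C] I C(2)[OF LC(2)] by auto
    have "I \<inter> J = I" using J by auto
    thus False using bz[of I J] L(3)[OF LC(1), of I] C(3)[OF LC(2) J(2,3)] I by simp
  qed
  have sys: "system_of Q = ?L \<union> (\<lambda>B. {1..8} - B) ` ?C" by (simp add: system_of_def FG)
  have cC: "card ({1..8} - C) = 8 - card C" "card ({1..8} - C) \<le> 2" if "C \<in> ?C" for C
    using card_compl8[OF C(1)[OF that]] C(2)[OF that] by auto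
  have c1: "bezout_compat L ({1..8} - C)" if "L \<in> ?L" "C \<in> ?C" for L C
  proof -
    have "L - C = L \<inter> ({1..8} - C)" using L(1)[OF that(1)] by auto
    moreover have "card L = card (L \<inter> C) + card (L - C)"
      using finite8[OF L(1)[OF that(1)]] by (metis card_Int_Diff)
    ultimately show ?thesis
      using LC[OF that] L(2)[OF that(1)] cC[OF that(2)] by (auto simp: bezout_compat_def compat_sizes_iff)
  qed
  have c2: "bezout_compat ({1..8} - C) ({1..8} - D)" if CD: "C \<in> ?C" "D \<in> ?C" "C \<noteq> D" for C D
  proof -
    let ?A = "{1..8} - C" and ?B = "{1..8} - D"
    have "C \<inter> D = {1..8} - (?A \<union> ?B)" using C(1)[OF CD(1)] C(1)[OF CD(2)] by auto
    moreover have "?A \<union> ?B \<subseteq> {1..8}" by auto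
    ultimately have "4 \<le> card (?A \<union> ?B)" using CC[OF CD] card_compl8[of "?A \<union> ?B"] by simp
    moreover have "card ?A + card ?B = card (?A \<union> ?B) + card (?A \<inter> ?B)" by (rule card_Un_Int) auto
    ultimately have "card ?A = 2 \<and> card ?B = 2 \<and> card (?A \<inter> ?B) = 0"
      using cC(2)[OF CD(1)] cC(2)[OF CD(2)] by linarith
    thus ?thesis unfolding bezout_compat_def compat_sizes_iff by presburger
  qed
  have c3: "bezout_compat L M" if "L \<in> ?L" "M \<in> ?L" "L \<noteq> M" for L M
    using LL[OF that] L(2)[OF that(1)] L(2)[OF that(2)] by (auto simp: bezout_compat_def compat_sizes_iff)
  have "pairwise bezout_compat (system_of Q)"
    unfolding sys
  proof (rule pairwiseI)
    fix A B assume AB: "A \<in> ?L \<union> (\<lambda>B. {1..8} - B) ` ?C" "B \<in> ?L \<union> (\<lambda>B. {1..8} - B) ` ?C" "A \<noteq> B"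
    from AB(1) show "bezout_compat A B"
    proof
      assume A: "A \<in> ?L"
      from AB(2) show ?thesis using c3[OF A _ AB(3)] c1[OF A] by auto
    next
      assume "A \<in> (\<lambda>B. {1..8} - B) ` ?C"
      then obtain C where C': "C \<in> ?C" "A = {1..8} - C" by blast
      from AB(2) show ?thesis
      proof
        assume "B \<in> ?L"
        thus ?thesis using c1 C' bezout_compat_commute by blast
      next
        assume "B \<in> (\<lambda>B. {1..8} - B) ` ?C"
        then obtain D where "D \<in> ?C" "B = {1..8} - D" by blast
        thus ?thesis using c2[OF C'(1)] C' AB(3) by blast
      qed
    qed
  qed
  moreover have "system_of Q \<subseteq> Pow {1..8}" using L(1) unfolding sys by blast
  ultimately show K: "system_of Q \<in> systems" by (simp add: systems_def)
  have "lines (system_of Q) = ?L"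
    using L(2) cC(2) unfolding lines_def sys by fastforce
  moreover have "conics (system_of Q) = ?C"
  proof -
    have "{A \<in> system_of Q. card A \<le> 2} = (\<lambda>B. {1..8} - B) ` ?C"
      using L(2) cC(2) unfolding sys by fastforce
    hence "conics (system_of Q) = (\<lambda>B. {1..8} - ({1..8} - B)) ` ?C"
      unfolding conics_def by (simp only: image_image)
    also have "\<dots> = ?C"
      using C(1) by (intro trans[OF image_cong[OF refl] image_ident]) (simp add: double_diff)
    finally show ?thesis .
  qed
  ultimately have "fst (pair_of (system_of Q)) = F" "snd (pair_of (system_of Q)) = G"
    unfolding fst_pair_of[OF K] snd_pair_of[OF K]
    using covered_by_max_blocks[OF _ _ F] covered_by_max_blocks[OF _ _ G] by simp_all
  thus "pair_of (system_of Q) = Q" by (metis FG prod.collapse prod.inject fst_conv snd_conv)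
qed

section \<open>Orbits of pairs and counts of invariant sets\<close>

lemma pair_of_image:
  assumes "\<sigma> permutes {1..8}"
  shows "pair_of ((`) \<sigma> ` K) = act \<sigma> (pair_of K)"
proof -
  note inj = permutes_inj[OF assms]
  have card: "card (\<sigma> ` A) = card A" for A using inj by (simp add: card_image inj_on_subset)
  have sub: "\<sigma> ` A \<subseteq> {1..8} \<longleftrightarrow> A \<subseteq> {1..8}" for A using permutes_in_image[OF assms] by blast
  have subs: "\<sigma> ` A \<subseteq> \<sigma> ` B \<longleftrightarrow> A \<subseteq> B" and disj: "\<sigma> ` A \<inter> \<sigma> ` B = {} \<longleftrightarrow> A \<inter> B = {}" for A B
    using inj by (auto dest: injD simp: inj_image_subset_iff image_Int[symmetric])
  have ex: "\<exists>B. A = \<sigma> ` B" for A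
    using permutes_surj[OF assms] by (metis surj_image_vimage_eq)
  have img: "{I. P I} = (`) \<sigma> ` {I. P (\<sigma> ` I)}" for P
  proof (intro equalityI subsetI)
    fix A assume "A \<in> {I. P I}"
    moreover obtain B where "A = \<sigma> ` B" using ex by blast
    ultimately show "A \<in> (`) \<sigma> ` {I. P (\<sigma> ` I)}" by auto
  qed auto
  have "{I. I \<subseteq> {1..8} \<and> card I = 3 \<and> (\<exists>L\<in>(`) \<sigma> ` K. I \<subseteq> L)} =
      (`) \<sigma> ` {I. I \<subseteq> {1..8} \<and> card I = 3 \<and> (\<exists>L\<in>K. I \<subseteq> L)}"
    by (subst img) (simp only: card sub subs bex_simps)
  moreover have "{J. J \<subseteq> {1..8} \<and> card J = 6 \<and> (\<exists>A\<in>(`) \<sigma> ` K. card A \<le> 2 \<and> J \<inter> A = {})} =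
      (`) \<sigma> ` {J. J \<subseteq> {1..8} \<and> card J = 6 \<and> (\<exists>A\<in>K. card A \<le> 2 \<and> J \<inter> A = {})}"
    by (subst img) (simp only: card sub disj bex_simps)
  ultimately show ?thesis by (simp only: pair_of_def act_def fst_conv snd_conv)
qed

lemma inj_on_pair_of: "inj_on pair_of systems"
  by (metis inj_onI system_of_pair_of)

lemma orbit_pair_of:
  assumes "i < 128" "K \<in> sys_class i"
  shows "orbit (sym_group 8) act (pair_of K) = pair_of ` sys_class i"
proof -
  have "sys_class i = {L. sys_iso K L}"
    using assms sys_iso_trans sys_iso_sym sys_iso_system unfolding sys_class_def by blast
  also have "\<dots> = {(`) \<sigma> ` K | \<sigma>. \<sigma> permutes {1..8}}"
    by (auto simp: sys_iso_def)
  finally have "pair_of ` sys_class i = {pair_of ((`) \<sigma> ` K) | \<sigma>. \<sigma> permutes {1..8}}" by auto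
  also have "\<dots> = {act \<sigma> (pair_of K) | \<sigma>. \<sigma> permutes {1..8}}"
    using pair_of_image by metis
  finally show ?thesis by (simp add: orbit_def sym_group_carrier)
qed

lemma rep_system_in_class: "i < 128 \<Longrightarrow> rep_system i \<in> sys_class i"
  by (simp add: sys_class_def rep_system_in_systems sys_iso_refl)

text \<open>The sets counted in the theorem are closed under permutations and consist of pairs
  satisfying the criteria, hence are unions of classes. Each count is thereby reduced to deciding
  which of the 128 representatives belong to the set.\<close>

lemma
  assumes "\<forall>Q\<in>E. Q \<in> pairs \<and> bezout_weak Q"
    and "\<forall>\<sigma> Q. \<sigma> permutes {1..8} \<longrightarrow> Q \<in> E \<longrightarrow> act \<sigma> Q \<in> E"
    and "I = {i. i < 128 \<and> pair_of (rep_system i) \<in> E}"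
  shows card_invariant_set: "card E = (\<Sum>i\<in>I. class_sizes ! i)"
    and card_orbits_invariant_set: "card (S8_orbits E) = card I"
proof -
  have I: "i < 128" if "i \<in> I" for i using that assms(3) by simp
  have mem: "pair_of K \<in> E \<longleftrightarrow> i \<in> I" if K: "K \<in> sys_class i" and i: "i < 128" for K i
  proof -
    have "orbit (sym_group 8) act (pair_of K) = orbit (sym_group 8) act (pair_of (rep_system i))"
      using orbit_pair_of[OF i K] orbit_pair_of[OF i rep_system_in_class[OF i]] by simp
    moreover have "P \<in> E" if "P \<in> orbit (sym_group 8) act Q" "Q \<in> E" for P Q
      using that assms(2) unfolding orbit_def sym_group_carrier by blast
    moreover have "pair_of L \<in> orbit (sym_group 8) act (pair_of L)" if "L \<in> sys_class i" for L
      using orbit_pair_of[OF i that] that by blast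
    ultimately show ?thesis
      using assms(3) i K rep_system_in_class[OF i] by (metis (mono_tags, lifting) mem_Collect_eq)
  qed
  have E: "E = (\<Union>i\<in>I. pair_of ` sys_class i)"
  proof (intro equalityI subsetI)
    fix Q assume Q: "Q \<in> E"
    hence K: "system_of Q \<in> systems" "pair_of (system_of Q) = Q"
      using assms(1) system_of_in_systems pair_of_system_of by blast+
    then obtain i where "i < 128" "system_of Q \<in> sys_class i" using systems_eq_Union by blast
    thus "Q \<in> (\<Union>i\<in>I. pair_of ` sys_class i)" using mem[of "system_of Q" i] K Q by (metis UN_iff imageI)
  qed (use mem I in blast)
  have disj: "pair_of ` sys_class i \<inter> pair_of ` sys_class j = {}" if "i \<in> I" "j \<in> I" "i \<noteq> j" for i j
  proof -
    have "sys_class i \<inter> sys_class j = {}" by (rule sys_class_disjoint[OF I[OF that(1)] I[OF that(2)] that(3)])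
    moreover have "sys_class i \<subseteq> systems" "sys_class j \<subseteq> systems" by (auto simp: sys_class_def)
    ultimately show ?thesis using inj_on_image_Int[OF inj_on_pair_of] by (metis image_empty)
  qed
  have card: "card (pair_of ` sys_class i) = class_sizes ! i" if "i \<in> I" for i
  proof -
    have "sys_class i \<subseteq> systems" by (auto simp: sys_class_def)
    thus ?thesis using card_sys_class[OF I[OF that]] by (simp add: card_image inj_on_subset[OF inj_on_pair_of])
  qed
  have finI: "finite I" by (simp add: assms(3))
  have "card E = (\<Sum>i\<in>I. card (pair_of ` sys_class i))"
    unfolding E using finI disj finite_sys_class by (subst card_UN_disjoint) auto
  thus "card E = (\<Sum>i\<in>I. class_sizes ! i)" using card by simp
  have "S8_orbits E = (\<lambda>i. pair_of ` sys_class i) ` I"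
  proof (intro equalityI subsetI)
    fix X assume "X \<in> S8_orbits E"
    then obtain Q where Q: "Q \<in> E" "X = orbit (sym_group 8) act Q" unfolding orbits_def by blast
    then obtain i K where "i \<in> I" "K \<in> sys_class i" "Q = pair_of K" unfolding E by blast
    thus "X \<in> (\<lambda>i. pair_of ` sys_class i) ` I" using orbit_pair_of[OF I] Q by blast
  next
    fix X assume "X \<in> (\<lambda>i. pair_of ` sys_class i) ` I"
    then obtain i where i: "i \<in> I" "X = pair_of ` sys_class i" by blast
    hence "X = orbit (sym_group 8) act (pair_of (rep_system i))" "pair_of (rep_system i) \<in> E"
      using orbit_pair_of[OF I[OF i(1)] rep_system_in_class[OF I[OF i(1)]]] assms(3) by auto
    thus "X \<in> S8_orbits E" unfolding orbits_def by blast
  qed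
  moreover have "inj_on (\<lambda>i. pair_of ` sys_class i) I"
  proof (rule inj_onI, rule ccontr)
    fix i j assume ij: "i \<in> I" "j \<in> I" "pair_of ` sys_class i = pair_of ` sys_class j" "i \<noteq> j"
    hence "pair_of ` sys_class i = {}" using disj[OF ij(1,2,4)] by simp
    thus False using rep_system_in_class[OF I[OF ij(1)]] by blast
  qed
  ultimately show "card (S8_orbits E) = card I" by (simp add: card_image)
qed

section \<open>Brackets and collinearity\<close>

definition bracket :: "'a::field ^ 3 \<Rightarrow> 'a ^ 3 \<Rightarrow> 'a ^ 3 \<Rightarrow> 'a" where
  "bracket u v w = u $ 1 * (v $ 2 * w $ 3 - v $ 3 * w $ 2) - u $ 2 * (v $ 1 * w $ 3 - v $ 3 * w $ 1)
     + u $ 3 * (v $ 1 * w $ 2 - v $ 2 * w $ 1)"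

text \<open>For distinct points the coordinates of the joining line; it vanishes exactly for
  proportional vectors, and distinctness of points is always expressed through it.\<close>

definition cross :: "'a::field ^ 3 \<Rightarrow> 'a ^ 3 \<Rightarrow> 'a ^ 3" where
  "cross u v = vector [u $ 2 * v $ 3 - u $ 3 * v $ 2, u $ 3 * v $ 1 - u $ 1 * v $ 3, u $ 1 * v $ 2 - u $ 2 * v $ 1]"

definition dot :: "'a::field ^ 3 \<Rightarrow> 'a ^ 3 \<Rightarrow> 'a" where
  "dot u v = u $ 1 * v $ 1 + u $ 2 * v $ 2 + u $ 3 * v $ 3"

lemma vec3_eq_iff: "u = v \<longleftrightarrow> u $ 1 = v $ 1 \<and> u $ 2 = v $ 2 \<and> u $ 3 = v $ 3"
  for u v :: "'a ^ 3"
  by (simp add: vec_eq_iff forall_3)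

lemmas vec3_simps = vector_add_component vector_smult_component vector_minus_component vector_uminus_component zero_index vector_3

lemma cross_eq_0_iff:
  assumes "v \<noteq> 0"
  shows "cross u v = 0 \<longleftrightarrow> (\<exists>c. u = c *s v)"
proof
  assume "cross u v = 0"
  hence c: "u $ 2 * v $ 3 = u $ 3 * v $ 2" "u $ 3 * v $ 1 = u $ 1 * v $ 3" "u $ 1 * v $ 2 = u $ 2 * v $ 1"
    by (simp_all add: cross_def vec3_eq_iff vec3_simps)
  consider "v $ 1 \<noteq> 0" | "v $ 2 \<noteq> 0" | "v $ 3 \<noteq> 0" using assms by (auto simp: vec3_eq_iff)
  thus "\<exists>c. u = c *s v"
  proof cases
    case 1 thus ?thesis using c by (intro exI[of _ "u $ 1 / v $ 1"]) (auto simp: vec3_eq_iff vec3_simps field_simps)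
  next
    case 2 thus ?thesis using c by (intro exI[of _ "u $ 2 / v $ 2"]) (auto simp: vec3_eq_iff vec3_simps field_simps)
  next
    case 3 thus ?thesis using c by (intro exI[of _ "u $ 3 / v $ 3"]) (auto simp: vec3_eq_iff vec3_simps field_simps)
  qed
qed (auto simp: cross_def vec3_eq_iff vec3_simps)

text \<open>The triple product expansion. A vector orthogonal to u and v has zero cross product with
  \<open>cross u v\<close>, so it is a multiple of it when u and v are independent.\<close>

lemma cross_cross: "cross a (cross u v) = dot a v *s u - dot a u *s v"
  by (simp add: cross_def dot_def vec3_eq_iff vec3_simps algebra_simps)

lemma bracket_cross: "bracket u v w = dot (cross u v) w"
  by (simp add: cross_def dot_def bracket_def vec3_simps algebra_simps)

text \<open>Cramer's rule without division: the brackets on the right are the coordinates of x in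
  the frame u, v, w, up to the common factor \<open>bracket u v w\<close>.\<close>

lemma cramer: "bracket u v w *s x = bracket x v w *s u + bracket u x w *s v + bracket u v x *s w"
  by (simp add: bracket_def vec3_eq_iff vec3_simps algebra_simps)

lemma span_pair: "vec.span {u, v} = {a *s u + b *s v | a b. True}" for u v :: "'a::field ^ 3"
proof -
  have "x \<in> vec.span {u, v} \<longleftrightarrow> (\<exists>a b. x = a *s u + b *s v)" for x
  proof -
    have "x \<in> vec.span {u, v} \<longleftrightarrow> (\<exists>a b. x - a *s u - b *s v = 0)"
      by (simp add: vec.span_insert vec.span_empty)
    also have "\<dots> \<longleftrightarrow> (\<exists>a b. x = a *s u + b *s v)"
      by (metis (no_types, lifting) add.commute diff_add_cancel diff_eq_eq eq_iff_diff_eq_0)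
    finally show ?thesis .
  qed
  thus ?thesis by blast
qed

lemma span_single: "vec.span {v} = {c *s v | c. True}" for v :: "'a::field ^ 3"
  using vec.span_singleton by (auto simp: full_SetCompr_eq)

lemma cross_nonzero_independent:
  assumes "cross u v \<noteq> 0"
  shows "vec.independent {u, v}" "u \<noteq> v"
proof -
  show ne: "u \<noteq> v" using assms by (auto simp: cross_def vec3_eq_iff vec3_simps)
  have v: "v \<noteq> 0" using assms by (auto simp: cross_def vec3_eq_iff vec3_simps)
  have "u \<notin> vec.span {v}" using assms cross_eq_0_iff[OF v] by (auto simp: span_single)
  moreover have "vec.independent {v}" using v by simp
  ultimately show "vec.independent {u, v}"
    using ne by (simp add: vec.independent_insert)
qed

lemma proj_line_eq_span:
  assumes "W \<in> proj_lines" "u \<in> W" "v \<in> W" "cross u v \<noteq> 0"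
  shows "W = vec.span {u, v}"
proof -
  note ind = cross_nonzero_independent[OF assms(4)]
  have W: "vec.subspace W" "vec.dim W = 2" using assms by (auto simp: proj_lines_def)
  have "card {u, v} = 2" using ind(2) by simp
  hence "W \<subseteq> vec.span {u, v}"
    using vec.card_ge_dim_independent[of "{u, v}" W] assms ind W by auto
  moreover have "vec.span {u, v} \<subseteq> W" using W assms by (intro vec.span_minimal) auto
  ultimately show ?thesis by blast
qed

lemma span_pair_proj_line:
  assumes "cross u v \<noteq> 0"
  shows "vec.span {u, v} \<in> proj_lines"
  using cross_nonzero_independent[OF assms]
  by (auto simp: proj_lines_def vec.subspace_span vec.dim_span vec.dim_eq_card_independent)

lemma span_pair_bracket:
  assumes "cross u v \<noteq> 0"
  shows "w \<in> vec.span {u, v} \<longleftrightarrow> bracket u v w = 0"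
proof
  assume "w \<in> vec.span {u, v}"
  then obtain a b where "w = a *s u + b *s v" by (auto simp: span_pair)
  thus "bracket u v w = 0" by (simp add: bracket_def vec3_simps algebra_simps)
next
  assume br: "bracket u v w = 0"
  have *: "w \<in> vec.span {u, v}" if "cross u v $ i \<noteq> 0" for i
  proof -
    \<comment> \<open>The i-th unit vector completes u, v to a frame with bracket \<open>?c\<close>;
      in Cramer's rule for w the third coordinate is \<open>bracket u v w\<close>, which
      vanishes.\<close>
    let ?c = "cross u v $ i" and ?e = "axis i 1 :: 'a ^ 3"
    have "bracket u v ?e = ?c"
      using exhaust_3[of i] by (auto simp: bracket_def cross_def axis_def vec3_simps)
    hence "?c *s w = bracket w v ?e *s u + bracket u w ?e *s v"
      using cramer[of u v ?e w] br by simp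
    hence "w = (bracket w v ?e / ?c) *s u + (bracket u w ?e / ?c) *s v"
      using that by (auto simp: vec3_eq_iff vec3_simps field_simps)
    thus ?thesis by (auto simp: span_pair)
  qed
  obtain i where "cross u v $ i \<noteq> 0" using assms by (auto simp: vec3_eq_iff)
  thus "w \<in> vec.span {u, v}" by (rule *)
qed

section \<open>Points and collinearity in coordinates\<close>

lemma proj_pointE:
  assumes "P \<in> proj_plane"
  obtains v where "v \<noteq> 0" "P = vec.span {v}"
proof -
  have P: "vec.subspace P" "vec.dim P = 1" using assms by (auto simp: proj_plane_def)
  obtain B where B: "B \<subseteq> P" "vec.independent B" "P \<subseteq> vec.span B" "card B = vec.dim P"
    using vec.basis_exists by metis
  then obtain v where v: "B = {v}" using P by (auto simp: card_Suc_eq card_1_singleton_iff)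
  have "vec.span B \<subseteq> P" using B P by (intro vec.span_minimal) auto
  hence "P = vec.span {v}" using B v by blast
  moreover have "v \<noteq> 0" using B v by auto
  ultimately show ?thesis using that by blast
qed

lemma span_in_proj_plane: "v \<noteq> 0 \<Longrightarrow> vec.span {v} \<in> proj_plane"
  by (auto simp: proj_plane_def vec.subspace_span vec.dim_span vec.dim_eq_card_independent)

lemma span_eq_iff_cross:
  assumes "u \<noteq> 0" "v \<noteq> 0"
  shows "vec.span {u} = vec.span {v} \<longleftrightarrow> cross u v = 0"
proof
  assume "vec.span {u} = vec.span {v}"
  hence "u \<in> vec.span {v}" using vec.span_base by blast
  thus "cross u v = 0" using cross_eq_0_iff[OF assms(2)] by (auto simp: span_single)
next
  assume "cross u v = 0"
  then obtain c where c: "u = c *s v" using cross_eq_0_iff[OF assms(2)] by blast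
  hence "c \<noteq> 0" using assms by auto
  hence "u \<in> vec.span {v}" using c by (auto simp: span_single)
  hence "vec.span {u} \<subseteq> vec.span {v}"
    by (intro vec.span_minimal) (simp_all add: vec.subspace_span)
  moreover have "v = (1 / c) *s u" using c \<open>c \<noteq> 0\<close> by (simp add: vec3_eq_iff vec3_simps)
  hence "v \<in> vec.span {u}" unfolding span_single by blast
  hence "vec.span {v} \<subseteq> vec.span {u}"
    by (intro vec.span_minimal) (simp_all add: vec.subspace_span)
  ultimately show "vec.span {u} = vec.span {v}" by blast
qed

lemma span_subset_line: "W \<in> proj_lines \<Longrightarrow> vec.span {v} \<subseteq> W \<longleftrightarrow> v \<in> W"
  using vec.span_minimal[of "{v}" W] vec.span_base[of v "{v}"] by (auto simp: proj_lines_def)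

lemma collinear_points_iff:
  assumes "cross u v \<noteq> 0"
  shows "collinear_points {vec.span {u}, vec.span {v}, vec.span {w}} \<longleftrightarrow> bracket u v w = 0"
proof
  assume "collinear_points {vec.span {u}, vec.span {v}, vec.span {w}}"
  then obtain W where W: "W \<in> proj_lines" "u \<in> W" "v \<in> W" "w \<in> W"
    unfolding collinear_points_def using span_subset_line by blast
  thus "bracket u v w = 0" using proj_line_eq_span[OF W(1-3) assms] span_pair_bracket[OF assms] by blast
next
  assume "bracket u v w = 0"
  hence "w \<in> vec.span {u, v}" using span_pair_bracket[OF assms] by blast
  moreover have "u \<in> vec.span {u, v}" "v \<in> vec.span {u, v}" by (auto intro: vec.span_base)
  ultimately show "collinear_points {vec.span {u}, vec.span {v}, vec.span {w}}"
    unfolding collinear_points_def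
    by (intro bexI[OF _ span_pair_proj_line[OF assms]]) (auto simp: span_subset_line[OF span_pair_proj_line[OF assms]])
qed

section \<open>Irreducible quadratic forms\<close>

lemma eval3_add: "eval3 (F + G) v = eval3 F v + eval3 G v"
  and eval3_mult: "eval3 (F * G) v = eval3 F v * eval3 G v"
  and eval3_power: "eval3 (F ^ n) v = eval3 F v ^ n"
  and eval3_const: "eval3 (const3 a) v = a"
  and eval3_var: "eval3 var_x v = v $ 1" "eval3 var_y v = v $ 2" "eval3 var_z v = v $ 3"
  and eval3_0: "eval3 0 v = 0"
  by (simp_all add: eval3_def)

lemma poly_eq_0_on_range:
  fixes p :: "'b::idom poly" and h :: "'a::field_char_0 \<Rightarrow> 'b"
  assumes "inj h" "\<And>c. poly p (h c) = 0"
  shows "p = 0"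
proof (rule ccontr)
  assume "p \<noteq> 0"
  hence "finite {x. poly p x = 0}" by (rule poly_roots_finite)
  moreover have "range h \<subseteq> {x. poly p x = 0}" using assms(2) by auto
  ultimately have "finite (range h)" by (rule rev_finite_subset)
  thus False using finite_imageD[OF _ assms(1)] infinite_UNIV_char_0 by blast
qed

text \<open>The variables are stripped one at a time, first x, then y, then z. At each stage the
  constants embedded in the coefficient ring are infinitely many roots, because the characteristic
  is 0.\<close>

lemma eval3_eq_0:
  fixes F :: "'a::field_char_0 poly poly poly"
  assumes "\<And>v. eval3 F v = 0"
  shows "F = 0"
proof -
  have "poly (poly (poly F [:[:c:]:]) [:b:]) a = 0" for a b c
    using assms[of "vector [a, b, c]"] by (simp add: eval3_def)
  hence "poly (poly F [:[:c:]:]) [:b:] = 0" for b c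
    by (intro poly_eq_0_on_range[of "\<lambda>a. a"]) auto
  hence "poly F [:[:c:]:] = 0" for c
    by (intro poly_eq_0_on_range[of "\<lambda>b. [:b:]"]) (auto simp: inj_def)
  thus ?thesis
    by (intro poly_eq_0_on_range[of "\<lambda>c. [:[:c:]:]"]) (auto simp: inj_def)
qed

lemma eval3_eqI:
  fixes F G :: "'a::field_char_0 poly poly poly"
  assumes "\<And>v. eval3 F v = eval3 G v"
  shows "F = G"
proof -
  have "eval3 (F - G) v = 0" for v using assms[of v] by (simp add: eval3_def)
  thus ?thesis using eval3_eq_0[of "F - G"] by simp
qed

text \<open>Describes a polynomial by its values, so that a linear substitution can be made
  pointwise instead of inside the nested polynomial ring.\<close>

definition polyfun :: "('a::field ^ 3 \<Rightarrow> 'a) \<Rightarrow> bool" where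
  "polyfun f \<longleftrightarrow> (\<exists>G. \<forall>v. eval3 G v = f v)"

lemma polyfun_const: "polyfun (\<lambda>v. c)"
  and polyfun_add: "polyfun f \<Longrightarrow> polyfun g \<Longrightarrow> polyfun (\<lambda>v. f v + g v)"
  and polyfun_mult: "polyfun f \<Longrightarrow> polyfun g \<Longrightarrow> polyfun (\<lambda>v. f v * g v)"
  unfolding polyfun_def by (metis eval3_const, metis eval3_add, metis eval3_mult)

lemma polyfun_coord: "polyfun (\<lambda>v. v $ i)"
  using exhaust_3[of i] eval3_var unfolding polyfun_def by metis

lemma polyfun_compose:
  assumes "polyfun a" "polyfun b" "polyfun c"
  shows "polyfun (\<lambda>w. eval3 G (vector [a w, b w, c w]))"
proof -
  have 1: "polyfun (\<lambda>w. poly p (a w))" for p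
    by (induction p) (auto intro!: polyfun_const polyfun_add polyfun_mult assms)
  have 2: "polyfun (\<lambda>w. poly (poly p [:b w:]) (a w))" for p
    by (induction p) (auto intro!: polyfun_const polyfun_add polyfun_mult assms 1)
  have 3: "polyfun (\<lambda>w. poly (poly (poly p [:[:c w:]:]) [:b w:]) (a w))" for p
    by (induction p) (auto intro!: polyfun_const polyfun_add polyfun_mult assms 2)
  show ?thesis using 3[of G] by (simp add: eval3_def)
qed

section \<open>Irreducibility of a conic in normal form\<close>

lemma unit_is_const3:
  fixes F :: "'a::field poly poly poly"
  assumes "F dvd 1"
  obtains c where "c \<noteq> 0" "F = const3 c"
proof -
  obtain F1 where F: "F = [:F1:]" "F1 dvd 1" using assms is_unit_poly_iff by blast
  then obtain F2 where F1: "F1 = [:F2:]" "F2 dvd 1" using is_unit_poly_iff by blast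
  then obtain c where "F2 = [:c:]" "c dvd 1" using is_unit_poly_iff by blast
  thus ?thesis using that[of c] F F1 by (simp add: dvd_field_iff)
qed

lemma const3_unit: "c \<noteq> 0 \<Longrightarrow> const3 (c::'a::field) dvd 1"
  by (simp add: is_unit_poly_iff dvd_field_iff)

text \<open>The quadratic form d xy + (e x + f y) z, zero at the three coordinate points, written as
  a polynomial of degree 1 in z.\<close>

definition normal_conic :: "'a::field \<Rightarrow> 'a \<Rightarrow> 'a \<Rightarrow> 'a poly poly poly" where
  "normal_conic d e f = [:[:0, [:0, d:]:], [:[:0, e:], [:f:]:]:]"

lemma eval3_normal_conic:
  "eval3 (normal_conic d e f) v = d * v $ 1 * v $ 2 + e * v $ 1 * v $ 3 + f * v $ 2 * v $ 3"
  by (simp add: normal_conic_def eval3_def algebra_simps)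

text \<open>The degree in z is 1, so one factor is free of z and divides both coefficients d xy and
  e x + f y. It then divides the combination f (d xy) - d x (e x + f y) = -d e x^2, so it is free of
  y as well, and therefore divides f, the coefficient of y in e x + f y. Hence it is a unit.\<close>

lemma irreducible_normal_conic:
  fixes d e f :: "'a::field"
  assumes "d \<noteq> 0" "e \<noteq> 0" "f \<noteq> 0"
  shows "irreducible (normal_conic d e f)"
proof (rule irreducibleI)
  let ?N = "normal_conic d e f"
  show N0: "?N \<noteq> 0" using assms by (simp add: normal_conic_def)
  show "\<not> ?N dvd 1"
  proof
    assume "?N dvd 1"
    then obtain c where "c \<noteq> 0" "?N = const3 c" by (rule unit_is_const3)
    thus False using assms by (simp add: normal_conic_def)
  qed
  have unit: "H dvd 1" if H: "?N = G * H" "degree H = 0" for G H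
  proof -
    obtain h where h: "H = [:h:]" using H(2) degree_eq_zeroE by blast
    let ?A = "[:0, [:0, d:]:]" and ?B = "[:[:0, e:], [:f:]:]"
    have coeffs: "coeff ?N 0 = ?A" "coeff ?N 1 = ?B" by (simp_all add: normal_conic_def)
    have "coeff ?N n = h * coeff G n" for n using H(1) h by simp
    hence dvd: "h dvd ?A" "h dvd ?B" unfolding coeffs[symmetric] by auto
    have "h dvd [:[:f:]:] * ?A - [:[:0, d:]:] * ?B" using dvd by (intro dvd_diff dvd_mult)
    also have "[:[:f:]:] * ?A - [:[:0, d:]:] * ?B = [:[:0, 0, - (d * e):]:]" by simp
    finally have "degree h \<le> degree [:[:0, 0, - (d * e):]:]"
      using assms by (intro dvd_imp_degree_le) auto
    then obtain k where k: "h = [:k:]" using degree_eq_zeroE by (metis degree_pCons_0 le_zero_eq)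
    have "k dvd coeff ?B 1" using dvd(2) unfolding k const_poly_dvd_iff by blast
    hence "k dvd [:f:]" by simp
    moreover have "[:f:] dvd 1" using assms by (simp add: is_unit_poly_iff dvd_field_iff)
    ultimately have "k dvd 1" by (rule dvd_trans)
    thus ?thesis by (simp add: h k is_unit_poly_iff)
  qed
  fix G H assume GH: "?N = G * H"
  have "degree G + degree H = degree ?N"
    unfolding GH using N0 GH by (intro degree_mult_eq[symmetric]) auto
  moreover have "degree ?N = 1" using assms by (simp add: normal_conic_def)
  ultimately have "degree G = 0 \<or> degree H = 0" by linarith
  thus "G dvd 1 \<or> H dvd 1" using unit[of G H] unit[of H G] GH by (auto simp: mult.commute)
qed

section \<open>Quadratic functions and their factors\<close>

definition quadratic :: "('a::field ^ 3 \<Rightarrow> 'a) \<Rightarrow> bool" where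
  "quadratic q \<longleftrightarrow> (\<exists>a b c d e f. \<forall>v. q v = a * (v $ 1)\<^sup>2 + b * (v $ 2)\<^sup>2 + c * (v $ 3)\<^sup>2
     + d * (v $ 1 * v $ 2) + e * (v $ 1 * v $ 3) + f * (v $ 2 * v $ 3))"

lemma quadraticI:
  assumes "\<And>v. q v = a * (v $ 1)\<^sup>2 + b * (v $ 2)\<^sup>2 + c * (v $ 3)\<^sup>2
     + d * (v $ 1 * v $ 2) + e * (v $ 1 * v $ 3) + f * (v $ 2 * v $ 3)"
  shows "quadratic q"
  unfolding quadratic_def using assms by blast

lemma quadratic_eval3: "ternary_quadratic_form F \<Longrightarrow> quadratic (eval3 F)"
  unfolding ternary_quadratic_form_def quadratic_def
proof (elim exE)
  fix a b c d e f
  assume F: "F = const3 a * var_x ^ 2 + const3 b * var_y ^ 2 + const3 c * var_z ^ 2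
       + const3 d * (var_x * var_y) + const3 e * (var_x * var_z) + const3 f * (var_y * var_z)"
  have "eval3 F v = a * (v $ 1)\<^sup>2 + b * (v $ 2)\<^sup>2 + c * (v $ 3)\<^sup>2
     + d * (v $ 1 * v $ 2) + e * (v $ 1 * v $ 3) + f * (v $ 2 * v $ 3)" for v
    unfolding F eval3_add eval3_mult eval3_power eval3_const eval3_var ..
  thus "\<exists>a b c d e f. \<forall>v. eval3 F v = a * (v $ 1)\<^sup>2 + b * (v $ 2)\<^sup>2 + c * (v $ 3)\<^sup>2
     + d * (v $ 1 * v $ 2) + e * (v $ 1 * v $ 3) + f * (v $ 2 * v $ 3)" by blast
qed

lemma quadratic_form_exists:
  assumes "quadratic q"
  obtains F where "ternary_quadratic_form F" "\<And>v. eval3 F v = q v"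
proof -
  obtain a b c d e f where q: "\<And>v. q v = a * (v $ 1)\<^sup>2 + b * (v $ 2)\<^sup>2 + c * (v $ 3)\<^sup>2
     + d * (v $ 1 * v $ 2) + e * (v $ 1 * v $ 3) + f * (v $ 2 * v $ 3)"
    using assms unfolding quadratic_def by blast
  let ?F = "const3 a * var_x ^ 2 + const3 b * var_y ^ 2 + const3 c * var_z ^ 2
       + const3 d * (var_x * var_y) + const3 e * (var_x * var_z) + const3 f * (var_y * var_z)"
  have "ternary_quadratic_form ?F" unfolding ternary_quadratic_form_def by blast
  moreover have "eval3 ?F v = q v" for v
    unfolding q eval3_add eval3_mult eval3_power eval3_const eval3_var ..
  ultimately show ?thesis using that by blast
qed

lemma quadratic_dot_mult: "quadratic (\<lambda>v. dot l v * dot m v)"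
  by (rule quadraticI[of _ "l $ 1 * m $ 1" "l $ 2 * m $ 2" "l $ 3 * m $ 3"
        "l $ 1 * m $ 2 + l $ 2 * m $ 1" "l $ 1 * m $ 3 + l $ 3 * m $ 1" "l $ 2 * m $ 3 + l $ 3 * m $ 2"])
     (simp add: dot_def power2_eq_square algebra_simps)

lemma quadratic_add:
  assumes "quadratic p" "quadratic q"
  shows "quadratic (\<lambda>v. p v + q v)"
proof -
  obtain a b c d e f where p: "\<And>v. p v = a * (v $ 1)\<^sup>2 + b * (v $ 2)\<^sup>2 + c * (v $ 3)\<^sup>2
     + d * (v $ 1 * v $ 2) + e * (v $ 1 * v $ 3) + f * (v $ 2 * v $ 3)"
    using assms(1) unfolding quadratic_def by blast
  obtain a' b' c' d' e' f' where q: "\<And>v. q v = a' * (v $ 1)\<^sup>2 + b' * (v $ 2)\<^sup>2 + c' * (v $ 3)\<^sup>2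
     + d' * (v $ 1 * v $ 2) + e' * (v $ 1 * v $ 3) + f' * (v $ 2 * v $ 3)"
    using assms(2) unfolding quadratic_def by blast
  show ?thesis
    by (rule quadraticI[of _ "a + a'" "b + b'" "c + c'" "d + d'" "e + e'" "f + f'"])
      (simp add: p q algebra_simps)
qed

text \<open>Turns irreducibility into a statement about values: linear forms, the zero form
  included, vanish at the origin and so are not units, and a factorization of values is one of
  polynomials by \<open>eval3_eqI\<close>.\<close>

lemma conic_form_not_product:
  fixes F :: "'a::field_char_0 poly poly poly"
  assumes "conic_form F"
  shows "\<exists>v. eval3 F v \<noteq> dot l v * dot m v"
proof (rule ccontr)
  assume "\<not> ?thesis"
  hence eq: "\<And>v. eval3 F v = dot l v * dot m v" by blast
  define lin where "lin l = const3 (l $ 1) * var_x + const3 (l $ 2) * var_y + const3 (l $ 3) * var_z" for l :: "'a ^ 3"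
  have lin: "eval3 (lin l) v = dot l v" for l v
    unfolding lin_def eval3_add eval3_mult eval3_const eval3_var dot_def ..
  have "F = lin l * lin m" by (rule eval3_eqI) (simp only: eq eval3_mult lin)
  hence "lin l dvd 1 \<or> lin m dvd 1"
    using assms irreducibleD by (auto simp: conic_form_def)
  moreover have "\<not> lin l dvd 1" for l
  proof
    assume "lin l dvd 1"
    then obtain c where "c \<noteq> 0" "lin l = const3 c" by (rule unit_is_const3)
    thus False using lin[of l 0] eval3_const[of c 0] by (simp add: dot_def)
  qed
  ultimately show False by blast
qed

text \<open>B is the polar form. Three vectors are expanded at once to serve a frame; on a line the
  third coefficient is set to 0 and the third vector is arbitrary.\<close>

lemma quadratic_polarize:
  assumes "quadratic q"
  obtains B where "\<And>x y z u v w. q (x *s u + y *s v + z *s w) =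
     x\<^sup>2 * q u + y\<^sup>2 * q v + z\<^sup>2 * q w + x * y * B u v + x * z * B u w + y * z * B v w"
proof -
  obtain a b c d e f where q: "\<And>v. q v = a * (v $ 1)\<^sup>2 + b * (v $ 2)\<^sup>2 + c * (v $ 3)\<^sup>2
     + d * (v $ 1 * v $ 2) + e * (v $ 1 * v $ 3) + f * (v $ 2 * v $ 3)"
    using assms unfolding quadratic_def by blast
  define B where "B u v = 2 * a * u $ 1 * v $ 1 + 2 * b * u $ 2 * v $ 2 + 2 * c * u $ 3 * v $ 3
    + d * (u $ 1 * v $ 2 + u $ 2 * v $ 1) + e * (u $ 1 * v $ 3 + u $ 3 * v $ 1) + f * (u $ 2 * v $ 3 + u $ 3 * v $ 2)" for u v :: "'a ^ 3"
  have "q (x *s u + y *s v + z *s w) =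
     x\<^sup>2 * q u + y\<^sup>2 * q v + z\<^sup>2 * q w + x * y * B u v + x * z * B u w + y * z * B v w" for x y z u v w
    unfolding q B_def vec3_simps power2_eq_square by algebra
  thus ?thesis using that by blast
qed

text \<open>With l the cross product, every \<open>cross k l\<close> is a zero of q. Letting k run
  over the unit vectors and their pairwise sums yields six relations between the coefficients of q
  and of l, enough to solve for m where a coordinate of l is nonzero.\<close>

lemma quadratic_zero_on_line_factors:
  assumes "quadratic q" "cross u v \<noteq> 0" "\<And>x y. q (x *s u + y *s v) = 0"
  shows "\<exists>m. \<forall>w. q w = dot (cross u v) w * dot m w"
proof -
  obtain a b c d e f where q: "\<And>v. q v = a * (v $ 1)\<^sup>2 + b * (v $ 2)\<^sup>2 + c * (v $ 3)\<^sup>2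
     + d * (v $ 1 * v $ 2) + e * (v $ 1 * v $ 3) + f * (v $ 2 * v $ 3)"
    using assms(1) unfolding quadratic_def by blast
  define l where "l = cross u v"
  \<comment> \<open>By the triple product expansion \<open>cross k l\<close> is a combination of u
    and v.\<close>
  have q0: "q (cross k l) = 0" for k
    using assms(3)[of "dot k v" "- dot k u"] by (simp add: l_def cross_cross)
  let ?e1 = "vector [1, 0, 0] :: 'a ^ 3" and ?e2 = "vector [0, 1, 0] :: 'a ^ 3" and ?e3 = "vector [0, 0, 1] :: 'a ^ 3"
  have s: "b * (l $ 3)\<^sup>2 + c * (l $ 2)\<^sup>2 = f * (l $ 2 * l $ 3)"
    "a * (l $ 3)\<^sup>2 + c * (l $ 1)\<^sup>2 = e * (l $ 1 * l $ 3)"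
    "a * (l $ 2)\<^sup>2 + b * (l $ 1)\<^sup>2 = d * (l $ 1 * l $ 2)"
    using q0[of ?e1] q0[of ?e2] q0[of ?e3] by (simp_all add: q cross_def vec3_simps power2_eq_square algebra_simps)
  have t: "2 * c * (l $ 1 * l $ 2) + d * (l $ 3)\<^sup>2 = e * (l $ 2 * l $ 3) + f * (l $ 1 * l $ 3)"
    "2 * b * (l $ 1 * l $ 3) + e * (l $ 2)\<^sup>2 = d * (l $ 2 * l $ 3) + f * (l $ 1 * l $ 2)"
    "2 * a * (l $ 2 * l $ 3) + f * (l $ 1)\<^sup>2 = d * (l $ 1 * l $ 3) + e * (l $ 1 * l $ 2)"
    using q0[of "?e1 + ?e2"] q0[of "?e1 + ?e3"] q0[of "?e2 + ?e3"] s
    by (simp_all add: q cross_def vec3_simps, algebra+)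
  have l: "l $ 1 \<noteq> 0 \<or> l $ 2 \<noteq> 0 \<or> l $ 3 \<noteq> 0" using assms(2) by (auto simp: l_def vec3_eq_iff)
  \<comment> \<open>The vector m is found by comparing the coefficients of z^2, xz and yz in the
    product, which needs division by \<open>l $ 3\<close> only; the relations \<open>s\<close> and
    \<open>t\<close> settle the other three coefficients. The remaining cases are analogous.\<close>
  have 3: "\<forall>w. q w = dot l w * dot (vector [(e - c * l $ 1 / l $ 3) / l $ 3, (f - c * l $ 2 / l $ 3) / l $ 3, c / l $ 3]) w"
    if "l $ 3 \<noteq> 0"
  proof
    fix w
    have "(l $ 3)\<^sup>2 * q w = (l $ 3)\<^sup>2 * (dot l w * dot (vector [(e - c * l $ 1 / l $ 3) / l $ 3, (f - c * l $ 2 / l $ 3) / l $ 3, c / l $ 3]) w)"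
      using that s t unfolding q dot_def vec3_simps by (simp add: field_simps) algebra
    thus "q w = dot l w * dot (vector [(e - c * l $ 1 / l $ 3) / l $ 3, (f - c * l $ 2 / l $ 3) / l $ 3, c / l $ 3]) w"
      using that by simp
  qed
  have 2: "\<forall>w. q w = dot l w * dot (vector [(d - b * l $ 1 / l $ 2) / l $ 2, b / l $ 2, (f - b * l $ 3 / l $ 2) / l $ 2]) w"
    if "l $ 2 \<noteq> 0"
  proof
    fix w
    have "(l $ 2)\<^sup>2 * q w = (l $ 2)\<^sup>2 * (dot l w * dot (vector [(d - b * l $ 1 / l $ 2) / l $ 2, b / l $ 2, (f - b * l $ 3 / l $ 2) / l $ 2]) w)"
      using that s t unfolding q dot_def vec3_simps by (simp add: field_simps) algebra
    thus "q w = dot l w * dot (vector [(d - b * l $ 1 / l $ 2) / l $ 2, b / l $ 2, (f - b * l $ 3 / l $ 2) / l $ 2]) w"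
      using that by simp
  qed
  have 1: "\<forall>w. q w = dot l w * dot (vector [a / l $ 1, (d - a * l $ 2 / l $ 1) / l $ 1, (e - a * l $ 3 / l $ 1) / l $ 1]) w"
    if "l $ 1 \<noteq> 0"
  proof
    fix w
    have "(l $ 1)\<^sup>2 * q w = (l $ 1)\<^sup>2 * (dot l w * dot (vector [a / l $ 1, (d - a * l $ 2 / l $ 1) / l $ 1, (e - a * l $ 3 / l $ 1) / l $ 1]) w)"
      using that s t unfolding q dot_def vec3_simps by (simp add: field_simps) algebra
    thus "q w = dot l w * dot (vector [a / l $ 1, (d - a * l $ 2 / l $ 1) / l $ 1, (e - a * l $ 3 / l $ 1) / l $ 1]) w"
      using that by simp
  qed
  show ?thesis using 1 2 3 l unfolding l_def[symmetric] by blast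
qed

text \<open>On the line through the zeros u and v the form is a multiple of xy. A third zero there,
  distinct from both, makes this multiple 0; the form then vanishes on the whole line and splits off
  a linear factor.\<close>

lemma conic_no_three_collinear:
  fixes F :: "'a::field_char_0 poly poly poly"
  assumes F: "conic_form F" and zero: "eval3 F u = 0" "eval3 F v = 0" "eval3 F w = 0"
    and cr: "cross u v \<noteq> 0" "cross u w \<noteq> 0" "cross v w \<noteq> 0"
  shows "bracket u v w \<noteq> 0"
proof
  assume "bracket u v w = 0"
  hence "w \<in> vec.span {u, v}" using span_pair_bracket[OF cr(1)] by blast
  then obtain x y where w: "w = x *s u + y *s v" by (auto simp: span_pair)
  have xy: "x \<noteq> 0" "y \<noteq> 0" using cr(2,3) by (auto simp: w cross_def vec3_eq_iff vec3_simps)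
  have quad: "quadratic (eval3 F)" using F by (simp add: conic_form_def quadratic_eval3)
  obtain B where B: "\<And>x y z u v w. eval3 F (x *s u + y *s v + z *s w) =
     x\<^sup>2 * eval3 F u + y\<^sup>2 * eval3 F v + z\<^sup>2 * eval3 F w + x * y * B u v + x * z * B u w + y * z * B v w"
    using quadratic_polarize[OF quad] by blast
  have pol: "eval3 F (x *s u + y *s v) = x * y * B u v" for x y
    using B[of x u y v 0 v] zero by simp
  have "B u v = 0" using pol[of x y] zero(3) xy by (simp add: w)
  hence "eval3 F (x *s u + y *s v) = 0" for x y using pol by simp
  from quadratic_zero_on_line_factors[OF quad cr(1) this]
  show False using conic_form_not_product[OF F] by blast
qed

text \<open>In the frame u, v, w the coefficients of the squares are the values at the three
  vertices and vanish. What remains are multiples of the mixed monomials, not all zero because F is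
  not.\<close>

lemma conic_form_frame:
  fixes F :: "'a::field_char_0 poly poly poly"
  assumes F: "conic_form F" and zero: "eval3 F u = 0" "eval3 F v = 0" "eval3 F w = 0"
    and D: "bracket u v w \<noteq> 0"
  obtains d e f where "\<not> (d = 0 \<and> e = 0 \<and> f = 0)"
    "\<And>x. (bracket u v w)\<^sup>2 * eval3 F x = d * (bracket x v w * bracket u x w)
       + e * (bracket x v w * bracket u v x) + f * (bracket u x w * bracket u v x)"
proof -
  have quad: "quadratic (eval3 F)" using F by (simp add: conic_form_def quadratic_eval3)
  obtain B where B: "\<And>x y z u v w. eval3 F (x *s u + y *s v + z *s w) =
     x\<^sup>2 * eval3 F u + y\<^sup>2 * eval3 F v + z\<^sup>2 * eval3 F w + x * y * B u v + x * z * B u w + y * z * B v w"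
    using quadratic_polarize[OF quad] by blast
  have *: "(bracket u v w)\<^sup>2 * eval3 F x = B u v * (bracket x v w * bracket u x w)
       + B u w * (bracket x v w * bracket u v x) + B v w * (bracket u x w * bracket u v x)" for x
  proof -
    have "(bracket u v w)\<^sup>2 * eval3 F x = eval3 F (bracket u v w *s x)"
      using B[of "bracket u v w" x 0 x 0 x] by simp
    also have "bracket u v w *s x = bracket x v w *s u + bracket u x w *s v + bracket u v x *s w"
      by (rule cramer)
    also have "eval3 F \<dots> = B u v * (bracket x v w * bracket u x w)
       + B u w * (bracket x v w * bracket u v x) + B v w * (bracket u x w * bracket u v x)"
      using B[of "bracket x v w" u "bracket u x w" v "bracket u v x" w] zero by (simp add: mult_ac)
    finally show ?thesis .
  qed
  moreover have "\<not> (B u v = 0 \<and> B u w = 0 \<and> B v w = 0)"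
  proof
    assume "B u v = 0 \<and> B u w = 0 \<and> B v w = 0"
    hence "eval3 F x = 0" for x using *[of x] D by simp
    hence "F = 0" by (rule eval3_eq_0)
    thus False using F by (simp add: conic_form_def)
  qed
  ultimately show ?thesis using that by blast
qed

text \<open>The linear map T sends the coordinate points to u, v, w and pulls the form back to a
  normal conic, which is irreducible. A factorization of F pulls back too, and as T is onto, a
  factor that becomes a unit was one before.\<close>

lemma conic_form_exists:
  fixes u v w :: "'a::field_char_0 ^ 3"
  assumes D: "bracket u v w \<noteq> 0" and def: "d \<noteq> 0" "e \<noteq> 0" "f \<noteq> 0"
  obtains F where "conic_form F"
    "\<And>x. eval3 F x = d * (bracket x v w * bracket u x w)
       + e * (bracket x v w * bracket u v x) + f * (bracket u x w * bracket u v x)"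
proof -
  let ?q = "\<lambda>x. d * (bracket x v w * bracket u x w)
       + e * (bracket x v w * bracket u v x) + f * (bracket u x w * bracket u v x)"
  have dots: "bracket x v w = dot (cross v w) x" "bracket u x w = dot (cross w u) x" "bracket u v x = dot (cross u v) x"
    "dot (c *s l) x = c * dot l x" for x c l
    by (simp_all add: bracket_def dot_def cross_def vec3_simps algebra_simps)
  have "quadratic ?q"
    using quadratic_add[OF quadratic_add[OF quadratic_dot_mult[of "d *s cross v w" "cross w u"]
        quadratic_dot_mult[of "e *s cross v w" "cross u v"]] quadratic_dot_mult[of "f *s cross w u" "cross u v"]]
    by (simp only: dots mult.assoc)
  then obtain F where F: "ternary_quadratic_form F" "\<And>x. eval3 F x = ?q x"
    using quadratic_form_exists by blast
  define D where "D = bracket u v w"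
  define T where "T x = x $ 1 *s u + x $ 2 *s v + x $ 3 *s w" for x :: "'a ^ 3"
  have T: "bracket (T x) v w = D * x $ 1" "bracket u (T x) w = D * x $ 2" "bracket u v (T x) = D * x $ 3" for x
    unfolding T_def D_def bracket_def vec3_simps by algebra+
  have surj: "\<exists>x. T x = y" for y
    using cramer[of u v w y] D
    by (intro exI[of _ "vector [bracket y v w / D, bracket u y w / D, bracket u v y / D]"])
      (auto simp: T_def D_def vec3_eq_iff vec3_simps field_simps)
  let ?N = "normal_conic (D\<^sup>2 * d) (D\<^sup>2 * e) (D\<^sup>2 * f)"
  have N: "irreducible ?N" using D def by (intro irreducible_normal_conic) (auto simp: D_def)
  have FT: "eval3 F (T x) = eval3 ?N x" for x
    unfolding F(2) T eval3_normal_conic by (simp add: power2_eq_square algebra_simps)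
  have pull: "\<exists>G'. \<forall>x. eval3 G' x = eval3 G (T x)" for G
  proof -
    have "polyfun (\<lambda>x. eval3 G (vector [T x $ 1, T x $ 2, T x $ 3]))"
      unfolding T_def vec3_simps
      by (intro polyfun_compose polyfun_add polyfun_mult polyfun_coord polyfun_const)
    moreover have "vector [T x $ 1, T x $ 2, T x $ 3] = T x" for x by (simp add: vec3_eq_iff)
    ultimately show ?thesis by (simp add: polyfun_def)
  qed
  have unit: "G dvd 1" if G': "\<forall>x. eval3 G' x = eval3 G (T x)" "G' dvd 1" for G G'
  proof -
    obtain c where c: "c \<noteq> 0" "G' = const3 c" using unit_is_const3[OF G'(2)] by blast
    have "eval3 G y = eval3 (const3 c) y" for y
      using surj[of y] G'(1) c eval3_const by metis
    hence "G = const3 c" by (rule eval3_eqI)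
    thus ?thesis using const3_unit[OF c(1)] by simp
  qed
  have "irreducible F"
  proof (rule irreducibleI)
    show "F \<noteq> 0"
    proof
      assume "F = 0"
      hence "eval3 ?N x = 0" for x using FT[of x] by (simp add: eval3_0)
      hence "?N = 0" by (rule eval3_eq_0)
      thus False using N by simp
    qed
    show "\<not> F dvd 1"
    proof
      assume "F dvd 1"
      then obtain c where "c \<noteq> 0" "F = const3 c" by (rule unit_is_const3)
      thus False using F(2)[of 0] eval3_const[of c 0] by (simp add: bracket_def)
    qed
    fix G H assume GH: "F = G * H"
    obtain G' H' where G': "\<forall>x. eval3 G' x = eval3 G (T x)" and H': "\<forall>x. eval3 H' x = eval3 H (T x)"
      using pull by blast
    have "?N = G' * H'"
      by (rule eval3_eqI) (simp add: FT[symmetric] GH eval3_mult G' H')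
    hence "G' dvd 1 \<or> H' dvd 1" using N irreducibleD by blast
    thus "G dvd 1 \<or> H dvd 1" using unit G' H' by blast
  qed
  thus ?thesis using that F by (auto simp: conic_form_def)
qed

section \<open>Conics through six points\<close>

lemma bracket_combination:
  "bracket (x *s a + y *s b + z *s c) (x' *s a + y' *s b + z' *s c) (x'' *s a + y'' *s b + z'' *s c) =
    (x * (y' * z'' - z' * y'') - y * (x' * z'' - z' * x'') + z * (x' * y'' - y' * x'')) * bracket a b c"
  unfolding bracket_def vec3_simps by algebra

lemma bracket_smult: "bracket (k *s u) v w = k * bracket u v w" "bracket u (k *s v) w = k * bracket u v w"
  "bracket u v (k *s w) = k * bracket u v w"
  by (simp_all add: bracket_def vec3_simps algebra_simps)

lemma bracket_cyclic: "bracket v w u = bracket u v w"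
  by (simp add: bracket_def algebra_simps)

text \<open>The values at x of the three monomials XY, XZ, YZ in the coordinates of the frame a, b, c;
  the conics through a, b, c are the linear conditions on this vector.\<close>

definition frame_monomials :: "'a::field ^ 3 \<Rightarrow> 'a ^ 3 \<Rightarrow> 'a ^ 3 \<Rightarrow> 'a ^ 3 \<Rightarrow> 'a ^ 3" where
  "frame_monomials a b c x = vector [bracket x b c * bracket a x c, bracket x b c * bracket a b x, bracket a x c * bracket a b x]"

text \<open>The classical bracket condition for six points on a conic. Its vanishing equates the
  cross ratio of b, c, d, e seen from a with the one seen from f.\<close>

definition conic_det :: "'a::field ^ 3 \<Rightarrow> 'a ^ 3 \<Rightarrow> 'a ^ 3 \<Rightarrow> 'a ^ 3 \<Rightarrow> 'a ^ 3 \<Rightarrow> 'a ^ 3 \<Rightarrow> 'a" where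
  "conic_det a b c d e f = bracket a b c * bracket a d e * bracket b d f * bracket c e f
     - bracket a b d * bracket a c e * bracket b c f * bracket d e f"

text \<open>The first three are three-term Grassmann-Pluecker relations, the last expands a
  determinant of frame coordinates. They reduce every bracket to the coordinates of its points in
  the frame a, b, c, both for the conic condition and for the exceptional classes.\<close>

lemma
  fixes a b c d e f :: "'a::field ^ 3"
  assumes D: "bracket a b c \<noteq> 0"
  shows bracket_frame1: "bracket a b c * bracket a d e = bracket a d c * bracket a b e - bracket a b d * bracket a e c"
    and bracket_frame2: "bracket a b c * bracket b d e = bracket a b d * bracket e b c - bracket d b c * bracket a b e"
    and bracket_frame3: "bracket a b c * bracket c d e = bracket d b c * bracket a e c - bracket a d c * bracket e b c"
    and bracket_frame0: "(bracket a b c)\<^sup>2 * bracket d e f =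
      bracket d b c * (bracket a e c * bracket a b f - bracket a b e * bracket a f c)
      - bracket a d c * (bracket e b c * bracket a b f - bracket a b e * bracket f b c)
      + bracket a b d * (bracket e b c * bracket a f c - bracket a e c * bracket f b c)"
proof -
  let ?D = "bracket a b c"
  have un: "1 *s a + 0 *s b + 0 *s c = a" "0 *s a + 1 *s b + 0 *s c = b" "0 *s a + 0 *s b + 1 *s c = c"
    by (simp_all add: vec3_eq_iff vec3_simps)
  note cr = cramer[of a b c]
  have "?D * (?D * bracket a d e) = bracket a (?D *s d) (?D *s e)" by (simp add: bracket_smult)
  also have "\<dots> = (bracket a d c * bracket a b e - bracket a b d * bracket a e c) * ?D"
    unfolding cr using bracket_combination[of 1 a 0 b 0 c] unfolding un by simp
  finally show "?D * bracket a d e = bracket a d c * bracket a b e - bracket a b d * bracket a e c"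
    using D by simp
  have "?D * (?D * bracket b d e) = bracket b (?D *s d) (?D *s e)" by (simp add: bracket_smult)
  also have "\<dots> = (bracket a b d * bracket e b c - bracket d b c * bracket a b e) * ?D"
    unfolding cr using bracket_combination[of 0 a 1 b 0 c] unfolding un by simp
  finally show "?D * bracket b d e = bracket a b d * bracket e b c - bracket d b c * bracket a b e"
    using D by simp
  have "?D * (?D * bracket c d e) = bracket c (?D *s d) (?D *s e)" by (simp add: bracket_smult)
  also have "\<dots> = (bracket d b c * bracket a e c - bracket a d c * bracket e b c) * ?D"
    unfolding cr using bracket_combination[of 0 a 0 b 1 c] unfolding un by simp
  finally show "?D * bracket c d e = bracket d b c * bracket a e c - bracket a d c * bracket e b c"
    using D by simp
  have "?D * (?D\<^sup>2 * bracket d e f) = bracket (?D *s d) (?D *s e) (?D *s f)" by (simp add: bracket_smult power2_eq_square)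
  also have "\<dots> = (bracket d b c * (bracket a e c * bracket a b f - bracket a b e * bracket a f c)
      - bracket a d c * (bracket e b c * bracket a b f - bracket a b e * bracket f b c)
      + bracket a b d * (bracket e b c * bracket a f c - bracket a e c * bracket f b c)) * ?D"
    unfolding cr by (rule bracket_combination)
  finally show "?D\<^sup>2 * bracket d e f =
      bracket d b c * (bracket a e c * bracket a b f - bracket a b e * bracket a f c)
      - bracket a d c * (bracket e b c * bracket a b f - bracket a b e * bracket f b c)
      + bracket a b d * (bracket e b c * bracket a f c - bracket a e c * bracket f b c)"
    using D by simp
qed

text \<open>A quadric through the vertices of the frame is a linear form on the vectors of
  monomials, so three further points are tested by the determinant of their vectors.
  \<open>conic_det\<close> is this determinant up to sign and a power of
  \<open>bracket a b c\<close>.\<close>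

lemma conic_det_frame:
  assumes D: "bracket a b c \<noteq> 0"
  shows "(bracket a b c)\<^sup>2 * conic_det a b c d e f =
    - dot (cross (frame_monomials a b c d) (frame_monomials a b c e)) (frame_monomials a b c f)"
proof -
  have s: "bracket a c e = - bracket a e c" "bracket b c f = bracket f b c"
    by (simp_all add: bracket_def algebra_simps)
  have key: "(y * z' - z * y') * (z * x'' - x * z'') * (x' * y'' - y' * x'')
      - z * (- y') * x'' * (x * (y' * z'' - z' * y'') - y * (x' * z'' - z' * x'') + z * (x' * y'' - y' * x''))
    = - dot (cross (vector [x * y, x * z, y * z]) (vector [x' * y', x' * z', y' * z'])) (vector [x'' * y'', x'' * z'', y'' * z''])"
    for x y z x' y' z' x'' y'' z'' :: 'a
    unfolding dot_def cross_def vec3_simps by algebra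
  \<comment> \<open>The third power of \<open>bracket a b c\<close> supplies every bracket outside
    the frame with the factor it needs in \<open>bracket_frame0\<close> to
    \<open>bracket_frame3\<close>.\<close>
  have "bracket a b c * ((bracket a b c)\<^sup>2 * conic_det a b c d e f) = bracket a b c * (
     (bracket a b c * bracket a d e) * (bracket a b c * bracket b d f) * (bracket a b c * bracket c e f)
     - bracket a b d * bracket a c e * bracket b c f * ((bracket a b c)\<^sup>2 * bracket d e f))"
    unfolding conic_det_def by algebra
  also have "\<dots> = bracket a b c * - dot (cross (frame_monomials a b c d) (frame_monomials a b c e)) (frame_monomials a b c f)"
    unfolding bracket_frame1[OF D] bracket_frame2[OF D] bracket_frame3[OF D] bracket_frame0[OF D] s frame_monomials_def key ..
  finally show ?thesis using D mult_left_cancel by blast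
qed

section \<open>Conics through five points in general position\<close>

definition general5 :: "'a::field ^ 3 \<Rightarrow> 'a ^ 3 \<Rightarrow> 'a ^ 3 \<Rightarrow> 'a ^ 3 \<Rightarrow> 'a ^ 3 \<Rightarrow> bool" where
  "general5 a b c d e \<longleftrightarrow> bracket a b c \<noteq> 0 \<and> bracket a b d \<noteq> 0 \<and> bracket a b e \<noteq> 0 \<and> bracket a c d \<noteq> 0 \<and>
     bracket a c e \<noteq> 0 \<and> bracket a d e \<noteq> 0 \<and> bracket b c d \<noteq> 0 \<and> bracket b c e \<noteq> 0 \<and> bracket b d e \<noteq> 0 \<and> bracket c d e \<noteq> 0"

text \<open>The vector n holds the coefficients, in the frame a, b, c, of the conic through the five
  points. Each of its coordinates is a product of brackets, none zero in general position;
  \<open>conic_form_exists\<close> then makes the conic irreducible.\<close>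

lemma pencil_vector_nonzero:
  assumes "general5 a b c d e"
  defines "n \<equiv> cross (frame_monomials a b c d) (frame_monomials a b c e)"
  shows "n $ 1 \<noteq> 0" "n $ 2 \<noteq> 0" "n $ 3 \<noteq> 0"
proof -
  have D: "bracket a b c \<noteq> 0" using assms by (simp add: general5_def)
  have "bracket d b c = bracket b c d" "bracket e b c = bracket b c e"
    "bracket a d c = - bracket a c d" "bracket a e c = - bracket a c e"
    by (simp_all add: bracket_def algebra_simps)
  hence nz: "bracket d b c \<noteq> 0" "bracket e b c \<noteq> 0" "bracket a d c \<noteq> 0" "bracket a e c \<noteq> 0" "bracket a b d \<noteq> 0" "bracket a b e \<noteq> 0"
    using assms(1) by (simp_all add: general5_def)
  have nz2: "bracket a b c * bracket a d e \<noteq> 0" "bracket a b c * bracket b d e \<noteq> 0" "bracket a b c * bracket c d e \<noteq> 0"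
    using assms(1) by (auto simp: general5_def)
  have "n $ 3 = bracket d b c * bracket e b c * (bracket a b c * bracket a d e)"
    unfolding bracket_frame1[OF D] n_def by (simp add: cross_def frame_monomials_def vec3_simps algebra_simps)
  thus "n $ 3 \<noteq> 0" using nz nz2 by simp
  have "n $ 2 = bracket a d c * bracket a e c * (bracket a b c * bracket b d e)"
    unfolding bracket_frame2[OF D] n_def by (simp add: cross_def frame_monomials_def vec3_simps algebra_simps)
  thus "n $ 2 \<noteq> 0" using nz nz2 by simp
  have "n $ 1 = bracket a b d * bracket a b e * (bracket a b c * bracket c d e)"
    unfolding bracket_frame3[OF D] n_def by (simp add: cross_def frame_monomials_def vec3_simps algebra_simps)
  thus "n $ 1 \<noteq> 0" using nz nz2 by simp
qed

lemma dot_cross_self: "dot (cross u v) u = 0" "dot (cross u v) v = 0"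
  by (simp_all add: dot_def cross_def vec3_simps algebra_simps)

lemma dot_frame_monomials: "dot n (frame_monomials a b c x) = n $ 1 * (bracket x b c * bracket a x c)
       + n $ 2 * (bracket x b c * bracket a b x) + n $ 3 * (bracket a x c * bracket a b x)"
  by (simp add: dot_def frame_monomials_def vec3_simps)

lemma frame_monomials_vertex: "frame_monomials a b c a = 0" "frame_monomials a b c b = 0" "frame_monomials a b c c = 0"
  by (simp_all add: frame_monomials_def bracket_def vec3_eq_iff vec3_simps algebra_simps)

lemma conic_through_5_exists:
  fixes a b c d e :: "'a::field_char_0 ^ 3"
  assumes g: "general5 a b c d e"
  shows "\<exists>F. conic_form F \<and> (\<forall>x\<in>{a,b,c,d,e}. eval3 F x = 0)"
proof -
  let ?n = "cross (frame_monomials a b c d) (frame_monomials a b c e)"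
  have D: "bracket a b c \<noteq> 0" using g by (simp add: general5_def)
  obtain F where F: "conic_form F" "\<And>x. eval3 F x = dot ?n (frame_monomials a b c x)"
    using conic_form_exists[OF D pencil_vector_nonzero[OF g]] unfolding dot_frame_monomials by metis
  have "\<forall>x\<in>{a,b,c,d,e}. eval3 F x = 0"
    by (auto simp: F(2) frame_monomials_vertex dot_cross_self) (simp_all add: dot_def)
  thus ?thesis using F(1) by blast
qed

text \<open>The coefficient vector of F is orthogonal to the monomials of d and e, hence a multiple
  of their cross product: the conic is unique. In particular two conics through the same five such
  points have the same zeros.\<close>

lemma conic_through_5_iff:
  fixes a b c d e :: "'a::field_char_0 ^ 3"
  assumes g: "general5 a b c d e" and F: "conic_form F" "\<forall>x\<in>{a,b,c,d,e}. eval3 F x = 0"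
  shows "eval3 F x = 0 \<longleftrightarrow> conic_det a b c d e x = 0"
proof -
  let ?m = "frame_monomials a b c"
  let ?n = "cross (?m d) (?m e)"
  have D: "bracket a b c \<noteq> 0" using g by (simp add: general5_def)
  obtain \<alpha> \<beta> \<gamma> where l: "\<not> (\<alpha> = 0 \<and> \<beta> = 0 \<and> \<gamma> = 0)"
    "\<And>x. (bracket a b c)\<^sup>2 * eval3 F x = dot (vector [\<alpha>, \<beta>, \<gamma>]) (?m x)"
    using conic_form_frame[OF F(1) _ _ _ D] F(2) unfolding dot_frame_monomials vec3_simps by (metis insertCI)
  define l where "l = (vector [\<alpha>, \<beta>, \<gamma>] :: 'a ^ 3)"
  have l0: "l \<noteq> 0" using l(1) by (auto simp: l_def vec3_eq_iff vec3_simps)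
  have dl: "(bracket a b c)\<^sup>2 * eval3 F x = dot l (?m x)" for x using l(2) by (simp add: l_def)
  have "dot l (?m d) = 0" "dot l (?m e) = 0" using dl[of d] dl[of e] F(2) by simp_all
  hence "cross l ?n = 0"
    by (simp add: cross_cross vec3_eq_iff vec3_simps)
  moreover have n0: "?n \<noteq> 0" using pencil_vector_nonzero[OF g] by (metis zero_index)
  ultimately obtain k where k: "l = k *s ?n" using cross_eq_0_iff by blast
  have "k \<noteq> 0" using k l0 by auto
  have "(bracket a b c)\<^sup>2 * eval3 F x = k * dot ?n (?m x)"
    unfolding dl k by (simp add: dot_def vec3_simps algebra_simps)
  also have "dot ?n (?m x) = - ((bracket a b c)\<^sup>2 * conic_det a b c d e x)"
    using conic_det_frame[OF D, of d e x] by simp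
  finally have "(bracket a b c)\<^sup>2 * eval3 F x = k * - ((bracket a b c)\<^sup>2 * conic_det a b c d e x)" .
  thus ?thesis
    using D \<open>k \<noteq> 0\<close> by (metis mult_eq_0_iff neg_equal_0_iff_equal power_not_zero)
qed

section \<open>Configurations in coordinates\<close>

definition represented_by :: "(nat \<Rightarrow> ('a::field ^ 3) set) \<Rightarrow> (nat \<Rightarrow> 'a ^ 3) \<Rightarrow> bool" where
  "represented_by p v \<longleftrightarrow> (\<forall>i\<in>{1..8}. p i = vec.span {v i} \<and> v i \<noteq> 0) \<and>
     (\<forall>i\<in>{1..8}. \<forall>j\<in>{1..8}. i \<noteq> j \<longrightarrow> cross (v i) (v j) \<noteq> 0)"

lemma configuration_coordinates:
  assumes "p \<in> configurations"
  obtains v where "represented_by p v"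
proof -
  have p: "p i \<in> proj_plane" if "i \<in> {1..8}" for i
    using assms that by (auto simp: configurations_def)
  have "\<forall>i. \<exists>w. i \<in> {1..8} \<longrightarrow> p i = vec.span {w} \<and> w \<noteq> 0"
    using p proj_pointE by metis
  then obtain v where v: "\<And>i. i \<in> {1..8} \<Longrightarrow> p i = vec.span {v i} \<and> v i \<noteq> 0" by metis
  have "cross (v i) (v j) \<noteq> 0" if "i \<in> {1..8}" "j \<in> {1..8}" "i \<noteq> j" for i j
  proof -
    have "p i \<noteq> p j" using assms that by (auto simp: configurations_def inj_on_def)
    thus ?thesis using v[OF that(1)] v[OF that(2)] span_eq_iff_cross by metis
  qed
  thus ?thesis using that[of v] v by (auto simp: represented_by_def)
qed

lemma configuration_of_vectors:
  assumes "\<And>i j. i \<in> {1..8} \<Longrightarrow> j \<in> {1..8} \<Longrightarrow> i \<noteq> j \<Longrightarrow> cross (v i) (v j) \<noteq> 0"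
  shows "restrict (\<lambda>i. vec.span {v i}) {1..8} \<in> configurations"
    and "represented_by (restrict (\<lambda>i. vec.span {v i}) {1..8}) v"
proof -
  have nz: "v i \<noteq> 0" if "i \<in> {1..8}" for i
  proof -
    have "(1::nat) \<in> {1..8}" "(2::nat) \<in> {1..8}" "i \<noteq> 1 \<or> i \<noteq> 2" by auto
    then obtain j where "j \<in> {1..8}" "i \<noteq> j" by blast
    hence "cross (v i) (v j) \<noteq> 0" using assms[OF that] by blast
    thus ?thesis by (auto simp: cross_def vec3_eq_iff vec3_simps)
  qed
  have "inj_on (\<lambda>i. vec.span {v i}) {1..8}"
    using assms nz span_eq_iff_cross unfolding inj_on_def by metis
  thus "restrict (\<lambda>i. vec.span {v i}) {1..8} \<in> configurations"
    using span_in_proj_plane[OF nz] unfolding configurations_def mem_Collect_eq inj_on_restrict_eq restrict_PiE_iff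
    by blast
  show "represented_by (restrict (\<lambda>i. vec.span {v i}) {1..8}) v"
    using assms nz by (auto simp: represented_by_def)
qed

lemma collinear_triples_iff:
  assumes "represented_by p v" "i \<in> {1..8}" "j \<in> {1..8}" "k \<in> {1..8}" "distinct [i, j, k]"
  shows "{i, j, k} \<in> collinear_triples p \<longleftrightarrow> bracket (v i) (v j) (v k) = 0"
proof -
  have "cross (v i) (v j) \<noteq> 0" using assms by (auto simp: represented_by_def)
  from collinear_points_iff[OF this, of "v k"]
  show ?thesis using assms by (auto simp: collinear_triples_def represented_by_def)
qed

text \<open>By homogeneity a form vanishes on a whole projective point as soon as it vanishes at one
  spanning vector.\<close>

lemma eval3_conic_smult:
  assumes "conic_form F"
  shows "eval3 F (c *s v) = c\<^sup>2 * eval3 F v"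
proof -
  have "quadratic (eval3 F)" using assms by (simp add: conic_form_def quadratic_eval3)
  then obtain B where "\<And>x y z u v w. eval3 F (x *s u + y *s v + z *s w) =
     x\<^sup>2 * eval3 F u + y\<^sup>2 * eval3 F v + z\<^sup>2 * eval3 F w + x * y * B u v + x * z * B u w + y * z * B v w"
    using quadratic_polarize by blast
  from this[of c v 0 v 0 v] show ?thesis by simp
qed

lemma conic_sextuples_iff:
  assumes "represented_by p v"
  shows "J \<in> conic_sextuples p \<longleftrightarrow> J \<subseteq> {1..8} \<and> card J = 6 \<and> (\<exists>F. conic_form F \<and> (\<forall>i\<in>J. eval3 F (v i) = 0))"
proof -
  have *: "(\<forall>P\<in>p ` J. \<forall>x\<in>P. eval3 F x = 0) \<longleftrightarrow> (\<forall>i\<in>J. eval3 F (v i) = 0)" if "J \<subseteq> {1..8}" "conic_form F" for F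
  proof -
    have "p i = {c *s v i | c. True}" if "i \<in> J" for i
      using assms that \<open>J \<subseteq> {1..8}\<close> by (auto simp: represented_by_def span_single)
    moreover have "(\<forall>x\<in>{c *s v i | c. True}. eval3 F x = 0) \<longleftrightarrow> eval3 F (v i) = 0" for i
    proof -
      have "(\<forall>x\<in>{c *s v i | c. True}. eval3 F x = 0) \<longleftrightarrow> (\<forall>c. eval3 F (c *s v i) = 0)" by blast
      thus ?thesis unfolding eval3_conic_smult[OF that(2)] by (auto dest: spec[of _ 1])
    qed
    ultimately show ?thesis by simp
  qed
  show ?thesis
    unfolding conic_sextuples_def on_common_conic_def mem_Collect_eq
    by (intro conj_cong ex_cong1 refl) (rule *)
qed

lemma conic_sextuplesE:
  assumes "J \<in> conic_sextuples p" "represented_by p v"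
  obtains F where "conic_form F" "\<forall>i\<in>J. eval3 F (v i) = 0" "J \<subseteq> {1..8}" "card J = 6"
  using assms(1) unfolding conic_sextuples_iff[OF assms(2)] by (elim conjE exE)

lemma conic_sextuplesI:
  assumes "represented_by p v" "conic_form F" "\<forall>i\<in>J. eval3 F (v i) = 0" "J \<subseteq> {1..8}" "card J = 6"
  shows "J \<in> conic_sextuples p"
  unfolding conic_sextuples_iff[OF assms(1)] by (intro conjI exI) (fact assms)+

lemma card_3_elements:
  assumes "card I = 3"
  obtains i j k where "I = {i, j, k}" "distinct [i, j, k]"
  using assms by (auto simp: card_Suc_eq numeral_3_eq_3)

lemma conic_sextuple_no_collinear:
  fixes p :: "nat \<Rightarrow> ('a::field_char_0 ^ 3) set"
  assumes p: "represented_by p v" and J: "J \<in> conic_sextuples p" and I: "I \<subseteq> J" "I \<in> collinear_triples p"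
  shows False
proof -
  obtain F where F: "conic_form F" "\<forall>i\<in>J. eval3 F (v i) = 0" and sub: "J \<subseteq> {1..8}"
    using conic_sextuplesE[OF J p] .
  have "card I = 3" using I by (simp add: collinear_triples_def)
  then obtain i j k where ijk: "I = {i, j, k}" "distinct [i, j, k]" by (rule card_3_elements)
  have mem: "i \<in> J" "j \<in> J" "k \<in> J" using ijk I by auto
  hence mem8: "i \<in> {1..8}" "j \<in> {1..8}" "k \<in> {1..8}" using sub by blast+
  have "cross (v i) (v j) \<noteq> 0" "cross (v i) (v k) \<noteq> 0" "cross (v j) (v k) \<noteq> 0"
    using p mem8 ijk(2) unfolding represented_by_def by auto
  hence "bracket (v i) (v j) (v k) \<noteq> 0"
    using conic_no_three_collinear[OF F(1)] F(2) mem by blast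
  thus False using collinear_triples_iff[OF p mem8 ijk(2)] I(2) ijk(1) by simp
qed

lemma general5_of_no_collinear:
  assumes p: "represented_by p v" and "distinct [a, b, c, d, e]" "{a, b, c, d, e} \<subseteq> {1..8}"
    and nc: "\<And>I. I \<subseteq> {a, b, c, d, e} \<Longrightarrow> I \<notin> collinear_triples p"
  shows "general5 (v a) (v b) (v c) (v d) (v e)"
proof -
  have "bracket (v i) (v j) (v k) \<noteq> 0"
    if "{i, j, k} \<subseteq> {a, b, c, d, e}" "distinct [i, j, k]" for i j k
  proof -
    have "i \<in> {1..8}" "j \<in> {1..8}" "k \<in> {1..8}" using that(1) assms(3) by blast+
    thus ?thesis using collinear_triples_iff[OF p _ _ _ that(2)] nc[OF that(1)] by blast
  qed
  thus ?thesis using assms(2) unfolding general5_def by auto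
qed

text \<open>Without collinear triples the quadric through five of the points is irreducible, and the
  sixth is tested against it. With such triples the determinant may vanish because of a pair of
  lines, which is not a conic.\<close>

lemma conic_sextuple_iff_conic_det:
  fixes p :: "nat \<Rightarrow> ('a::field_char_0 ^ 3) set"
  assumes p: "represented_by p v" and J: "distinct [a, b, c, d, e, f]" "{a, b, c, d, e, f} \<subseteq> {1..8}"
    and nc: "\<And>I. I \<subseteq> {a, b, c, d, e, f} \<Longrightarrow> I \<notin> collinear_triples p"
  shows "{a, b, c, d, e, f} \<in> conic_sextuples p \<longleftrightarrow> conic_det (v a) (v b) (v c) (v d) (v e) (v f) = 0"
proof -
  have "I \<notin> collinear_triples p" if "I \<subseteq> {a, b, c, d, e}" for I using nc[of I] that by blast
  hence g: "general5 (v a) (v b) (v c) (v d) (v e)"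
    using J by (intro general5_of_no_collinear[OF p]) auto
  have card: "card {a, b, c, d, e, f} = 6" using J(1) by simp
  show ?thesis
  proof
    assume "{a, b, c, d, e, f} \<in> conic_sextuples p"
    then obtain F where F: "conic_form F" "\<forall>i\<in>{a, b, c, d, e, f}. eval3 F (v i) = 0"
      using conic_sextuplesE[OF _ p] by metis
    hence "\<forall>x\<in>{v a, v b, v c, v d, v e}. eval3 F x = 0" "eval3 F (v f) = 0" by auto
    thus "conic_det (v a) (v b) (v c) (v d) (v e) (v f) = 0" using conic_through_5_iff[OF g F(1)] by blast
  next
    assume 0: "conic_det (v a) (v b) (v c) (v d) (v e) (v f) = 0"
    obtain F where F: "conic_form F" "\<forall>x\<in>{v a, v b, v c, v d, v e}. eval3 F x = 0"
      using conic_through_5_exists[OF g] by blast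
    hence "eval3 F (v f) = 0" using conic_through_5_iff[OF g F] 0 by blast
    hence "\<forall>i\<in>{a, b, c, d, e, f}. eval3 F (v i) = 0" using F(2) by auto
    thus "{a, b, c, d, e, f} \<in> conic_sextuples p" by (rule conic_sextuplesI[OF p F(1) _ J(2) card])
  qed
qed

lemma collinear_triples_exchange:
  assumes p: "represented_by p v" and I: "I1 \<in> collinear_triples p" "I2 \<in> collinear_triples p" "1 < card (I1 \<inter> I2)"
    "I \<subseteq> I1 \<union> I2" "card I = 3"
  shows "I \<in> collinear_triples p"
proof -
  have sub: "I1 \<subseteq> {1..8}" "I2 \<subseteq> {1..8}" using I by (auto simp: collinear_triples_def)
  have "finite (I1 \<inter> I2)" using sub finite_subset by blast
  then obtain i j where ij: "i \<in> I1 \<inter> I2" "j \<in> I1 \<inter> I2" "i \<noteq> j"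
    using I(3) by (metis card_le_Suc0_iff_eq One_nat_def not_less)
  obtain W1 where W1: "W1 \<in> proj_lines" "\<forall>l\<in>I1. p l \<subseteq> W1"
    using I(1) by (auto simp: collinear_triples_def collinear_points_def)
  obtain W2 where W2: "W2 \<in> proj_lines" "\<forall>l\<in>I2. p l \<subseteq> W2"
    using I(2) by (auto simp: collinear_triples_def collinear_points_def)
  have mem8: "i \<in> {1..8}" "j \<in> {1..8}" using ij sub by blast+
  hence cr: "cross (v i) (v j) \<noteq> 0" and pi: "p i = vec.span {v i}" "p j = vec.span {v j}"
    using p ij(3) unfolding represented_by_def by blast+
  have "v i \<in> W1" "v j \<in> W1" "v i \<in> W2" "v j \<in> W2"
    using W1 W2 ij pi vec.span_base[of "v i" "{v i}"] vec.span_base[of "v j" "{v j}"] by blast+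
  hence "W1 = W2" using proj_line_eq_span[OF W1(1) _ _ cr] proj_line_eq_span[OF W2(1) _ _ cr] by simp
  hence "collinear_points (p ` I)" using W1 W2 I(4) unfolding collinear_points_def by blast
  thus ?thesis using I(4,5) sub by (auto simp: collinear_triples_def)
qed

text \<open>Five common points, no three of them collinear since they lie on a conic, determine the
  zeros of the form, so both forms vanish at all points of both sextuples.\<close>

lemma conic_sextuples_exchange:
  fixes p :: "nat \<Rightarrow> ('a::field_char_0 ^ 3) set"
  assumes p: "represented_by p v" and J: "J1 \<in> conic_sextuples p" "J2 \<in> conic_sextuples p" "4 < card (J1 \<inter> J2)"
    "J \<subseteq> J1 \<union> J2" "card J = 6"
  shows "J \<in> conic_sextuples p"
proof -
  obtain F1 where F1: "conic_form F1" "\<forall>i\<in>J1. eval3 F1 (v i) = 0" and s1: "J1 \<subseteq> {1..8}" "card J1 = 6"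
    using conic_sextuplesE[OF J(1) p] .
  obtain F2 where F2: "conic_form F2" "\<forall>i\<in>J2. eval3 F2 (v i) = 0" and s2: "J2 \<subseteq> {1..8}" "card J2 = 6"
    using conic_sextuplesE[OF J(2) p] .
  have "5 \<le> card (J1 \<inter> J2)" using J(3) by simp
  then obtain S where S: "S \<subseteq> J1 \<inter> J2" "card S = 5" using obtain_subset_with_card_n by metis
  have "finite S" using S(2) by (metis card.infinite zero_neq_numeral)
  then obtain xs where xs: "distinct xs" "set xs = S" using finite_distinct_list by blast
  hence "length xs = 5" using S(2) distinct_card by fastforce
  then obtain a b c d e where "xs = [a, b, c, d, e]" by (auto simp: length_Suc_conv eval_nat_numeral)
  hence abc: "S = {a, b, c, d, e}" "distinct [a, b, c, d, e]" using xs by auto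
  have "S \<subseteq> J1" "S \<subseteq> J2" using S by auto
  have g: "general5 (v a) (v b) (v c) (v d) (v e)"
  proof (rule general5_of_no_collinear[OF p abc(2)])
    show "{a, b, c, d, e} \<subseteq> {1..8}" using \<open>S \<subseteq> J1\<close> s1 abc by blast
    show "I \<notin> collinear_triples p" if "I \<subseteq> {a, b, c, d, e}" for I
      using conic_sextuple_no_collinear[OF p J(1)] that \<open>S \<subseteq> J1\<close> abc by blast
  qed
  have z1: "\<forall>x\<in>{v a, v b, v c, v d, v e}. eval3 F1 x = 0" using F1(2) \<open>S \<subseteq> J1\<close> abc by auto
  have z2: "\<forall>x\<in>{v a, v b, v c, v d, v e}. eval3 F2 x = 0" using F2(2) \<open>S \<subseteq> J2\<close> abc by auto
  have "eval3 F1 (v i) = 0" if "i \<in> J1 \<union> J2" for i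
    using that F1(2) F2(2) conic_through_5_iff[OF g F1(1) z1, of "v i"] conic_through_5_iff[OF g F2(1) z2, of "v i"]
    by blast
  hence "\<forall>i\<in>J. eval3 F1 (v i) = 0" using J(4) by blast
  moreover have "J \<subseteq> {1..8}" using J(4) s1(1) s2(1) by blast
  ultimately show ?thesis using conic_sextuplesI[OF p F1(1)] J(5) by blast
qed

text \<open>Because of this every pair represented over the complex numbers is a candidate quatroid,
  and the nonempty strata can be counted among the candidates.\<close>

lemma bezout_weak_configuration:
  fixes p :: "nat \<Rightarrow> ('a::field_char_0 ^ 3) set"
  assumes "p \<in> configurations"
  shows "bezout_weak (collinear_triples p, conic_sextuples p)"
proof -
  obtain v where p: "represented_by p v" using configuration_coordinates[OF assms] .
  have "card (I \<inter> J) \<le> 2" if "I \<in> collinear_triples p" "J \<in> conic_sextuples p" for I J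
  proof (rule ccontr)
    assume "\<not> card (I \<inter> J) \<le> 2"
    moreover have "card I = 3" using that(1) by (simp add: collinear_triples_def)
    moreover have "finite I" using \<open>card I = 3\<close> by (metis card.infinite zero_neq_numeral)
    ultimately have "I \<inter> J = I" by (intro card_seteq) auto
    thus False using conic_sextuple_no_collinear[OF p that(2) _ that(1)] by blast
  qed
  thus ?thesis
    unfolding bezout_weak_def prod.case
    using collinear_triples_exchange[OF p] conic_sextuples_exchange[OF p] by blast
qed

lemma represents_in_pairs: "represents p Q \<Longrightarrow> Q \<in> pairs"
  by (cases Q) (auto simp: represents_def pairs_def collinear_triples_def conic_sextuples_def)

text \<open>The relabelled configuration is p composed with the inverse of \<sigma>, so that its
  point with label \<sigma> i is the old point with label i.\<close>

lemma represents_permuted: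
  fixes p :: "nat \<Rightarrow> ('a::field ^ 3) set"
  assumes p: "p \<in> configurations" and s: "\<sigma> permutes {1..8}"
  obtains q :: "nat \<Rightarrow> ('a ^ 3) set" where "q \<in> configurations" "collinear_triples q = (`) \<sigma> ` collinear_triples p"
    "conic_sextuples q = (`) \<sigma> ` conic_sextuples p"
proof -
  let ?t = "inv_into UNIV \<sigma>"
  have t: "?t permutes {1..8}" using permutes_inv[OF s] .
  define q where "q = restrict (p \<circ> ?t) {1..8}"
  have t8: "?t i \<in> {1..8} \<longleftrightarrow> i \<in> {1..8}" for i using permutes_in_image[OF t] .
  have "q \<in> configurations"
  proof -
    have "inj_on (p \<circ> ?t) {1..8}"
      using p permutes_inj[OF t] permutes_image[OF t]
      by (intro comp_inj_on) (auto simp: configurations_def intro: inj_on_subset)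
    moreover have "(p \<circ> ?t) i \<in> proj_plane" if "i \<in> {1..8}" for i
      using p that t8[of i] by (auto simp: configurations_def Pi_iff PiE_iff)
    ultimately show ?thesis by (auto simp: configurations_def q_def inj_on_restrict_eq)
  qed
  moreover have img: "q ` (\<sigma> ` I) = p ` I" if "I \<subseteq> {1..8}" for I
  proof -
    have "q (\<sigma> i) = p i" if "i \<in> I" for i
      using that \<open>I \<subseteq> {1..8}\<close> permutes_in_image[OF s, of i] permutes_inverses(2)[OF s] by (auto simp: q_def)
    thus ?thesis by (simp add: image_image)
  qed
  have gen: "{I. I \<subseteq> {1..8} \<and> card I = k \<and> P (q ` I)} = (`) \<sigma> ` {I. I \<subseteq> {1..8} \<and> card I = k \<and> P (p ` I)}" for k P
  proof -
    have sub: "\<sigma> ` I \<subseteq> {1..8} \<longleftrightarrow> I \<subseteq> {1..8}" for I using permutes_in_image[OF s] by blast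
    have card: "card (\<sigma> ` I) = card I" for I using permutes_inj[OF s] by (simp add: card_image inj_on_subset)
    show ?thesis
    proof (intro equalityI subsetI)
      fix A assume A: "A \<in> {I. I \<subseteq> {1..8} \<and> card I = k \<and> P (q ` I)}"
      have "\<sigma> ` (?t ` A) = A" using permutes_inverses(1)[OF s] by (simp add: image_image)
      thus "A \<in> (`) \<sigma> ` {I. I \<subseteq> {1..8} \<and> card I = k \<and> P (p ` I)}"
        using A sub[of "?t ` A"] card[of "?t ` A"] img[of "?t ` A"]
        by (intro image_eqI[of _ _ "?t ` A"]) simp_all
    next
      fix A assume "A \<in> (`) \<sigma> ` {I. I \<subseteq> {1..8} \<and> card I = k \<and> P (p ` I)}"
      thus "A \<in> {I. I \<subseteq> {1..8} \<and> card I = k \<and> P (q ` I)}" using sub card img by auto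
    qed
  qed
  ultimately show ?thesis using that[of q] gen unfolding collinear_triples_def conic_sextuples_def by blast
qed

section \<open>Integer witnesses\<close>

type_synonym int3 = "int \<times> int \<times> int"

fun bracket_int :: "int3 \<Rightarrow> int3 \<Rightarrow> int3 \<Rightarrow> int" where
  "bracket_int (a, b, c) (a', b', c') (a'', b'', c'') =
     a * (b' * c'' - c' * b'') - b * (a' * c'' - c' * a'') + c * (a' * b'' - b' * a'')"

fun proportional_int :: "int3 \<Rightarrow> int3 \<Rightarrow> bool" where
  "proportional_int (a, b, c) (a', b', c') =
     (if b * c' = c * b' then if c * a' = a * c' then a * b' = b * a' else False else False)"

definition conic_det_int :: "int3 \<Rightarrow> int3 \<Rightarrow> int3 \<Rightarrow> int3 \<Rightarrow> int3 \<Rightarrow> int3 \<Rightarrow> int" where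
  "conic_det_int a b c d e f = bracket_int a b c * bracket_int a d e * bracket_int b d f * bracket_int c e f
     - bracket_int a b d * bracket_int a c e * bracket_int b c f * bracket_int d e f"

definition index_pairs :: "(nat \<times> nat) list" where
  "index_pairs = [(1,2), (1,3), (1,4), (1,5), (1,6), (1,7), (1,8), (2,3), (2,4), (2,5), (2,6), (2,7), (2,8), (3,4), (3,5),
    (3,6), (3,7), (3,8), (4,5), (4,6), (4,7), (4,8), (5,6), (5,7), (5,8), (6,7), (6,8), (7,8)]"

definition index_triples :: "(nat \<times> nat \<times> nat) list" where
  "index_triples = [(1,2,3), (1,2,4), (1,2,5), (1,2,6), (1,2,7), (1,2,8), (1,3,4), (1,3,5), (1,3,6), (1,3,7), (1,3,8), (1,4,5),
    (1,4,6), (1,4,7), (1,4,8), (1,5,6), (1,5,7), (1,5,8), (1,6,7), (1,6,8), (1,7,8), (2,3,4), (2,3,5), (2,3,6),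
    (2,3,7), (2,3,8), (2,4,5), (2,4,6), (2,4,7), (2,4,8), (2,5,6), (2,5,7), (2,5,8), (2,6,7), (2,6,8), (2,7,8),
    (3,4,5), (3,4,6), (3,4,7), (3,4,8), (3,5,6), (3,5,7), (3,5,8), (3,6,7), (3,6,8), (3,7,8), (4,5,6), (4,5,7),
    (4,5,8), (4,6,7), (4,6,8), (4,7,8), (5,6,7), (5,6,8), (5,7,8), (6,7,8)]"

definition index_sextuples :: "(nat \<times> nat \<times> nat \<times> nat \<times> nat \<times> nat) list" where
  "index_sextuples = [(1,2,3,4,5,6), (1,2,3,4,5,7), (1,2,3,4,5,8), (1,2,3,4,6,7), (1,2,3,4,6,8), (1,2,3,4,7,8), (1,2,3,5,6,7),
    (1,2,3,5,6,8), (1,2,3,5,7,8), (1,2,3,6,7,8), (1,2,4,5,6,7), (1,2,4,5,6,8), (1,2,4,5,7,8), (1,2,4,6,7,8),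
    (1,2,5,6,7,8), (1,3,4,5,6,7), (1,3,4,5,6,8), (1,3,4,5,7,8), (1,3,4,6,7,8), (1,3,5,6,7,8), (1,4,5,6,7,8),
    (2,3,4,5,6,7), (2,3,4,5,6,8), (2,3,4,5,7,8), (2,3,4,6,7,8), (2,3,5,6,7,8), (2,4,5,6,7,8), (3,4,5,6,7,8)]"

primrec on_line :: "bool oct list \<Rightarrow> nat \<Rightarrow> nat \<Rightarrow> nat \<Rightarrow> bool" where
  "on_line [] i j k = False"
| "on_line (L # K) i j k = (if (if ap i L then if ap j L then ap k L else False else False) then True else on_line K i j k)"

text \<open>The number of points of L among six given points: at least 3 if L is a line that meets them too often,
  and 0 if L stands for a conic through them.\<close>

definition count6 :: "nat \<times> nat \<times> nat \<times> nat \<times> nat \<times> nat \<Rightarrow> bool oct \<Rightarrow> nat" where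
  "count6 = (\<lambda>(a, b, c, d, e, f) L. bsuc (ap a L) (bsuc (ap b L) (bsuc (ap c L) (bsuc (ap d L) (bsuc (ap e L) (bsuc (ap f L) 0))))))"

primrec some_count :: "(nat \<Rightarrow> bool) \<Rightarrow> bool oct list \<Rightarrow> nat \<times> nat \<times> nat \<times> nat \<times> nat \<times> nat \<Rightarrow> bool" where
  "some_count P [] s = False"
| "some_count P (L # K) s = (if P (count6 s L) then True else some_count P K s)"

fun ge3 :: "nat \<Rightarrow> bool" where
  "ge3 (Suc (Suc (Suc n))) = True" | "ge3 n = False"

fun is0 :: "nat \<Rightarrow> bool" where
  "is0 0 = True" | "is0 (Suc n) = False"

primrec pairs_ok :: "int3 oct \<Rightarrow> (nat \<times> nat) list \<Rightarrow> bool" where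
  "pairs_ok w [] = True"
| "pairs_ok w (t # ts) = (if proportional_int (ap (fst t) w) (ap (snd t) w) then False else pairs_ok w ts)"

primrec triples_ok :: "bool oct list \<Rightarrow> int3 oct \<Rightarrow> (nat \<times> nat \<times> nat) list \<Rightarrow> bool" where
  "triples_ok K w [] = True"
| "triples_ok K w (t # ts) = (if (case t of (i, j, k) \<Rightarrow> (bracket_int (ap i w) (ap j w) (ap k w) = 0) = on_line K i j k)
     then triples_ok K w ts else False)"

text \<open>The determinant decides about conics only for six points without a collinear triple; a
  sextuple that contains a triple of the system is excluded on both sides.\<close>

fun sextuple_ok :: "bool oct list \<Rightarrow> int3 oct \<Rightarrow> nat \<times> nat \<times> nat \<times> nat \<times> nat \<times> nat \<Rightarrow> bool" where
  "sextuple_ok K w (a, b, c, d, e, f) = (if some_count ge3 K (a, b, c, d, e, f) then True else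
     (conic_det_int (ap a w) (ap b w) (ap c w) (ap d w) (ap e w) (ap f w) = 0) = some_count is0 K (a, b, c, d, e, f))"

primrec sextuples_ok :: "bool oct list \<Rightarrow> int3 oct \<Rightarrow> (nat \<times> nat \<times> nat \<times> nat \<times> nat \<times> nat) list \<Rightarrow> bool" where
  "sextuples_ok K w [] = True"
| "sextuples_ok K w (s # ss) = (if sextuple_ok K w s then sextuples_ok K w ss else False)"

definition witness_ok :: "nat \<times> int3 oct \<Rightarrow> bool" where
  "witness_ok iw = (if pairs_ok (snd iw) index_pairs then if triples_ok (rep (fst iw)) (snd iw) index_triples
     then sextuples_ok (rep (fst iw)) (snd iw) index_sextuples else False else False)"

text \<open>Found by a computer search; the four exceptional classes are missing.\<close>

definition witnesses :: "(nat \<times> int3 oct) list" where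
  "witnesses = [(0, Oct (1,2,2) (1,0,0) (1,1,-2) (0,1,0) (2,1,-1) (1,-2,1) (0,0,1) (2,-1,-2)),
    (1, Oct (1,-2,4) (1,-1,1) (2,2,-1) (0,0,1) (1,0,0) (0,1,0) (1,3,-1) (2,-3,4)),
    (2, Oct (1,0,0) (0,1,0) (2,-1,-1) (1,-1,1) (0,0,1) (2,2,1) (11,-3,2) (10,-8,15)),
    (3, Oct (1,2,-1) (0,1,0) (2,2,1) (1,-2,2) (0,0,1) (1,-1,-2) (2,-1,-1) (1,0,0)),
    (4, Oct (1,-2,-2) (1,2,2) (1,-1,-1) (2,1,-1) (1,0,1) (1,1,0) (0,0,1) (0,1,0)),
    (5, Oct (0,1,0) (0,0,1) (0,1,-1) (0,2,1) (1,1,2) (1,-1,-1) (1,-2,1) (1,0,0)),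
    (6, Oct (0,1,0) (0,0,1) (0,1,1) (0,1,-1) (0,2,1) (1,1,0) (2,-1,-1) (1,-1,1)),
    (7, Oct (0,1,0) (0,1,-1) (0,2,-1) (0,1,1) (0,0,1) (0,2,1) (1,-1,1) (1,0,-1)),
    (8, Oct (0,1,-2) (0,0,1) (0,2,1) (0,2,-1) (0,1,-1) (0,1,1) (0,1,0) (1,0,0)),
    (9, Oct (0,0,1) (0,1,2) (0,1,0) (0,1,-1) (0,1,-2) (0,1,1) (0,2,1) (0,2,-1)),
    (10, Oct (1,-1,1) (3,-18,-2) (1,2,2) (0,1,0) (1,6,-2) (0,0,1) (1,0,0) (2,2,1)),
    (11, Oct (0,1,0) (0,1,-2) (0,0,1) (1,-1,-2) (2,2,1) (1,2,2) (2,1,-1) (1,0,0)),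
    (12, Oct (2,-1,-2) (0,0,1) (2,2,-1) (1,0,0) (1,2,2) (22,-16,11) (0,1,0) (1,-1,1)),
    (13, Oct (2,1,2) (1,-1,-1) (0,1,0) (1,0,1) (1,2,-2) (1,-2,0) (0,0,1) (2,-1,1)),
    (14, Oct (2,-1,-1) (1,-1,-1) (1,-2,-2) (2,1,1) (1,0,1) (0,0,1) (1,2,0) (0,1,0)),
    (15, Oct (1,1,0) (0,0,1) (1,1,-1) (2,1,-1) (1,-1,-2) (1,0,1) (0,1,0) (1,2,2)),
    (16, Oct (0,1,0) (0,0,1) (0,1,1) (1,1,0) (1,2,2) (2,1,-2) (2,-2,-1) (1,0,1)),
    (17, Oct (1,0,1) (1,1,1) (0,1,0) (1,0,0) (0,0,1) (1,0,-1) (1,-2,2) (2,-2,-1)),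
    (18, Oct (1,-1,-1) (2,1,1) (1,0,0) (0,1,-1) (0,1,-2) (0,0,1) (0,1,0) (1,2,1)),
    (19, Oct (0,0,1) (0,1,0) (0,1,-1) (1,1,1) (1,1,-2) (2,2,-1) (2,2,1) (1,0,0)),
    (20, Oct (0,1,0) (0,0,1) (0,1,1) (2,1,-1) (1,-2,2) (1,1,-1) (1,-1,1) (1,0,0)),
    (21, Oct (1,0,1) (0,0,1) (1,0,0) (0,1,0) (2,-1,2) (1,1,1) (1,-1,1) (1,2,1)),
    (22, Oct (0,1,-1) (0,0,1) (0,1,2) (0,1,0) (1,-2,2) (1,0,0) (2,-1,1) (1,-1,-1)),
    (23, Oct (1,-1,1) (2,-1,1) (1,1,-1) (1,0,0) (0,0,1) (0,1,0) (0,2,1) (0,1,1)),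
    (24, Oct (1,0,0) (1,0,-1) (1,0,1) (0,0,1) (1,-1,0) (1,1,0) (2,-1,0) (0,1,0)),
    (25, Oct (0,1,0) (0,1,1) (0,0,1) (1,7,1) (1,-1,1) (1,-3,6) (2,2,-1) (1,0,0)),
    (26, Oct (1,-2,-1) (1,0,0) (17,-8,-4) (0,0,1) (0,1,0) (17,10,-28) (1,-1,1) (1,1,-2)),
    (27, Oct (0,1,0) (2,1,1) (2,-1,1) (1,-2,1) (1,2,1) (1,1,2) (1,0,0) (0,0,1)),
    (28, Oct (1,-2,-1) (1,1,2) (1,-1,0) (1,0,1) (2,1,1) (0,1,0) (2,-1,-1) (0,0,1)),
    (29, Oct (0,1,0) (1,-2,0) (2,1,1) (2,-1,-2) (2,2,1) (2,-2,-1) (0,0,1) (1,0,1)),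
    (30, Oct (7,11,16) (1,-1,1) (1,1,-2) (0,0,1) (1,0,0) (3,2,4) (0,1,0) (2,1,1)),
    (31, Oct (0,1,0) (1,-2,-2) (0,1,1) (0,0,1) (1,-1,-1) (2,1,-1) (2,2,1) (1,0,1)),
    (32, Oct (10,1,-1) (0,1,0) (1,0,0) (1,-2,2) (2,2,1) (2,-1,-1) (0,0,1) (1,-1,-2)),
    (33, Oct (1,-1,-1) (0,0,1) (1,2,0) (2,1,-1) (1,0,-2) (1,0,1) (0,1,0) (2,-1,1)),
    (34, Oct (2,-4,-1) (2,-2,-1) (1,-2,-2) (0,0,1) (0,1,0) (2,2,-1) (1,0,0) (2,-1,2)),
    (35, Oct (1,1,1) (0,0,1) (2,2,-1) (0,1,0) (1,-1,1) (0,1,2) (2,1,-2) (1,0,0)),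
    (36, Oct (0,3,-1) (0,0,1) (0,1,0) (1,-2,-1) (1,1,-2) (2,1,1) (1,-1,1) (1,0,0)),
    (37, Oct (1,2,2) (1,0,-2) (1,1,0) (1,-1,-1) (2,-1,-1) (1,0,1) (0,0,1) (0,1,0)),
    (38, Oct (1,1,-1) (1,1,0) (0,0,1) (1,0,0) (1,-1,1) (1,-2,0) (0,1,0) (1,2,2)),
    (39, Oct (2,-1,-1) (0,1,0) (2,-2,-1) (1,1,-2) (1,-2,1) (2,0,1) (1,0,0) (0,0,1)),
    (40, Oct (1,-1,0) (1,1,2) (1,-2,-1) (0,1,0) (1,0,0) (0,0,1) (2,-2,1) (1,-1,1)),
    (41, Oct (1,2,11) (1,2,0) (0,0,1) (1,-1,-1) (2,-1,2) (1,0,0) (1,1,0) (0,1,0)),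
    (42, Oct (1,0,0) (0,1,0) (1,1,0) (0,0,1) (1,0,2) (0,1,2) (0,1,-1) (0,1,1)),
    (43, Oct (2,0,-1) (1,-1,1) (1,1,-2) (0,0,1) (0,1,1) (0,1,0) (1,0,0) (1,0,-1)),
    (44, Oct (1,-1,0) (0,0,1) (1,-1,1) (0,1,0) (1,0,0) (1,1,0) (0,1,1) (0,1,-2)),
    (45, Oct (1,0,0) (1,1,0) (0,1,0) (1,0,-1) (0,0,1) (1,-1,1) (3,1,-1) (3,-5,2)),
    (46, Oct (1,0,0) (1,-1,1) (2,-1,1) (13,0,-1) (0,0,1) (1,-3,2) (1,1,-2) (0,1,0)),
    (47, Oct (1,0,0) (4,-2,-1) (1,-2,-1) (0,0,1) (1,0,1) (2,-1,-1) (1,1,-2) (0,1,0)),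
    (48, Oct (2,-1,-2) (2,1,-2) (0,1,0) (1,-1,-2) (1,1,2) (2,-1,0) (0,0,1) (1,0,1)),
    (49, Oct (0,1,-1) (0,1,0) (0,0,1) (1,2,-2) (2,-1,1) (2,1,2) (1,0,1) (2,-2,-1)),
    (50, Oct (4,4,1) (1,-1,1) (2,2,-1) (1,-1,-1) (0,0,1) (1,0,0) (2,-1,-4) (0,1,0)),
    (51, Oct (1,-1,2) (2,1,1) (1,0,0) (2,2,-1) (2,-1,2) (1,-2,-2) (0,1,0) (0,0,1)),
    (52, Oct (1,0,-2) (1,-2,2) (1,0,1) (2,-1,1) (0,0,1) (2,1,-1) (0,1,0) (1,1,0)),
    (53, Oct (0,1,0) (1,-1,2) (0,0,1) (1,1,1) (0,1,-1) (17,21,30) (1,0,0) (2,-6,3)),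
    (54, Oct (2,2,-1) (2,1,-2) (1,2,2) (1,-2,-2) (1,0,1) (1,-1,0) (0,0,1) (0,1,0)),
    (55, Oct (1,-2,2) (1,1,0) (0,0,1) (1,-2,-1) (1,1,-2) (2,-1,-1) (0,1,0) (1,0,1)),
    (56, Oct (7,-2,1) (0,1,0) (1,-2,1) (1,0,0) (1,2,1) (1,-1,-2) (2,-1,-1) (0,0,1)),
    (57, Oct (0,1,1) (0,2,1) (1,-2,-2) (1,0,0) (2,2,-1) (0,0,1) (0,1,0) (2,-1,2)),
    (58, Oct (1,1,0) (0,0,1) (1,2,2) (2,1,-2) (1,0,0) (0,1,0) (2,-1,1) (1,-2,1)),
    (59, Oct (2,1,-2) (0,1,0) (1,2,-2) (1,-1,0) (0,0,1) (2,1,-1) (1,-2,1) (1,0,1)),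
    (60, Oct (0,1,-1) (0,1,0) (1,1,-2) (1,-2,1) (1,0,0) (2,-1,1) (0,0,1) (0,1,1)),
    (61, Oct (0,1,0) (0,1,1) (2,-1,-2) (1,-2,-1) (2,1,-1) (1,1,0) (0,0,1) (0,1,-1)),
    (62, Oct (1,-1,1) (0,1,1) (2,1,5) (0,1,0) (2,1,2) (0,0,1) (2,2,-1) (1,0,0)),
    (63, Oct (1,-2,4) (1,1,-2) (1,0,0) (1,-2,1) (0,0,1) (2,-1,-1) (2,-2,1) (0,1,0)),
    (64, Oct (0,0,1) (1,-1,1) (1,-1,-1) (0,2,1) (0,1,0) (1,1,2) (2,1,-2) (1,0,0)),
    (65, Oct (1,-1,-2) (0,0,1) (1,-1,0) (2,1,-1) (1,1,0) (2,1,0) (0,1,0) (1,0,1)),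
    (66, Oct (0,1,-1) (0,1,0) (0,0,1) (1,2,-2) (1,0,0) (1,-1,-2) (2,-1,2) (2,2,-1)),
    (67, Oct (2,2,-1) (0,0,1) (1,1,1) (1,0,0) (1,2,-1) (2,0,1) (0,1,0) (1,-1,1)),
    (68, Oct (0,1,-1) (0,0,1) (0,1,0) (1,1,-1) (1,0,0) (2,2,-1) (1,-1,-1) (1,-2,-1)),
    (69, Oct (1,1,-1) (0,1,0) (1,0,-1) (1,1,2) (0,0,1) (1,-1,2) (1,0,0) (1,0,1)),
    (70, Oct (1,-1,1) (1,2,-2) (1,0,0) (0,1,0) (1,0,1) (1,0,-2) (0,0,1) (1,0,-1)),
    (71, Oct (1,-1,-1) (0,2,-1) (1,1,-2) (0,1,1) (1,0,0) (0,0,1) (1,-1,1) (0,1,0)),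
    (72, Oct (0,1,0) (3,-2,0) (1,0,0) (1,-1,1) (1,1,1) (1,-1,2) (2,-1,-2) (0,0,1)),
    (73, Oct (1,1,0) (2,1,2) (0,1,-2) (0,1,0) (1,0,0) (0,3,4) (1,-1,-1) (0,0,1)),
    (74, Oct (1,0,0) (1,-1,1) (0,1,-1) (1,0,1) (0,0,1) (0,1,0) (1,2,1) (0,1,1)),
    (75, Oct (0,1,0) (1,0,-2) (1,2,-2) (0,0,1) (0,1,-2) (2,0,1) (1,-2,0) (1,-1,1)),
    (76, Oct (1,-1,1) (0,1,-1) (1,0,0) (0,1,0) (2,-1,2) (0,0,1) (2,2,-1) (1,-2,-2)),
    (77, Oct (1,1,-2) (1,-2,1) (2,-1,-1) (1,-2,4) (1,0,0) (0,0,1) (1,-1,-2) (0,1,0)),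
    (78, Oct (2,-1,-1) (1,4,-2) (1,-2,1) (0,1,0) (1,1,-2) (1,0,0) (0,0,1) (4,-56,7)),
    (79, Oct (1,0,0) (1,2,-1) (1,-1,1) (15,-10,9) (2,-1,1) (15,-18,25) (0,0,1) (0,1,0)),
    (80, Oct (0,1,0) (0,0,1) (1,1,0) (1,2,1) (1,0,0) (2,2,-1) (2,-1,2) (1,-2,-2)),
    (81, Oct (1,-1,1) (2,0,1) (1,1,-1) (0,0,1) (1,2,-2) (1,0,2) (0,1,0) (2,1,0)),
    (82, Oct (1,1,1) (1,0,0) (1,0,1) (0,1,0) (0,0,1) (1,1,0) (2,1,-2) (2,-2,1)),
    (83, Oct (2,5,-4) (1,2,0) (1,-2,-2) (0,1,0) (2,2,-1) (1,0,0) (2,-1,2) (0,0,1)),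
    (84, Oct (1,-1,-1) (1,0,1) (1,-1,1) (0,0,1) (0,1,0) (1,0,-2) (1,2,0) (2,1,-1)),
    (85, Oct (2,1,1) (1,0,0) (1,0,1) (1,1,0) (0,0,1) (0,1,0) (1,-2,2) (1,2,-2)),
    (86, Oct (0,0,1) (0,1,0) (1,2,1) (1,2,0) (1,-1,1) (1,0,0) (0,1,1) (0,2,-1)),
    (87, Oct (1,-2,4) (1,1,0) (1,0,0) (2,-1,2) (0,1,0) (0,0,1) (1,-2,-2) (2,2,-1)),
    (88, Oct (1,0,0) (0,1,0) (1,1,0) (0,1,-1) (1,1,-1) (0,0,1) (2,1,1) (2,-2,-1)),
    (89, Oct (0,1,0) (1,-1,1) (1,0,1) (0,1,-1) (0,0,1) (1,0,0) (1,1,-2) (1,-2,-2)),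
    (90, Oct (1,-1,1) (1,0,0) (2,-1,1) (2,-2,1) (0,0,1) (4,-2,1) (0,1,0) (2,2,1)),
    (91, Oct (2,-1,-1) (1,1,-1) (3,-3,-1) (1,-1,1) (1,0,-2) (1,0,0) (0,0,1) (0,1,0)),
    (92, Oct (1,-1,1) (1,-1,-1) (0,0,1) (1,0,0) (1,1,-1) (1,-2,-2) (2,0,1) (0,1,0)),
    (93, Oct (1,-1,1) (1,0,0) (0,1,-1) (0,0,1) (2,-2,-3) (1,0,-1) (0,1,0) (1,-2,-2)),
    (94, Oct (1,0,0) (1,-1,-2) (0,1,2) (0,0,1) (1,0,3) (1,-1,1) (0,1,0) (1,-2,-1)),
    (95, Oct (0,1,0) (0,1,1) (0,0,1) (1,0,2) (1,-2,2) (1,-1,1) (1,0,0) (1,1,-1)),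
    (96, Oct (1,1,-2) (0,1,0) (1,4,-2) (0,0,1) (1,1,-1) (0,2,-1) (2,-1,-1) (1,0,0)),
    (97, Oct (1,0,0) (1,0,2) (0,0,1) (1,-2,2) (1,-1,1) (0,1,0) (2,-2,-1) (2,2,-1)),
    (98, Oct (0,1,-1) (1,-2,1) (1,1,-2) (0,1,0) (0,0,1) (1,-1,1) (1,1,-1) (1,0,0)),
    (99, Oct (1,0,0) (2,-1,1) (1,-1,1) (1,1,0) (0,1,0) (1,-2,1) (1,0,1) (0,0,1)),
    (100, Oct (1,1,-1) (1,0,1) (2,1,0) (1,0,-1) (0,1,0) (0,0,1) (1,1,0) (1,0,0)),
    (101, Oct (1,1,-1) (2,-1,-2) (0,1,0) (1,0,0) (0,1,-1) (2,-1,-1) (0,0,1) (0,1,1)),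
    (102, Oct (1,2,0) (0,2,-1) (1,0,1) (1,-2,0) (0,1,0) (1,2,-2) (0,0,1) (2,-1,1)),
    (103, Oct (1,-1,-2) (1,0,0) (2,1,2) (1,0,-1) (1,1,0) (0,0,1) (0,1,0) (2,-2,-1)),
    (104, Oct (2,-1,-1) (0,1,0) (1,2,2) (0,0,1) (0,1,1) (2,-1,4) (1,1,-1) (1,-1,1)),
    (105, Oct (2,1,-2) (0,1,-1) (0,1,0) (2,-1,-1) (1,0,-1) (0,0,1) (1,-2,0) (1,2,2)),
    (106, Oct (0,1,0) (1,2,-1) (0,1,-1) (1,2,-2) (0,0,1) (2,1,1) (1,-2,-2) (2,2,-1)),
    (107, Oct (1,-1,0) (2,-1,-1) (2,-5,-1) (1,-1,-2) (2,1,1) (0,1,0) (0,0,1) (1,0,1)),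
    (108, Oct (0,0,1) (1,0,0) (0,1,1) (0,1,0) (2,-1,-1) (2,-1,0) (1,-1,1) (1,-1,-2)),
    (109, Oct (0,1,-1) (1,0,0) (0,1,0) (0,0,1) (2,1,0) (2,0,1) (1,-1,1) (1,1,-1)),
    (110, Oct (1,0,0) (0,0,1) (2,-2,1) (1,2,-1) (1,-1,1) (1,2,0) (1,-2,2) (0,1,0)),
    (111, Oct (0,0,1) (1,0,1) (1,0,0) (0,1,1) (0,1,0) (1,-1,0) (1,1,1) (2,1,-1)),
    (112, Oct (1,1,0) (0,1,0) (1,0,0) (2,1,-1) (0,1,1) (2,-1,-1) (1,-1,1) (0,0,1)),
    (113, Oct (1,-1,0) (0,1,0) (1,0,0) (1,0,-1) (1,1,-2) (2,1,-2) (0,0,1) (1,-1,1)),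
    (114, Oct (1,-1,-1) (0,1,1) (1,0,0) (1,-1,0) (0,0,1) (1,0,1) (0,1,0) (0,1,-1)),
    (115, Oct (0,2,1) (0,1,0) (0,0,1) (2,0,1) (1,1,1) (2,1,1) (1,0,0) (1,-1,1)),
    (116, Oct (2,-1,2) (1,1,0) (1,-2,2) (1,1,-2) (1,0,0) (0,0,1) (0,3,-4) (0,1,0)),
    (117, Oct (0,1,-1) (0,0,1) (0,1,0) (1,-1,-1) (1,0,-2) (1,-1,1) (1,1,-1) (1,0,0)),
    (118, Oct (1,0,-1) (2,2,-1) (1,2,0) (0,0,1) (1,0,0) (1,1,1) (0,1,0) (0,1,-1)),
    (120, Oct (0,1,0) (1,0,1) (1,0,0) (1,1,0) (0,0,1) (1,2,-1) (0,1,1) (1,-2,-1)),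
    (122, Oct (0,1,-1) (0,0,1) (0,1,0) (1,0,0) (1,-1,1) (1,0,1) (1,-1,0) (1,2,-1)),
    (124, Oct (1,-1,-1) (0,1,1) (1,0,0) (1,1,-1) (0,1,0) (1,2,0) (1,-1,1) (0,0,1)),
    (125, Oct (1,0,0) (0,1,0) (1,-2,0) (1,-2,1) (2,-2,1) (1,0,1) (0,0,1) (2,0,1)),
    (126, Oct (1,1,-3) (1,-1,1) (1,0,-1) (1,-1,-1) (0,1,-1) (0,0,1) (0,1,0) (1,0,0))]"

primrec all_witnesses_ok :: "(nat \<times> int3 oct) list \<Rightarrow> bool" where
  "all_witnesses_ok [] = True"
| "all_witnesses_ok (x # xs) = (if witness_ok x then all_witnesses_ok xs else False)"

lemmas witness_rules = all_witnesses_ok.simps witness_ok_def sextuples_ok.simps sextuple_ok.simps triples_ok.simps pairs_ok.simps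
  is0.simps ge3.simps some_count.simps count6_def on_line.simps index_pairs_def index_triples_def index_sextuples_def
  conic_det_int_def proportional_int.simps bracket_int.simps ap_simps bsuc_simps rep_eqs
  prod.case fst_conv snd_conv if_True if_False simp_thms
  Num.inc.simps arith_simps arith_special rel_simps more_arith_simps

lemma witnesses_ok: "all_witnesses_ok witnesses"
  by (simp only: witnesses_def witness_rules cong: if_weak_cong)

section \<open>Completeness of the index lists\<close>

lemma length_3E:
  assumes "length xs = 3"
  obtains x y z where "xs = [x, y, z]"
  using assms by (auto simp: length_Suc_conv eval_nat_numeral)

lemma index_triples_complete:
  assumes "I \<subseteq> {1..8}" "card I = 3"
  obtains i j k where "(i, j, k) \<in> set index_triples" "I = {i, j, k}" "distinct [i, j, k]"
    "i \<in> {1..8}" "j \<in> {1..8}" "k \<in> {1..8}"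
proof -
  have fin: "finite I" using assms(2) by (metis card.infinite zero_neq_numeral)
  have "length (sorted_list_of_set I) = 3" using assms(2) by simp
  then obtain i j k where l: "sorted_list_of_set I = [i, j, k]" by (rule length_3E)
  have I: "I = {i, j, k}" using l set_sorted_list_of_set[OF fin] by simp
  have ord: "i < j" "j < k"
    using l sorted_sorted_list_of_set[of I] distinct_sorted_list_of_set[of I] by auto
  have "\<forall>i\<in>{1..8}. \<forall>j\<in>{1..8}. \<forall>k\<in>{1..8}. i < j \<longrightarrow> j < k \<longrightarrow> (i, j, k) \<in> set index_triples"
    unfolding atLeastAtMost_1_8 index_triples_def by simp
  thus ?thesis using that[of i j k] I ord assms(1) by auto
qed

lemma index_pairs_complete:
  assumes "i \<in> {1..8}" "j \<in> {1..8}" "i \<noteq> j"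
  shows "(i, j) \<in> set index_pairs \<or> (j, i) \<in> set index_pairs"
proof -
  have "\<forall>i\<in>{1..8}. \<forall>j\<in>{1..8}. i \<noteq> j \<longrightarrow> (i, j) \<in> set index_pairs \<or> (j, i) \<in> set index_pairs"
    unfolding atLeastAtMost_1_8 index_pairs_def by simp
  thus ?thesis using assms by blast
qed

definition set6 :: "nat \<times> nat \<times> nat \<times> nat \<times> nat \<times> nat \<Rightarrow> nat set" where
  "set6 = (\<lambda>(a, b, c, d, e, f). {a, b, c, d, e, f})"

lemma list_all2_exists: "list_all2 P xs ys \<Longrightarrow> x \<in> set xs \<Longrightarrow> \<exists>y\<in>set ys. P x y"
  by (induction rule: list_all2_induct) auto

lemma index_sextuples_complete:
  assumes "J \<subseteq> {1..8}" "card J = 6"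
  obtains s where "s \<in> set index_sextuples" "J = set6 s"
proof -
  \<comment> \<open>Both lists are in lexicographic order, so the reversed list of sextuples runs
    through the complements of the pairs.\<close>
  have la: "list_all2 (\<lambda>(i, j) s. {1..8} - {i, j} = set6 s) index_pairs (rev index_sextuples)"
    unfolding atLeastAtMost_1_8 index_pairs_def index_sextuples_def set6_def
    by (simp only: rev.simps append.simps list_all2_Cons list_all2_Nil prod.case) (simp add: insert_Diff_if)
  have all: "\<exists>s\<in>set index_sextuples. {1..8} - {i, j} = set6 s" if "(i, j) \<in> set index_pairs" for i j
    using list_all2_exists[OF la that] by (simp only: set_rev prod.case)
  have "card ({1..8} - J) = 2" using card_compl8[OF assms(1)] assms(2) by simp
  then obtain i j where ij: "{1..8} - J = {i, j}" "i \<noteq> j" by (auto simp: card_2_iff)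
  hence "i \<in> {1..8}" "j \<in> {1..8}" by blast+
  hence "(i, j) \<in> set index_pairs \<or> (j, i) \<in> set index_pairs" using index_pairs_complete ij(2) by blast
  hence "\<exists>s\<in>set index_sextuples. {1..8} - {i, j} = set6 s" 
    using all[of i j] all[of j i] insert_commute[of i j "{}"] by metis
  moreover have "{1..8} - {i, j} = J" using ij(1) assms(1) by blast
  ultimately show ?thesis using that by blast
qed

section \<open>From the executable tests to a representation\<close>

lemma on_line_iff:
  assumes "i \<in> {1..8}" "j \<in> {1..8}" "k \<in> {1..8}"
  shows "on_line K i j k \<longleftrightarrow> (\<exists>L\<in>set_of ` set K. {i, j, k} \<subseteq> L)"
  using assms by (induction K) (auto simp: set_of_def)

lemma count6_eq:
  assumes "distinct [a, b, c, d, e, f]" "{a, b, c, d, e, f} \<subseteq> {1..8}"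
  shows "count6 (a, b, c, d, e, f) L = card (set_of L \<inter> {a, b, c, d, e, f})"
proof -
  have "card (set_of L \<inter> {a, b, c, d, e, f}) = (\<Sum>i\<in>{a, b, c, d, e, f}. of_bool (i \<in> set_of L))"
    by (simp add: sum.If_cases of_bool_def Int_commute del: sum.insert)
  also have "\<dots> = (\<Sum>i\<in>{a, b, c, d, e, f}. of_bool (ap i L))"
    using assms(2) by (intro sum.cong) (auto simp: set_of_def)
  also have "\<dots> = count6 (a, b, c, d, e, f) L"
    using assms(1) by (simp add: count6_def bsuc_eq)
  finally show ?thesis by simp
qed

lemma some_count_iff: "some_count P K s \<longleftrightarrow> (\<exists>L\<in>set K. P (count6 s L))"
  by (induction K) auto

lemma ge3_iff: "ge3 n \<longleftrightarrow> 3 \<le> n"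
  by (cases n rule: ge3.cases) auto

lemma is0_iff: "is0 n \<longleftrightarrow> n = 0"
  by (cases n) auto

text \<open>A sextuple with three points on a line of the system needs no test.\<close>

lemma represents_rep_system:
  fixes v :: "nat \<Rightarrow> 'a::field_char_0 ^ 3"
  assumes i: "i < 128"
    and cr: "\<And>j k. (j, k) \<in> set index_pairs \<Longrightarrow> cross (v j) (v k) \<noteq> 0"
    and tr: "\<And>a b c. (a, b, c) \<in> set index_triples \<Longrightarrow> bracket (v a) (v b) (v c) = 0 \<longleftrightarrow> on_line (rep i) a b c"
    and sx: "\<And>a b c d e f. (a, b, c, d, e, f) \<in> set index_sextuples \<Longrightarrow> \<not> some_count ge3 (rep i) (a, b, c, d, e, f) \<Longrightarrow>
      conic_det (v a) (v b) (v c) (v d) (v e) (v f) = 0 \<longleftrightarrow> some_count is0 (rep i) (a, b, c, d, e, f)"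
  shows "\<exists>p\<in>configurations :: (nat \<Rightarrow> ('a ^ 3) set) set. represents p (pair_of (rep_system i))"
proof -
  let ?p = "restrict (\<lambda>i. vec.span {v i}) {1..8}"
  let ?K = "rep_system i"
  have sys: "?K \<in> systems" by (rule rep_system_in_systems[OF i])
  have "cross u w = 0 \<longleftrightarrow> cross w u = 0" for u w :: "'a ^ 3"
    by (auto simp: cross_def vec3_eq_iff vec3_simps algebra_simps)
  hence c8: "\<And>j k. j \<in> {1..8} \<Longrightarrow> k \<in> {1..8} \<Longrightarrow> j \<noteq> k \<Longrightarrow> cross (v j) (v k) \<noteq> 0"
    using index_pairs_complete cr by blast
  have p: "?p \<in> configurations" "represented_by ?p v"
    by (rule configuration_of_vectors, erule (2) c8)+
  have fst: "I \<in> collinear_triples ?p \<longleftrightarrow> I \<in> fst (pair_of ?K)" if I: "I \<subseteq> {1..8}" "card I = 3" for I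
  proof -
    obtain a b c where abc: "(a, b, c) \<in> set index_triples" "I = {a, b, c}" "distinct [a, b, c]"
      "a \<in> {1..8}" "b \<in> {1..8}" "c \<in> {1..8}" using index_triples_complete[OF I] .
    have "I \<in> collinear_triples ?p \<longleftrightarrow> (\<exists>L\<in>?K. I \<subseteq> L)"
      using collinear_triples_iff[OF p(2) abc(4-6,3)] tr[OF abc(1)] on_line_iff[OF abc(4-6), of "rep i"]
      by (simp only: abc(2) rep_system_def)
    thus ?thesis using I by (simp add: pair_of_def)
  qed
  have ct: "collinear_triples ?p = fst (pair_of ?K)"
    using fst by (auto simp: collinear_triples_def pair_of_def)
  have snd: "J \<in> conic_sextuples ?p \<longleftrightarrow> J \<in> snd (pair_of ?K)" if J: "J \<subseteq> {1..8}" "card J = 6" for J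
  proof -
    obtain s where s: "s \<in> set index_sextuples" "J = set6 s" using index_sextuples_complete[OF J] .
    obtain a b c d e f where sa: "s = (a, b, c, d, e, f)" by (cases s)
    have Ja: "J = {a, b, c, d, e, f}" using s sa by (simp add: set6_def)
    have dist: "distinct [a, b, c, d, e, f]" using J(2) Ja by (intro card_distinct) simp
    have sub: "{a, b, c, d, e, f} \<subseteq> {1..8}" using J(1) Ja by simp
    have cnt: "some_count P (rep i) s \<longleftrightarrow> (\<exists>L\<in>?K. P (card (L \<inter> J)))" for P
      unfolding some_count_iff sa count6_eq[OF dist sub] rep_system_def Ja by simp
    show ?thesis
    proof (cases "some_count ge3 (rep i) s")
      case True
      then obtain L where L: "L \<in> ?K" "3 \<le> card (L \<inter> J)" using cnt by (auto simp: ge3_iff)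
      then obtain I where I: "I \<subseteq> L \<inter> J" "card I = 3" using obtain_subset_with_card_n by metis
      hence I': "I \<in> fst (pair_of ?K)" using L(1) J(1) by (auto simp: pair_of_def)
      have "J \<notin> conic_sextuples ?p"
        using conic_sextuple_no_collinear[OF p(2) _ _] I(1) I' ct by blast
      moreover have "J \<notin> snd (pair_of ?K)"
      proof
        assume "J \<in> snd (pair_of ?K)"
        hence "card (I \<inter> J) \<le> 2"
          using I' bezout_weak_pair_of[OF sys] unfolding bezout_weak_def by (auto split: prod.splits)
        moreover have "I \<inter> J = I" using I(1) by blast
        ultimately show False using I(2) by simp
      qed
      ultimately show ?thesis by simp
    next
      case False
      have nc: "I \<notin> collinear_triples ?p" if I: "I \<subseteq> {a, b, c, d, e, f}" for I
      proof
        assume "I \<in> collinear_triples ?p"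
        then obtain L where L: "L \<in> ?K" "I \<subseteq> L" "card I = 3" unfolding ct by (auto simp: pair_of_def)
        have "card I \<le> card (L \<inter> J)" using L(2) I Ja by (intro card_mono) auto
        thus False using False L cnt by (auto simp: ge3_iff)
      qed
      have "J \<in> conic_sextuples ?p \<longleftrightarrow> (\<exists>L\<in>?K. card (L \<inter> J) = 0)"
        using conic_sextuple_iff_conic_det[OF p(2) dist sub nc] sx[OF s(1)[unfolded sa] False[unfolded sa]] cnt[of is0]
        by (simp only: Ja sa is0_iff)
      \<comment> \<open>An element of the system that misses J lies in the complement of J, which
        has two points, and so stands for a conic automatically.\<close>
      also have "\<dots> \<longleftrightarrow> (\<exists>A\<in>?K. card A \<le> 2 \<and> J \<inter> A = {})"
      proof (rule bex_cong[OF refl])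
        fix A assume A: "A \<in> ?K"
        have A8: "A \<subseteq> {1..8}" using system_subset[OF sys A] .
        have "card A \<le> 2" if "J \<inter> A = {}"
        proof -
          have "A \<subseteq> {1..8} - J" using A8 that by blast
          from card_mono[OF _ this] show ?thesis using card_compl8[OF J(1)] J(2) by simp
        qed
        moreover have "card (A \<inter> J) = 0 \<longleftrightarrow> J \<inter> A = {}"
          using finite8[OF A8] by (auto simp: Int_commute)
        ultimately show "card (A \<inter> J) = 0 \<longleftrightarrow> card A \<le> 2 \<and> J \<inter> A = {}" by blast
      qed
      finally show ?thesis using J by (simp add: pair_of_def)
    qed
  qed
  have "conic_sextuples ?p = snd (pair_of ?K)"
    using snd by (auto simp: conic_sextuples_def pair_of_def)
  hence "represents ?p (pair_of ?K)" using ct by (simp add: represents_def)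
  thus ?thesis using p(1) by blast
qed

section \<open>Transfer of integer witnesses to fields of characteristic 0\<close>

definition vec_of_int3 :: "int3 \<Rightarrow> 'a::field_char_0 ^ 3" where
  "vec_of_int3 = (\<lambda>(a, b, c). vector [of_int a, of_int b, of_int c])"

lemma bracket_vec_of_int3:
  "bracket (vec_of_int3 u) (vec_of_int3 v) (vec_of_int3 w) = of_int (bracket_int u v w)"
  by (cases u; cases v; cases w) (simp add: vec_of_int3_def bracket_def vec3_simps)

lemma cross_vec_of_int3:
  "cross (vec_of_int3 u :: 'a::field_char_0 ^ 3) (vec_of_int3 v) = 0 \<Longrightarrow> proportional_int u v"
  by (cases u; cases v)
    (simp add: vec_of_int3_def cross_def vec3_eq_iff vec3_simps flip: of_int_mult)

lemma conic_det_vec_of_int3: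
  "conic_det (vec_of_int3 a) (vec_of_int3 b) (vec_of_int3 c) (vec_of_int3 d) (vec_of_int3 e) (vec_of_int3 f) =
    of_int (conic_det_int a b c d e f)"
  by (simp add: conic_det_def conic_det_int_def bracket_vec_of_int3)

lemma pairs_ok_iff: "pairs_ok w ts \<longleftrightarrow> (\<forall>(i, j)\<in>set ts. \<not> proportional_int (ap i w) (ap j w))"
  by (induction ts) auto

lemma triples_ok_iff: "triples_ok K w ts \<longleftrightarrow>
    (\<forall>(i, j, k)\<in>set ts. (bracket_int (ap i w) (ap j w) (ap k w) = 0) = on_line K i j k)"
  by (induction ts) auto

lemma sextuples_ok_iff: "sextuples_ok K w ss \<longleftrightarrow> (\<forall>s\<in>set ss. sextuple_ok K w s)"
  by (induction ss) auto

lemma all_witnesses_ok_iff: "all_witnesses_ok xs \<longleftrightarrow> (\<forall>x\<in>set xs. witness_ok x)"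
  by (induction xs) auto

lemma witness_indices: "map fst witnesses = filter (\<lambda>i. i \<notin> {119, 121, 123, 127}) [0..<128]"
  by (simp only: witnesses_def list.map fst_conv upt128) simp

text \<open>Integers embed into every field of characteristic 0, so the vanishing and nonvanishing
  of brackets carries over, and one integer witness serves the complex, real and rational numbers
  alike.\<close>

lemma rational_representation:
  assumes "i < 128" "i \<notin> {119, 121, 123, 127}"
  shows "\<exists>p\<in>configurations :: (nat \<Rightarrow> ('a::field_char_0 ^ 3) set) set. represents p (pair_of (rep_system i))"
proof -
  have "i \<in> set (map fst witnesses)" using assms unfolding witness_indices by auto
  then obtain w where w: "(i, w) \<in> set witnesses" by auto
  hence "witness_ok (i, w)" using witnesses_ok by (auto simp: all_witnesses_ok_iff)
  hence ok: "pairs_ok w index_pairs" "triples_ok (rep i) w index_triples" "sextuples_ok (rep i) w index_sextuples"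
    by (simp_all add: witness_ok_def split: if_splits)
  show ?thesis
  proof (rule represents_rep_system[OF assms(1), of "\<lambda>j. vec_of_int3 (ap j w)"])
    show "cross (vec_of_int3 (ap j w) :: 'a ^ 3) (vec_of_int3 (ap k w)) \<noteq> 0" if "(j, k) \<in> set index_pairs" for j k
      using ok(1) that cross_vec_of_int3 unfolding pairs_ok_iff by blast
    show "(bracket (vec_of_int3 (ap a w) :: 'a ^ 3) (vec_of_int3 (ap b w)) (vec_of_int3 (ap c w)) = 0) = on_line (rep i) a b c"
      if "(a, b, c) \<in> set index_triples" for a b c
      using ok(2) that unfolding triples_ok_iff bracket_vec_of_int3 of_int_eq_0_iff by blast
    show "(conic_det (vec_of_int3 (ap a w) :: 'a ^ 3) (vec_of_int3 (ap b w)) (vec_of_int3 (ap c w))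
        (vec_of_int3 (ap d w)) (vec_of_int3 (ap e w)) (vec_of_int3 (ap f w)) = 0) = some_count is0 (rep i) (a, b, c, d, e, f)"
      if s: "(a, b, c, d, e, f) \<in> set index_sextuples" "\<not> some_count ge3 (rep i) (a, b, c, d, e, f)" for a b c d e f
    proof -
      have "sextuple_ok (rep i) w (a, b, c, d, e, f)" using ok(3) s(1) by (simp only: sextuples_ok_iff)
      thus ?thesis using s(2) unfolding conic_det_vec_of_int3 of_int_eq_0_iff by simp
    qed
  qed
qed

section \<open>The exceptional classes\<close>

lemma fano_not_realizable:
  fixes v :: "nat \<Rightarrow> 'a::field_char_0 ^ 3"
  assumes zero: "bracket (v 1) (v 2) (v 3) = 0" "bracket (v 1) (v 4) (v 5) = 0" "bracket (v 2) (v 4) (v 6) = 0"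
      "bracket (v 3) (v 5) (v 6) = 0" "bracket (v 4) (v 3) (v 7) = 0" "bracket (v 2) (v 5) (v 7) = 0" "bracket (v 1) (v 6) (v 7) = 0"
    and nz: "bracket (v 1) (v 2) (v 4) \<noteq> 0" "bracket (v 3) (v 2) (v 4) \<noteq> 0" "bracket (v 1) (v 2) (v 5) \<noteq> 0" "bracket (v 1) (v 6) (v 4) \<noteq> 0"
      "bracket (v 7) (v 2) (v 4) \<noteq> 0" "bracket (v 1) (v 7) (v 4) \<noteq> 0" "bracket (v 1) (v 2) (v 7) \<noteq> 0"
  shows False
proof -
  define X Y Z where "X i = bracket (v i) (v 2) (v 4)" and "Y i = bracket (v 1) (v i) (v 4)" and "Z i = bracket (v 1) (v 2) (v i)" for i
  have c: "Z 3 = 0" "Y 5 = 0" "X 6 = 0"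
    using zero(1-3) by (simp_all add: X_def Y_def Z_def bracket_def algebra_simps)
  have 1: "X 3 * Y 7 = Y 3 * X 7" using bracket_frame3[OF nz(1), of "v 3" "v 7"] zero(5) by (simp add: X_def Y_def Z_def)
  have 2: "Z 5 * X 7 = X 5 * Z 7" using bracket_frame2[OF nz(1), of "v 5" "v 7"] zero(6) by (simp add: X_def Y_def Z_def)
  have 3: "Y 6 * Z 7 = Z 6 * Y 7" using bracket_frame1[OF nz(1), of "v 6" "v 7"] zero(7) by (simp add: X_def Y_def Z_def)
  have "X 3 * (Y 5 * Z 6 - Z 5 * Y 6) - Y 3 * (X 5 * Z 6 - Z 5 * X 6) + Z 3 * (X 5 * Y 6 - Y 5 * X 6) = 0"
    using bracket_frame0[OF nz(1), of "v 3" "v 5" "v 6"] zero(4) by (simp add: X_def Y_def Z_def)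
  hence 4: "X 3 * Z 5 * Y 6 + Y 3 * X 5 * Z 6 = 0" unfolding c by algebra
  have "(2 * (X 3 * Z 5 * Y 6)) * (X 7 * Y 7 * Z 7) = 0" using 1 2 3 4 by algebra
  thus False using nz by (simp add: X_def Y_def Z_def)
qed

text \<open>Again 3, 5, 6 lie on the sides of the triangle 1, 2, 4, and \<open>a\<close> and
  \<open>b\<close> are the two products that Ceva's theorem would equate. Point 7 is the meet of 43
  and 56, point 8 that of 25 and 36. Their collinearity with 1 becomes the stated equation, which
  makes the quotient of \<open>a\<close> and \<open>b\<close> a primitive cube root of
  unity.\<close>

lemma maclane_equation:
  fixes v :: "nat \<Rightarrow> 'a::field_char_0 ^ 3"
  assumes zero: "bracket (v 1) (v 2) (v 3) = 0" "bracket (v 1) (v 4) (v 5) = 0" "bracket (v 2) (v 4) (v 6) = 0"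
      "bracket (v 4) (v 3) (v 7) = 0" "bracket (v 2) (v 5) (v 8) = 0" "bracket (v 1) (v 7) (v 8) = 0"
      "bracket (v 5) (v 6) (v 7) = 0" "bracket (v 3) (v 6) (v 8) = 0"
    and nz: "bracket (v 1) (v 2) (v 4) \<noteq> 0" "bracket (v 3) (v 2) (v 4) \<noteq> 0" "bracket (v 1) (v 2) (v 5) \<noteq> 0" "bracket (v 1) (v 6) (v 4) \<noteq> 0"
      "bracket (v 7) (v 2) (v 4) \<noteq> 0" "bracket (v 8) (v 2) (v 4) \<noteq> 0"
  shows "\<exists>a b :: 'a. a \<noteq> 0 \<and> a * a + a * b + b * b = 0"
proof -
  define X Y Z where "X i = bracket (v i) (v 2) (v 4)" and "Y i = bracket (v 1) (v i) (v 4)" and "Z i = bracket (v 1) (v 2) (v i)" for i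
  have c: "Z 3 = 0" "Y 5 = 0" "X 6 = 0"
    using zero(1-3) by (simp_all add: X_def Y_def Z_def bracket_def algebra_simps)
  have 1: "X 3 * Y 7 = Y 3 * X 7" using bracket_frame3[OF nz(1), of "v 3" "v 7"] zero(4) by (simp add: X_def Y_def Z_def)
  have 2: "Z 5 * X 8 = X 5 * Z 8" using bracket_frame2[OF nz(1), of "v 5" "v 8"] zero(5) by (simp add: X_def Y_def Z_def)
  have 3: "Y 7 * Z 8 = Z 7 * Y 8" using bracket_frame1[OF nz(1), of "v 7" "v 8"] zero(6) by (simp add: X_def Y_def Z_def)
  have "X 5 * (Y 6 * Z 7 - Z 6 * Y 7) - Y 5 * (X 6 * Z 7 - Z 6 * X 7) + Z 5 * (X 6 * Y 7 - Y 6 * X 7) = 0"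
    using bracket_frame0[OF nz(1), of "v 5" "v 6" "v 7"] zero(7) by (simp add: X_def Y_def Z_def)
  hence 4: "X 5 * Y 6 * Z 7 = X 5 * Z 6 * Y 7 + Z 5 * Y 6 * X 7" unfolding c by algebra
  have "X 3 * (Y 6 * Z 8 - Z 6 * Y 8) - Y 3 * (X 6 * Z 8 - Z 6 * X 8) + Z 3 * (X 6 * Y 8 - Y 6 * X 8) = 0"
    using bracket_frame0[OF nz(1), of "v 3" "v 6" "v 8"] zero(8) by (simp add: X_def Y_def Z_def)
  hence 5: "X 3 * Z 6 * Y 8 = X 3 * Y 6 * Z 8 + Y 3 * Z 6 * X 8" unfolding c by algebra
  define a b where "a = X 3 * Y 6 * Z 5" and "b = Y 3 * Z 6 * X 5"
  have 6: "X 3 * X 5 * Y 6 * Z 7 = X 7 * (a + b)" unfolding a_def b_def using 1 4 by algebra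
  have 7: "X 5 * X 3 * Z 6 * Y 8 = X 8 * (a + b)" unfolding a_def b_def using 2 5 by algebra
  have "(X 7 * (a + b)) * (X 8 * (a + b)) = X 3 * X 5 * Y 6 * Z 6 * ((X 3 * Y 7) * (X 5 * Z 8))"
    unfolding 6[symmetric] 7[symmetric] using 3 by algebra
  also have "\<dots> = X 7 * X 8 * (a * b)" unfolding 1 2[symmetric] a_def b_def by algebra
  finally have "(X 7 * X 8) * (a * a + a * b + b * b) = 0" by algebra
  hence "a * a + a * b + b * b = 0" using nz by (simp add: X_def)
  moreover have "a \<noteq> 0" using nz by (simp add: a_def X_def Y_def Z_def)
  ultimately show ?thesis by blast
qed

text \<open>Twice the expression is the sum of the squares of a, b and a + b.\<close>

lemma no_real_cube_root:
  fixes a b :: "'a::linordered_field"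
  assumes "a \<noteq> 0"
  shows "a * a + a * b + b * b \<noteq> 0"
proof
  assume "a * a + a * b + b * b = 0"
  hence "a * a + b * b + (a + b) * (a + b) = 0" by algebra
  moreover have "0 < a * a" using assms by (simp add: zero_less_mult_iff linorder_neq_iff) (metis linorder_neqE)
  ultimately show False by (metis add_pos_nonneg less_irrefl zero_le_square)
qed

section \<open>A complete quadrilateral with three conics\<close>

lemma bracket_of_crosses: "bracket (cross a b) (cross c d) (cross e f) =
    bracket c d f * bracket a b e - bracket c d e * bracket a b f"
  unfolding bracket_def cross_def vec3_simps by algebra

lemma quadratic_scale: "quadratic q \<Longrightarrow> quadratic (\<lambda>v. c * q v)"
  unfolding quadratic_def
proof (elim exE)
  fix a b c' d e f
  assume q: "\<forall>v. q v = a * (v $ 1)\<^sup>2 + b * (v $ 2)\<^sup>2 + c' * (v $ 3)\<^sup>2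
     + d * (v $ 1 * v $ 2) + e * (v $ 1 * v $ 3) + f * (v $ 2 * v $ 3)"
  show "\<exists>a b c' d e f. \<forall>v. c * q v = a * (v $ 1)\<^sup>2 + b * (v $ 2)\<^sup>2 + c' * (v $ 3)\<^sup>2
     + d * (v $ 1 * v $ 2) + e * (v $ 1 * v $ 3) + f * (v $ 2 * v $ 3)"
    by (rule exI[of _ "c * a"], rule exI[of _ "c * b"], rule exI[of _ "c * c'"], rule exI[of _ "c * d"],
        rule exI[of _ "c * e"], rule exI[of _ "c * f"]) (simp add: q algebra_simps)
qed

text \<open>The nonzero factor b is what a conic can be divided by; after this division all conics
  through u and v agree on their common secant.\<close>

lemma conic_on_secant:
  fixes F :: "'a::field_char_0 poly poly poly"
  assumes F: "conic_form F" "eval3 F u = 0" "eval3 F v = 0" and cr: "cross u v \<noteq> 0"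
  obtains b where "b \<noteq> 0" "\<And>x y. eval3 F (x *s u + y *s v) = x * y * b"
proof -
  have quad: "quadratic (eval3 F)" using F by (simp add: conic_form_def quadratic_eval3)
  obtain B where B: "\<And>x y z u v w. eval3 F (x *s u + y *s v + z *s w) =
     x\<^sup>2 * eval3 F u + y\<^sup>2 * eval3 F v + z\<^sup>2 * eval3 F w + x * y * B u v + x * z * B u w + y * z * B v w"
    using quadratic_polarize[OF quad] by blast
  have pol: "eval3 F (x *s u + y *s v) = x * y * B u v" for x y
    using B[of x u y v 0 v] F by simp
  have "B u v \<noteq> 0"
  proof
    assume "B u v = 0"
    hence "eval3 F (x *s u + y *s v) = 0" for x y using pol by simp
    from quadratic_zero_on_line_factors[OF quad cr this]
    show False using conic_form_not_product[OF F(1)] by blast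
  qed
  thus ?thesis using that pol by blast
qed

lemma dot_zero_imp_multiple:
  assumes "dot m u = 0" "dot m v = 0" "cross u v \<noteq> 0"
  obtains c where "m = c *s cross u v"
proof -
  have "cross m (cross u v) = 0" using assms by (simp add: cross_cross vec3_eq_iff vec3_simps)
  thus ?thesis using that cross_eq_0_iff[OF assms(3)] by blast
qed

text \<open>Scale the three conics so that they agree on the line 78. The difference of two of them is then the
  product of that line with the line through their two other common points, so the lines 12, 34, 56
  are concurrent. In a complete quadrilateral this happens only in characteristic 2.\<close>

lemma quadrilateral_three_conics:
  fixes v :: "nat \<Rightarrow> 'a::field_char_0 ^ 3"
  assumes F: "conic_form F1" "conic_form F2" "conic_form F3"
    and z1: "\<And>i. i \<in> {1,2,3,4,7,8} \<Longrightarrow> eval3 F1 (v i) = 0"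
    and z2: "\<And>i. i \<in> {1,2,5,6,7,8} \<Longrightarrow> eval3 F2 (v i) = 0"
    and z3: "\<And>i. i \<in> {3,4,5,6,7,8} \<Longrightarrow> eval3 F3 (v i) = 0"
    and cr: "\<And>i j. i \<in> {1..8} \<Longrightarrow> j \<in> {1..8} \<Longrightarrow> i \<noteq> j \<Longrightarrow> cross (v i) (v j) \<noteq> 0"
    and zero: "bracket (v 1) (v 3) (v 5) = 0" "bracket (v 2) (v 4) (v 5) = 0" "bracket (v 2) (v 3) (v 6) = 0" "bracket (v 1) (v 4) (v 6) = 0"
    and nz78: "\<And>i. i \<in> {1..6} \<Longrightarrow> bracket (v 7) (v 8) (v i) \<noteq> 0"
    and nz: "bracket (v 1) (v 2) (v 3) \<noteq> 0" "bracket (v 5) (v 2) (v 3) \<noteq> 0" "bracket (v 1) (v 6) (v 3) \<noteq> 0" "bracket (v 1) (v 2) (v 4) \<noteq> 0"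
  shows False
proof -
  let ?l = "cross (v 7) (v 8)"
  have c78: "?l \<noteq> 0" by (rule cr) auto
  obtain b1 where b1: "b1 \<noteq> 0" "\<And>x y. eval3 F1 (x *s v 7 + y *s v 8) = x * y * b1"
    using conic_on_secant[OF F(1) z1 z1 c78] by auto
  obtain b2 where b2: "b2 \<noteq> 0" "\<And>x y. eval3 F2 (x *s v 7 + y *s v 8) = x * y * b2"
    using conic_on_secant[OF F(2) z2 z2 c78] by auto
  obtain b3 where b3: "b3 \<noteq> 0" "\<And>x y. eval3 F3 (x *s v 7 + y *s v 8) = x * y * b3"
    using conic_on_secant[OF F(3) z3 z3 c78] by auto
  have diff: "\<exists>m. \<forall>w. eval3 G w / c + (- 1 / d) * eval3 H w = dot ?l w * dot m w"
    if "conic_form G" "conic_form H" "c \<noteq> 0" "d \<noteq> 0"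
      "\<And>x y. eval3 G (x *s v 7 + y *s v 8) = x * y * c" "\<And>x y. eval3 H (x *s v 7 + y *s v 8) = x * y * d" for G H c d
  proof -
    have "quadratic (\<lambda>w. (1 / c) * eval3 G w + (- 1 / d) * eval3 H w)"
      using that by (intro quadratic_add quadratic_scale quadratic_eval3) (auto simp: conic_form_def)
    from quadratic_zero_on_line_factors[OF this c78] show ?thesis using that by simp
  qed
  obtain m12 where m12: "\<And>w. eval3 F1 w / b1 + (- 1 / b2) * eval3 F2 w = dot ?l w * dot m12 w"
    using diff[OF F(1,2) b1(1) b2(1) b1(2) b2(2)] by blast
  obtain m56 where m56: "\<And>w. eval3 F2 w / b2 + (- 1 / b3) * eval3 F3 w = dot ?l w * dot m56 w"
    using diff[OF F(2,3) b2(1) b3(1) b2(2) b3(2)] by blast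
  obtain m34 where m34: "\<And>w. eval3 F3 w / b3 + (- 1 / b1) * eval3 F1 w = dot ?l w * dot m34 w"
    using diff[OF F(3,1) b3(1) b1(1) b3(2) b1(2)] by blast
  have c12: "cross (v 1) (v 2) \<noteq> 0" and c56: "cross (v 5) (v 6) \<noteq> 0" and c34: "cross (v 3) (v 4) \<noteq> 0"
    using cr[of 1 2] cr[of 5 6] cr[of 3 4] by simp_all
  have l: "dot ?l (v i) \<noteq> 0" if "i \<in> {1..6}" for i using nz78[OF that] by (simp add: bracket_cross)
  have d12: "dot m12 (v 1) = 0" "dot m12 (v 2) = 0"
    using m12[of "v 1"] m12[of "v 2"] z1[of 1] z1[of 2] z2[of 1] z2[of 2] l[of 1] l[of 2] by simp_all
  obtain \<alpha> where \<alpha>: "m12 = \<alpha> *s cross (v 1) (v 2)" using dot_zero_imp_multiple[OF d12 c12] .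
  have d56: "dot m56 (v 5) = 0" "dot m56 (v 6) = 0"
    using m56[of "v 5"] m56[of "v 6"] z2[of 5] z2[of 6] z3[of 5] z3[of 6] l[of 5] l[of 6] by simp_all
  obtain \<beta> where \<beta>: "m56 = \<beta> *s cross (v 5) (v 6)" using dot_zero_imp_multiple[OF d56 c56] .
  have d34: "dot m34 (v 3) = 0" "dot m34 (v 4) = 0"
    using m34[of "v 3"] m34[of "v 4"] z1[of 3] z1[of 4] z3[of 3] z3[of 4] l[of 3] l[of 4] by simp_all
  obtain \<gamma> where \<gamma>: "m34 = \<gamma> *s cross (v 3) (v 4)" using dot_zero_imp_multiple[OF d34 c34] .
  define s where "s = m12 + m56 + m34"
  have "dot ?l w * dot s w = 0" for w
  proof -
    have "dot ?l w * dot s w = dot ?l w * dot m12 w + dot ?l w * dot m56 w + dot ?l w * dot m34 w"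
      by (simp add: s_def dot_def vec3_simps algebra_simps)
    thus ?thesis unfolding m12[symmetric] m56[symmetric] m34[symmetric] by simp
  qed
  hence s0: "dot s (v i) = 0" if "i \<in> {1..6}" for i using l[OF that] by (metis mult_eq_0_iff)
  have "s = 0"
  proof -
    obtain c where c: "s = c *s cross (v 1) (v 2)" 
      using dot_zero_imp_multiple[OF s0 s0 c12] by auto
    have "dot s (v 3) = c * bracket (v 1) (v 2) (v 3)"
      unfolding c by (simp add: bracket_cross dot_def vec3_simps algebra_simps)
    thus ?thesis using s0[of 3] nz(1) c by simp
  qed
  have "bracket s (cross (v 5) (v 6)) (cross (v 3) (v 4)) = \<alpha> * bracket (cross (v 1) (v 2)) (cross (v 5) (v 6)) (cross (v 3) (v 4))"
    unfolding s_def \<alpha> \<beta> \<gamma> by (simp add: bracket_def vec3_simps algebra_simps)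
  hence "\<alpha> * bracket (cross (v 1) (v 2)) (cross (v 5) (v 6)) (cross (v 3) (v 4)) = 0"
    using \<open>s = 0\<close> by (simp add: bracket_def)
  moreover have "bracket (cross (v 1) (v 2)) (cross (v 5) (v 6)) (cross (v 3) (v 4)) \<noteq> 0"
  proof -
    define X Y Z where "X i = bracket (v i) (v 2) (v 3)" and "Y i = bracket (v 1) (v i) (v 3)" and "Z i = bracket (v 1) (v 2) (v i)" for i
    let ?D = "bracket (v 1) (v 2) (v 3)"
    have c: "Y 5 = 0" "X 6 = 0"
      using zero(1,3) by (simp_all add: X_def Y_def bracket_def algebra_simps)
    have 1: "Z 4 * X 5 = X 4 * Z 5" using bracket_frame2[OF nz(1), of "v 4" "v 5"] zero(2) by (simp add: X_def Y_def Z_def)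
    have 2: "Y 4 * Z 6 = Z 4 * Y 6" using bracket_frame1[OF nz(1), of "v 4" "v 6"] zero(4) by (simp add: X_def Y_def Z_def)
    have 3: "?D\<^sup>2 * bracket (v 5) (v 6) (v 4) =
        X 5 * (Y 6 * Z 4 - Z 6 * Y 4) - Y 5 * (X 6 * Z 4 - Z 6 * X 4) + Z 5 * (X 6 * Y 4 - Y 6 * X 4)"
      using bracket_frame0[OF nz(1), of "v 5" "v 6" "v 4"] by (simp add: X_def Y_def Z_def)
    have 4: "?D * bracket (v 5) (v 6) (v 3) = X 5 * Y 6 - Y 5 * X 6"
      using bracket_frame3[OF nz(1), of "v 5" "v 6"] bracket_cyclic[of "v 5" "v 6" "v 3"] by (simp add: X_def Y_def Z_def)
    have "?D\<^sup>2 * (bracket (v 5) (v 6) (v 4) * ?D - bracket (v 5) (v 6) (v 3) * Z 4) = - (2 * ?D * (X 5 * Y 6 * Z 4))"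
      using 1 2 3 4 unfolding c by algebra
    moreover have "2 * ?D * (X 5 * Y 6 * Z 4) \<noteq> 0" using nz by (simp add: X_def Y_def Z_def)
    ultimately show ?thesis unfolding bracket_of_crosses by (auto simp: Z_def)
  qed
  \<comment> \<open>With \<open>m12 = 0\<close> the forms F1 and F2 are proportional. Then 5 lies on
    the first conic together with 1 and 3, although these three points are collinear.\<close>
  ultimately have "m12 = 0" using \<alpha> by simp
  hence "eval3 F1 (v 5) = 0" using m12[of "v 5"] z2[of 5] b1(1) by (simp add: dot_def)
  hence "bracket (v 1) (v 3) (v 5) \<noteq> 0"
    using z1[of 1] z1[of 3] cr[of 1 3] cr[of 1 5] cr[of 3 5] by (intro conic_no_three_collinear[OF F(1)]) auto
  thus False using zero(1) by simp
qed

section \<open>Nonrepresentable representatives\<close>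

lemmas rep_eval_rules = rep_eqs on_line.simps ap_simps if_True if_False simp_thms

lemma bracket_rep:
  assumes "represented_by p v" "collinear_triples p = fst (pair_of (rep_system n))"
    and "i \<in> {1..8}" "j \<in> {1..8}" "k \<in> {1..8}" "distinct [i, j, k]"
  shows "bracket (v i) (v j) (v k) = 0 \<longleftrightarrow> on_line (rep n) i j k"
proof -
  have "{i, j, k} \<in> collinear_triples p \<longleftrightarrow> (\<exists>L\<in>rep_system n. {i, j, k} \<subseteq> L)"
    using assms(3-6) unfolding assms(2) pair_of_def by simp
  thus ?thesis
    using collinear_triples_iff[OF assms(1,3-6)] on_line_iff[OF assms(3-5), of "rep n"] by (simp only: rep_system_def)
qed

lemma
  assumes "represented_by p v" "collinear_triples p = fst (pair_of (rep_system n))"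
  shows bracket_eq_0_rep: "on_line (rep n) i j k \<Longrightarrow> i \<in> {1..8} \<Longrightarrow> j \<in> {1..8} \<Longrightarrow> k \<in> {1..8} \<Longrightarrow>
      distinct [i, j, k] \<Longrightarrow> bracket (v i) (v j) (v k) = 0"
    and bracket_neq_0_rep: "\<not> on_line (rep n) i j k \<Longrightarrow> i \<in> {1..8} \<Longrightarrow> j \<in> {1..8} \<Longrightarrow> k \<in> {1..8} \<Longrightarrow>
      distinct [i, j, k] \<Longrightarrow> bracket (v i) (v j) (v k) \<noteq> 0"
  using bracket_rep[OF assms] by blast+

lemma set_of_bits: "set xs \<subseteq> {1..8} \<Longrightarrow> set_of (bits xs) = set xs"
  unfolding set_of_def atLeastAtMost_1_8 bits.simps by (auto simp: ap_simps ap_simps(1)[simplified])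

lemma rep_system_memI: "bits xs \<in> set (rep n) \<Longrightarrow> set xs \<subseteq> {1..8} \<Longrightarrow> set xs \<in> rep_system n"
  unfolding rep_system_def using set_of_bits[of xs] by (metis image_eqI)

text \<open>Both entries contain the Fano plane on the points 1 to 7; in entry 123 its line through
  1, 6, 7 also carries 8. Only brackets of the first seven points enter.\<close>

lemma fano_not_matroidal:
  fixes p :: "nat \<Rightarrow> ('a::field_char_0 ^ 3) set"
  assumes "p \<in> configurations" "n = 121 \<or> n = 123"
  shows "collinear_triples p \<noteq> fst (pair_of (rep_system n))"
proof
  assume eq: "collinear_triples p = fst (pair_of (rep_system n))"
  obtain v where v: "represented_by p v" using configuration_coordinates[OF assms(1)] .
  note br = bracket_eq_0_rep[OF v eq] bracket_neq_0_rep[OF v eq]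
  have on: "on_line (rep n) 1 2 3" "on_line (rep n) 1 4 5" "on_line (rep n) 2 4 6" "on_line (rep n) 3 5 6"
      "on_line (rep n) 4 3 7" "on_line (rep n) 2 5 7" "on_line (rep n) 1 6 7"
    and off: "\<not> on_line (rep n) 1 2 4" "\<not> on_line (rep n) 3 2 4" "\<not> on_line (rep n) 1 2 5" "\<not> on_line (rep n) 1 6 4"
      "\<not> on_line (rep n) 7 2 4" "\<not> on_line (rep n) 1 7 4" "\<not> on_line (rep n) 1 2 7"
    using assms(2) by (elim disjE; simp only: rep_eval_rules cong: if_weak_cong)+
  show False
    by (rule fano_not_realizable[of v]) ((rule br, fact on off, simp, simp, simp, simp)+)
qed

lemma maclane_not_realizable:
  fixes p :: "nat \<Rightarrow> ('a::linordered_field ^ 3) set"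
  assumes "p \<in> configurations"
  shows "collinear_triples p \<noteq> fst (pair_of (rep_system 127))"
proof
  assume eq: "collinear_triples p = fst (pair_of (rep_system 127))"
  obtain v where v: "represented_by p v" using configuration_coordinates[OF assms(1)] .
  note br = bracket_eq_0_rep[OF v eq] bracket_neq_0_rep[OF v eq]
  have on: "on_line (rep 127) 1 2 3" "on_line (rep 127) 1 4 5" "on_line (rep 127) 2 4 6" "on_line (rep 127) 4 3 7"
      "on_line (rep 127) 2 5 8" "on_line (rep 127) 1 7 8" "on_line (rep 127) 5 6 7" "on_line (rep 127) 3 6 8"
    and off: "\<not> on_line (rep 127) 1 2 4" "\<not> on_line (rep 127) 3 2 4" "\<not> on_line (rep 127) 1 2 5" "\<not> on_line (rep 127) 1 6 4"
      "\<not> on_line (rep 127) 7 2 4" "\<not> on_line (rep 127) 8 2 4"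
    by (simp only: rep_eval_rules cong: if_weak_cong)+
  have "\<exists>a b :: 'a. a \<noteq> 0 \<and> a * a + a * b + b * b = 0"
    by (rule maclane_equation[of v]) ((rule br, fact on off, simp, simp, simp, simp)+)
  thus False using no_real_cube_root by blast
qed

lemma quadrilateral_not_representable:
  fixes p :: "nat \<Rightarrow> ('a::field_char_0 ^ 3) set"
  assumes "p \<in> configurations"
  shows "\<not> represents p (pair_of (rep_system 119))"
proof
  assume rep: "represents p (pair_of (rep_system 119))"
  hence eq: "collinear_triples p = fst (pair_of (rep_system 119))"
    and eqc: "conic_sextuples p = snd (pair_of (rep_system 119))" by (simp_all add: represents_def)
  obtain v where v: "represented_by p v" using configuration_coordinates[OF assms(1)] .
  note br = bracket_eq_0_rep[OF v eq] bracket_neq_0_rep[OF v eq]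
  have on: "on_line (rep 119) 1 3 5" "on_line (rep 119) 2 4 5" "on_line (rep 119) 2 3 6" "on_line (rep 119) 1 4 6"
    and off: "\<not> on_line (rep 119) 1 2 3" "\<not> on_line (rep 119) 5 2 3" "\<not> on_line (rep 119) 1 6 3" "\<not> on_line (rep 119) 1 2 4"
    and off78: "\<not> on_line (rep 119) 7 8 1" "\<not> on_line (rep 119) 7 8 2" "\<not> on_line (rep 119) 7 8 3"
       "\<not> on_line (rep 119) 7 8 4" "\<not> on_line (rep 119) 7 8 5" "\<not> on_line (rep 119) 7 8 6"
    by (simp only: rep_eval_rules cong: if_weak_cong)+
  \<comment> \<open>Conics are stored by their complements: {5, 6} stands for the conic through 1,
    2, 3, 4, 7, 8, and likewise for the other two.\<close>
  have mem: "bits [5, 6] \<in> set (rep 119)" "bits [3, 4] \<in> set (rep 119)" "bits [1, 2] \<in> set (rep 119)"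
    by (simp_all only: rep_eqs bits_simps oct.inject)
  have sets: "{5, 6} \<in> rep_system 119" "{3, 4} \<in> rep_system 119" "{1, 2} \<in> rep_system 119"
    using mem[THEN rep_system_memI] by simp_all
  have conic: "\<exists>F. conic_form F \<and> (\<forall>k\<in>J. eval3 F (v k) = 0)"
    if "J \<subseteq> {1..8}" "card J = 6" "A \<in> rep_system 119" "card A \<le> 2" "J \<inter> A = {}" for J A
  proof -
    have "J \<in> conic_sextuples p" unfolding eqc pair_of_def using that by auto
    thus ?thesis using conic_sextuplesE[OF _ v] by metis
  qed
  obtain F1 where F1: "conic_form F1" "\<forall>k\<in>{1,2,3,4,7,8}. eval3 F1 (v k) = 0"
    using conic[OF _ _ sets(1), of "{1,2,3,4,7,8}"] by auto
  obtain F2 where F2: "conic_form F2" "\<forall>k\<in>{1,2,5,6,7,8}. eval3 F2 (v k) = 0"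
    using conic[OF _ _ sets(2), of "{1,2,5,6,7,8}"] by auto
  obtain F3 where F3: "conic_form F3" "\<forall>k\<in>{3,4,5,6,7,8}. eval3 F3 (v k) = 0"
    using conic[OF _ _ sets(3), of "{3,4,5,6,7,8}"] by auto
  have 78: "bracket (v 7) (v 8) (v i) \<noteq> 0" if "i \<in> {1..6}" for i
  proof -
    have "i \<in> {1,2,3,4,5,6}" using that by auto
    thus ?thesis using br(2)[of 7 8 i] off78 by (elim insertE emptyE) (simp_all only:, simp_all)
  qed
  have cr: "cross (v i) (v j) \<noteq> 0" if "i \<in> {1..8}" "j \<in> {1..8}" "i \<noteq> j" for i j
    using v that unfolding represented_by_def by blast
  show False
    by (rule quadrilateral_three_conics[OF F1(1) F2(1) F3(1), of v])
      (use F1(2) F2(2) F3(2) cr 78 in blast,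
       use F1(2) F2(2) F3(2) cr 78 in blast,
       use F1(2) F2(2) F3(2) cr 78 in blast,
       use cr in blast,
       (rule br, fact on off, simp, simp, simp, simp)+,
       use 78 in blast,
       (rule br, fact on off, simp, simp, simp, simp)+)
qed

section \<open>The MacLane configuration over the complex numbers\<close>

definition omega :: complex where
  "omega = Complex (- 1 / 2) (sqrt 3 / 2)"

text \<open>Coordinates in the frame 1, 2, 4, scaled so that 3 and 5 have coordinates 0 and 1. With
  6 = (0, 1, t) the equation of \<open>maclane_equation\<close> reads 1 + t + t^2 = 0, and
  \<open>omega\<close> is one of its two roots.\<close>

definition maclane_vector :: "nat \<Rightarrow> complex ^ 3" where
  "maclane_vector i = ap i (Oct (vector [1, 0, 0]) (vector [0, 1, 0]) (vector [1, 1, 0]) (vector [0, 0, 1])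
     (vector [1, 0, 1]) (vector [0, 1, omega]) (vector [1, 1, 1 + omega]) (vector [1, - omega, 1]))"

lemma maclane_vector_simps:
  "maclane_vector 1 = vector [1, 0, 0]" "maclane_vector 2 = vector [0, 1, 0]" "maclane_vector 3 = vector [1, 1, 0]"
  "maclane_vector 4 = vector [0, 0, 1]" "maclane_vector 5 = vector [1, 0, 1]" "maclane_vector 6 = vector [0, 1, omega]"
  "maclane_vector 7 = vector [1, 1, 1 + omega]" "maclane_vector 8 = vector [1, - omega, 1]"
  by (simp_all only: maclane_vector_def ap_simps)

lemma maclane_brackets:
  "\<forall>(i, j, k)\<in>set index_triples. (bracket (maclane_vector i) (maclane_vector j) (maclane_vector k) = 0) = on_line (rep 127) i j k"
  by (simp only: index_triples_def list.set ball_simps prod.case rep_eval_rules maclane_vector_simps cong: if_weak_cong)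
     (simp add: bracket_def vec3_simps complex_eq_iff omega_def)

lemma maclane_complex_representation:
  "\<exists>p\<in>configurations :: (nat \<Rightarrow> (complex ^ 3) set) set. represents p (pair_of (rep_system 127))"
proof (rule represents_rep_system[of 127 maclane_vector])
  show "cross (maclane_vector i) (maclane_vector j) \<noteq> 0" if "(i, j) \<in> set index_pairs" for i j
  proof -
    have "\<forall>(i, j)\<in>set index_pairs. cross (maclane_vector i) (maclane_vector j) \<noteq> 0"
      by (simp only: index_pairs_def list.set ball_simps prod.case maclane_vector_simps)
         (simp add: cross_def vec3_eq_iff vec3_simps complex_eq_iff omega_def)
    thus ?thesis using that by blast
  qed
  show "(bracket (maclane_vector a) (maclane_vector b) (maclane_vector c) = 0) = on_line (rep 127) a b c"
    if "(a, b, c) \<in> set index_triples" for a b c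
    using maclane_brackets that by blast
  \<comment> \<open>Each point is on three of the eight lines, so removing two points leaves at
    least two lines intact: every sextuple contains a collinear triple, and no conic condition
    remains to be checked.\<close>
  have "\<forall>s\<in>set index_sextuples. some_count ge3 (rep 127) s"
    by (simp only: index_sextuples_def list.set ball_simps some_count.simps count6_def prod.case bsuc_simps ge3.simps
        rep_eval_rules cong: if_weak_cong)
  thus "(conic_det (maclane_vector a) (maclane_vector b) (maclane_vector c) (maclane_vector d) (maclane_vector e) (maclane_vector f) = 0) =
      some_count is0 (rep 127) (a, b, c, d, e, f)"
    if "(a, b, c, d, e, f) \<in> set index_sextuples" "\<not> some_count ge3 (rep 127) (a, b, c, d, e, f)" for a b c d e f
    using that by blast
qed simp

lemma lines_rep_system_eq:
  assumes "i < 128" "j < 128" "select (\<lambda>A. ge3 (size_oct A)) (rep i) = select (\<lambda>A. ge3 (size_oct A)) (rep j)"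
  shows "fst (pair_of (rep_system i)) = fst (pair_of (rep_system j))"
proof -
  have "lines (rep_system n) = set_of ` set (select (\<lambda>A. ge3 (size_oct A)) (rep n))" for n
    by (auto simp: lines_def rep_system_def card_set_of select_eq_filter ge3_iff)
  thus ?thesis using assms by (simp add: fst_pair_of rep_system_in_systems)
qed

text \<open>Being matroidal depends on the lines alone. Entry 104 has a witness, so entry 119 is a
  candidate quatroid although no configuration represents it.\<close>

lemma quadrilateral_lines: "fst (pair_of (rep_system 119)) = fst (pair_of (rep_system 104))"
proof (rule lines_rep_system_eq)
  show "select (\<lambda>A. ge3 (size_oct A)) (rep 119) = select (\<lambda>A. ge3 (size_oct A)) (rep 104)"
    by (simp only: rep_eqs select.simps size_oct.simps bsuc_simps ge3.simps if_True if_False cong: if_weak_cong)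
qed simp_all

section \<open>Counting\<close>

primrec only_triples_and_conics6 :: "bool oct list \<Rightarrow> bool" where
  "only_triples_and_conics6 [] = True"
| "only_triples_and_conics6 (A # K) = (if size_oct A = Suc (Suc 0) then only_triples_and_conics6 K
     else if size_oct A = Suc (Suc (Suc 0)) then only_triples_and_conics6 K else False)"

lemma only_triples_and_conics6_iff: "only_triples_and_conics6 K \<longleftrightarrow> (\<forall>A\<in>set K. size_oct A = 2 \<or> size_oct A = 3)"
  by (induction K) (auto simp: eval_nat_numeral)

lemma bezoutian_indices: "select (\<lambda>i. only_triples_and_conics6 (rep i)) [0..<128] =
    [0, 3, 4, 11, 12, 13, 15, 16, 26, 27, 29, 30, 31, 32, 33, 35, 36, 37, 39, 46, 47, 48, 49, 50, 51, 52, 53, 54,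
      55, 56, 58, 59, 62, 63, 64, 66, 67, 72, 75, 76, 77, 78, 79, 80, 81, 82, 83, 84, 85, 87, 88, 89, 91, 92, 93,
      96, 97, 102, 103, 104, 105, 106, 107, 108, 110, 111, 112, 113, 115, 116, 118, 119, 120, 121, 122, 124, 126,
      127]"
  by (simp only: upt128 select.simps rep_eqs only_triples_and_conics6.simps size_oct.simps bsuc_simps nat.inject nat.distinct
      simp_thms if_True if_False cong: if_weak_cong)

lemma two_overlapping_subsets:
  assumes "Suc k \<le> card T" "0 < k"
  obtains I1 I2 where "I1 \<subseteq> T" "I2 \<subseteq> T" "card I1 = k" "card I2 = k" "I1 \<noteq> I2" "card (I1 \<inter> I2) = k - 1"
proof -
  obtain S where S: "S \<subseteq> T" "card S = Suc k" using obtain_subset_with_card_n[OF assms(1)] by metis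
  have fin: "finite S" using S(2) by (metis card.infinite nat.distinct(1))
  have "\<not> card S \<le> Suc 0" using S(2) assms(2) by simp
  then obtain x y where xy: "x \<in> S" "y \<in> S" "x \<noteq> y" using card_le_Suc0_iff_eq[OF fin] by blast
  show ?thesis
  proof (rule that[of "S - {x}" "S - {y}"])
    have "(S - {x}) \<inter> (S - {y}) = S - {x, y}" by auto
    thus "card ((S - {x}) \<inter> (S - {y})) = k - 1"
      using xy fin S(2) by (simp add: card_Diff_subset)
  qed (use xy S fin in auto)
qed

text \<open>A line with four points contains two triples that share two points, and a conic with
  seven points contains two sextuples that share five. If no line or conic is larger than necessary,
  each triple is a whole line and each sextuple a whole conic.\<close>

lemma bezoutian_pair_of:
  assumes K: "K \<in> systems"
  shows "bezoutian (pair_of K) \<longleftrightarrow> (\<forall>A\<in>K. card A = 2 \<or> card A = 3)"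
proof
  assume "bezoutian (pair_of K)"
  hence b1: "\<And>I1 I2. I1 \<in> fst (pair_of K) \<Longrightarrow> I2 \<in> fst (pair_of K) \<Longrightarrow> I1 \<noteq> I2 \<Longrightarrow> card (I1 \<inter> I2) \<le> 1"
    and b2: "\<And>J1 J2. J1 \<in> snd (pair_of K) \<Longrightarrow> J2 \<in> snd (pair_of K) \<Longrightarrow> J1 \<noteq> J2 \<Longrightarrow> card (J1 \<inter> J2) \<le> 4"
    unfolding bezoutian_def by blast+
  show "\<forall>A\<in>K. card A = 2 \<or> card A = 3"
  proof
    fix A assume A: "A \<in> K"
    have A8: "A \<subseteq> {1..8}" using system_subset[OF K A] .
    have "\<not> 4 \<le> card A"
    proof
      assume "4 \<le> card A"
      then obtain I1 I2 where I: "I1 \<subseteq> A" "I2 \<subseteq> A" "card I1 = 3" "card I2 = 3" "I1 \<noteq> I2" "card (I1 \<inter> I2) = 3 - 1"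
        using two_overlapping_subsets[of 3 A] by auto
      hence "I1 \<in> fst (pair_of K)" "I2 \<in> fst (pair_of K)" using A A8 by (auto simp: pair_of_def)
      hence "card (I1 \<inter> I2) \<le> 1" by (rule b1[OF _ _ I(5)])
      thus False using I(6) by simp
    qed
    moreover have "\<not> card A \<le> 1"
    proof
      assume small: "card A \<le> 1"
      hence "7 \<le> card ({1..8} - A)" using card_compl8[OF A8] by simp
      then obtain J1 J2 where J: "J1 \<subseteq> {1..8} - A" "J2 \<subseteq> {1..8} - A" "card J1 = 6" "card J2 = 6" "J1 \<noteq> J2" "card (J1 \<inter> J2) = 6 - 1"
        using two_overlapping_subsets[of 6 "{1..8} - A"] by auto
      have "J \<in> snd (pair_of K)" if "J \<subseteq> {1..8} - A" "card J = 6" for J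
        using that A small by (auto simp: pair_of_def intro!: bexI[of _ A])
      hence "card (J1 \<inter> J2) \<le> 4" using J by (intro b2) blast+
      thus False using J(6) by simp
    qed
    ultimately show "card A = 2 \<or> card A = 3" by linarith
  qed
next
  assume sizes: "\<forall>A\<in>K. card A = 2 \<or> card A = 3"
  have 1: "card (I1 \<inter> I2) \<le> 1" if I: "I1 \<in> fst (pair_of K)" "I2 \<in> fst (pair_of K)" "I1 \<noteq> I2" for I1 I2
  proof -
    have *: "I \<in> lines K" if I0: "I \<in> fst (pair_of K)" for I
    proof -
      obtain L where L: "L \<in> lines K" "I \<subseteq> L" "card I = 3" using I0 by (auto simp: fst_pair_of[OF K])
      have "card L = 3" using L(1) sizes by (auto simp: lines_def)
      moreover have "finite L" using L(1) lines_props(1)[OF K] finite8 by blast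
      ultimately have "I = L" using L by (intro card_subset_eq) auto
      thus ?thesis using L by simp
    qed
    show ?thesis using lines_props(2)[OF K *[OF I(1)] *[OF I(2)] I(3)] by simp
  qed
  have 2: "card (J1 \<inter> J2) \<le> 4" if J: "J1 \<in> snd (pair_of K)" "J2 \<in> snd (pair_of K)" "J1 \<noteq> J2" for J1 J2
  proof -
    have *: "J \<in> conics K" if J0: "J \<in> snd (pair_of K)" for J
    proof -
      obtain C where C: "C \<in> conics K" "J \<subseteq> C" "card J = 6" using J0 by (auto simp: snd_pair_of[OF K])
      obtain A where A: "A \<in> K" "card A \<le> 2" "C = {1..8} - A" using C(1) by (auto simp: conics_def)
      have "card A = 2" using A sizes by force
      hence "card C = 6" using A card_compl8[OF system_subset[OF K A(1)]] by simp
      moreover have "finite C" using A by simp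
      ultimately have "J = C" using C by (intro card_subset_eq) auto
      thus ?thesis using C by simp
    qed
    show ?thesis using conics_props(2)[OF K *[OF J(1)] *[OF J(2)] J(3)] by simp
  qed
  show "bezoutian (pair_of K)"
    unfolding bezoutian_def using bezout_weak_pair_of[OF K] 1 2 by blast
qed

lemma bezoutian_rep:
  assumes "i < 128"
  shows "bezoutian (pair_of (rep_system i)) \<longleftrightarrow> i \<in> set (select (\<lambda>i. only_triples_and_conics6 (rep i)) [0..<128])"
proof -
  have "(\<forall>A\<in>rep_system i. card A = 2 \<or> card A = 3) \<longleftrightarrow> only_triples_and_conics6 (rep i)"
    by (auto simp: only_triples_and_conics6_iff rep_system_def card_set_of)
  thus ?thesis
    unfolding bezoutian_pair_of[OF rep_system_in_systems[OF assms]] select_eq_filter set_filter using assms by simp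
qed

text \<open>Two entries tell the three notions apart: 119 has the lines of a configuration but
  conics that these lines do not admit, and 127 needs a cube root of unity, which no ordered field
  has.\<close>

lemma representable_over_rep:
  assumes "i < 128"
  shows "representable_over TYPE(complex) (pair_of (rep_system i)) \<longleftrightarrow> i \<notin> {119, 121, 123}"
    and "representable_over TYPE('a::linordered_field) (pair_of (rep_system i)) \<longleftrightarrow> i \<notin> {119, 121, 123, 127}"
    and "matroidal (pair_of (rep_system i)) \<longleftrightarrow> i \<notin> {121, 123}"
proof -
  have cx: "representable_over TYPE(complex) (pair_of (rep_system i))" if "i \<notin> {119, 121, 123}"
    using rational_representation[OF assms, where 'a = complex] maclane_complex_representation that
    unfolding representable_over_def by (cases "i = 127") auto
  have no: "i \<notin> {119, 121, 123}" if r0: "representable_over TYPE('b::field_char_0) (pair_of (rep_system i))"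
  proof -
    obtain p :: "nat \<Rightarrow> ('b ^ 3) set" where p: "p \<in> configurations" "represents p (pair_of (rep_system i))"
      using r0 by (auto simp: representable_over_def)
    show ?thesis
      using fano_not_matroidal[OF p(1), of i] quadrilateral_not_representable[OF p(1)] p(2)
      by (auto simp: represents_def)
  qed
  show "representable_over TYPE(complex) (pair_of (rep_system i)) \<longleftrightarrow> i \<notin> {119, 121, 123}" using cx no by blast
  show "representable_over TYPE('a) (pair_of (rep_system i)) \<longleftrightarrow> i \<notin> {119, 121, 123, 127}"
  proof
    assume r: "representable_over TYPE('a) (pair_of (rep_system i))"
    then obtain p :: "nat \<Rightarrow> ('a ^ 3) set" where p: "p \<in> configurations" "represents p (pair_of (rep_system i))"
      by (auto simp: representable_over_def)
    have "i \<noteq> 127" using maclane_not_realizable[OF p(1)] p(2) by (auto simp: represents_def)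
    moreover have "i \<noteq> 119" using quadrilateral_not_representable[OF p(1)] p(2) by auto
    moreover have "i \<noteq> 121" "i \<noteq> 123" using fano_not_matroidal[OF p(1), of i] p(2) by (auto simp: represents_def)
    ultimately show "i \<notin> {119, 121, 123, 127}" by simp
  next
    assume "i \<notin> {119, 121, 123, 127}"
    thus "representable_over TYPE('a) (pair_of (rep_system i))"
      using rational_representation[OF assms, where 'a = 'a] unfolding representable_over_def by blast
  qed
  show "matroidal (pair_of (rep_system i)) \<longleftrightarrow> i \<notin> {121, 123}"
  proof
    assume "matroidal (pair_of (rep_system i))"
    thus "i \<notin> {121, 123}" using fano_not_matroidal[of _ i] unfolding matroidal_def by blast
  next
    assume i: "i \<notin> {121, 123}"
    show "matroidal (pair_of (rep_system i))"
    proof (cases "i = 119")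
      case True
      obtain p :: "nat \<Rightarrow> (complex ^ 3) set" where "p \<in> configurations" "represents p (pair_of (rep_system 104))"
        using rational_representation[of 104, where 'a = complex] by auto
      thus ?thesis unfolding matroidal_def True quadrilateral_lines represents_def by blast
    next
      case False
      obtain p :: "nat \<Rightarrow> (complex ^ 3) set" where "p \<in> configurations" "represents p (pair_of (rep_system i))"
        using cx False i unfolding representable_over_def by auto
      thus ?thesis unfolding matroidal_def represents_def by blast
    qed
  qed
qed

section \<open>Invariance under permutations\<close>

lemma representable_over_act:
  assumes "\<sigma> permutes {1..8}" "representable_over TYPE('k::field) Q"
  shows "representable_over TYPE('k) (act \<sigma> Q)"
proof -
  obtain p :: "nat \<Rightarrow> ('k ^ 3) set" where p: "p \<in> configurations" "represents p Q"
    using assms(2) by (auto simp: representable_over_def)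
  obtain q :: "nat \<Rightarrow> ('k ^ 3) set" where q: "q \<in> configurations" "collinear_triples q = (`) \<sigma> ` collinear_triples p"
    "conic_sextuples q = (`) \<sigma> ` conic_sextuples p" using represents_permuted[OF p(1) assms(1)] .
  have "represents q (act \<sigma> Q)" using q(2,3) p(2) by (simp add: represents_def act_def)
  thus ?thesis using q(1) unfolding representable_over_def by blast
qed

lemma matroidal_act:
  assumes "\<sigma> permutes {1..8}" "matroidal Q"
  shows "matroidal (act \<sigma> Q)"
proof -
  obtain p :: "nat \<Rightarrow> (complex ^ 3) set" where p: "p \<in> configurations" "collinear_triples p = fst Q"
    using assms(2) by (auto simp: matroidal_def)
  obtain q :: "nat \<Rightarrow> (complex ^ 3) set" where q: "q \<in> configurations" "collinear_triples q = (`) \<sigma> ` collinear_triples p"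
    using represents_permuted[OF p(1) assms(1)] .
  have "collinear_triples q = fst (act \<sigma> Q)" using q(2) p(2) by (simp add: act_def)
  thus ?thesis using q(1) unfolding matroidal_def by blast
qed

lemma bezout_pairs_act:
  assumes "\<sigma> permutes {1..8}" "Q \<in> pairs" "bezout_weak Q"
  shows "act \<sigma> Q \<in> pairs" "bezout_weak (act \<sigma> Q)" "bezoutian Q \<Longrightarrow> bezoutian (act \<sigma> Q)"
proof -
  let ?K = "system_of Q"
  have K: "?K \<in> systems" "pair_of ?K = Q" using assms system_of_in_systems pair_of_system_of by blast+
  hence act: "act \<sigma> Q = pair_of ((`) \<sigma> ` ?K)" using pair_of_image[OF assms(1)] by metis
  have K': "(`) \<sigma> ` ?K \<in> systems" by (rule system_image[OF assms(1) K(1)])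
  show "act \<sigma> Q \<in> pairs" "bezout_weak (act \<sigma> Q)" unfolding act using pair_of_in_pairs bezout_weak_pair_of[OF K'] by blast+
  assume "bezoutian Q"
  hence "\<forall>A\<in>?K. card A = 2 \<or> card A = 3" using bezoutian_pair_of[OF K(1)] K(2) by metis
  moreover have "card (\<sigma> ` A) = card A" for A using permutes_inj[OF assms(1)] by (simp add: card_image inj_on_subset)
  ultimately show "bezoutian (act \<sigma> Q)" unfolding act bezoutian_pair_of[OF K'] by simp
qed

section \<open>Summation over the classes\<close>

lemma sum_class_sizes_except:
  assumes "N \<subseteq> {..<128}" "finite N"
  shows "(\<Sum>i\<in>{i. i < 128 \<and> i \<notin> N}. class_sizes ! i) = 782537 - (\<Sum>i\<in>N. class_sizes ! i)"
proof -
  \<comment> \<open>The number of all systems, equivalently of all pairs that satisfy Bezout's weak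
    criteria, matroidal or not.\<close>
  have "sum_list class_sizes = 782537" by (simp add: class_sizes_def)
  hence "(\<Sum>i\<in>{..<128}. class_sizes ! i) = 782537"
    by (simp add: sum_list_sum_nth length_class_sizes atLeast0LessThan)
  moreover have "{i. i < 128 \<and> i \<notin> N} = {..<128} - N" by auto
  ultimately show ?thesis using assms by (simp add: sum_diff_nat)
qed

lemma card_except:
  assumes "N \<subseteq> {..<128::nat}" "finite N"
  shows "card {i. i < 128 \<and> i \<notin> N} = 128 - card N"
proof -
  have "{i. i < 128 \<and> i \<notin> N} = {..<128} - N" by auto
  thus ?thesis using assms by (simp add: card_Diff_subset)
qed

lemma candidate_quatroids_count:
  "card candidate_quatroids = 780617" "card (S8_orbits candidate_quatroids) = 126"
proof -
  have I: "{i. i < 128 \<and> i \<notin> {121, 123}} = {i. i < 128 \<and> pair_of (rep_system i) \<in> candidate_quatroids}"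
    using representable_over_rep(3) pair_of_in_pairs bezout_weak_pair_of rep_system_in_systems
    unfolding candidate_quatroids_def by blast
  have inv: "\<forall>Q\<in>candidate_quatroids. Q \<in> pairs \<and> bezout_weak Q"
    "\<forall>\<sigma> Q. \<sigma> permutes {1..8} \<longrightarrow> Q \<in> candidate_quatroids \<longrightarrow> act \<sigma> Q \<in> candidate_quatroids"
    unfolding candidate_quatroids_def using bezout_pairs_act matroidal_act by blast+
  show "card candidate_quatroids = 780617"
    unfolding card_invariant_set[OF inv I] by (subst sum_class_sizes_except) (simp_all add: class_sizes_def)
  show "card (S8_orbits candidate_quatroids) = 126"
    unfolding card_orbits_invariant_set[OF inv I] by (subst card_except) simp_all
qed

text \<open>The Fano classes have to be in N: all other classes are matroidal, so that
  representability over the given field alone decides which of them are counted.\<close>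

lemma representable_count:
  assumes I: "{i. i < 128 \<and> i \<notin> N} = {i. i < 128 \<and> representable_over TYPE('k::field) (pair_of (rep_system i))}"
    and N: "N \<subseteq> {..<128}" "{121, 123} \<subseteq> N"
  shows "card {Q \<in> candidate_quatroids. representable_over TYPE('k) Q} = 782537 - (\<Sum>i\<in>N. class_sizes ! i)"
    and "card (S8_orbits {Q \<in> candidate_quatroids. representable_over TYPE('k) Q}) = 128 - card N"
proof -
  let ?E = "{Q \<in> candidate_quatroids. representable_over TYPE('k) Q}"
  have "pair_of (rep_system i) \<in> candidate_quatroids" if "i < 128" "i \<notin> N" for i
    using representable_over_rep(3)[OF that(1)] pair_of_in_pairs bezout_weak_pair_of[OF rep_system_in_systems[OF that(1)]] that N
    unfolding candidate_quatroids_def by blast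
  hence I': "{i. i < 128 \<and> i \<notin> N} = {i. i < 128 \<and> pair_of (rep_system i) \<in> ?E}"
    using I by blast
  have inv: "\<forall>Q\<in>?E. Q \<in> pairs \<and> bezout_weak Q"
    "\<forall>\<sigma> Q. \<sigma> permutes {1..8} \<longrightarrow> Q \<in> ?E \<longrightarrow> act \<sigma> Q \<in> ?E"
    unfolding candidate_quatroids_def using bezout_pairs_act matroidal_act representable_over_act by blast+
  have fin: "finite N" using N(1) finite_subset by blast
  show "card ?E = 782537 - (\<Sum>i\<in>N. class_sizes ! i)"
    unfolding card_invariant_set[OF inv I'] by (rule sum_class_sizes_except[OF N(1) fin])
  show "card (S8_orbits ?E) = 128 - card N"
    unfolding card_orbits_invariant_set[OF inv I'] by (rule card_except[OF N(1) fin])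
qed

section \<open>The strata\<close>

lemma stratum_nonempty_iff: "stratum Q \<noteq> {} \<longleftrightarrow> representable_over TYPE(complex) Q"
  by (auto simp: stratum_def representable_over_def)

lemma representable_candidate:
  assumes "representable_over TYPE(complex) Q"
  shows "Q \<in> candidate_quatroids"
proof -
  obtain p :: "nat \<Rightarrow> (complex ^ 3) set" where p: "p \<in> configurations" "represents p Q"
    using assms by (auto simp: representable_over_def)
  have "Q = (collinear_triples p, conic_sextuples p)" using p(2) by (simp add: represents_def)
  hence "bezout_weak Q" using bezout_weak_configuration[OF p(1)] by simp
  thus ?thesis using p represents_in_pairs unfolding candidate_quatroids_def matroidal_def represents_def by blast
qed

lemma inj_on_stratum: "inj_on stratum {Q. stratum Q \<noteq> {}}"
proof (rule inj_onI)
  fix Q R assume QR: "Q \<in> {Q. stratum Q \<noteq> {}}" "stratum Q = stratum R"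
  then obtain p where "p \<in> stratum Q" "p \<in> stratum R" by auto
  thus "Q = R" by (auto simp: stratum_def represents_def prod_eq_iff)
qed

lemma strata_partition: "partition_on configurations strata"
proof (rule partition_onI)
  show "\<Union>strata = configurations"
  proof
    show "configurations \<subseteq> \<Union>strata"
    proof
      fix p :: "nat \<Rightarrow> (complex ^ 3) set" assume p: "p \<in> configurations"
      let ?Q = "(collinear_triples p, conic_sextuples p)"
      have "represents p ?Q" by (simp add: represents_def)
      hence "p \<in> stratum ?Q" "?Q \<in> pairs" using p represents_in_pairs by (auto simp: stratum_def)
      thus "p \<in> \<Union>strata" unfolding strata_def by blast
    qed
  qed (auto simp: strata_def stratum_def)
  show "{} \<notin> strata" by (auto simp: strata_def)
  fix S T assume "S \<in> strata" "T \<in> strata" "S \<noteq> T"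
  then obtain Q R where "S = stratum Q" "T = stratum R" "Q \<noteq> R" by (auto simp: strata_def)
  thus "disjnt S T" by (auto simp: disjnt_def stratum_def represents_def prod_eq_iff)
qed

lemma card_strata_eq:
  assumes "\<And>Q. P Q \<Longrightarrow> stratum Q \<noteq> {}"
  shows "card {stratum Q | Q. P Q} = card {Q. P Q}"
proof -
  have "{stratum Q | Q. P Q} = stratum ` {Q. P Q}" by auto
  moreover have "inj_on stratum {Q. P Q}" using inj_on_subset[OF inj_on_stratum] assms by blast
  ultimately show ?thesis by (simp add: card_image)
qed

lemma bezoutian_strata_count:
  "card {Q \<in> pairs. bezoutian Q \<and> stratum Q \<noteq> {}} = 544748"
  "card (S8_orbits {Q \<in> pairs. bezoutian Q \<and> stratum Q \<noteq> {}}) = 76"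
proof -
  let ?E = "{Q \<in> pairs. bezoutian Q \<and> stratum Q \<noteq> {}}"
  \<comment> \<open>The Bezoutian indices without the classes 119 and 121, which are not
    representable over the complex numbers. Class 123 does not occur because one of its lines has
    four points, and class 127 stays.\<close>
  define xs :: "nat list" where "xs = removeAll 119 (removeAll 121 [0, 3, 4, 11, 12, 13, 15, 16, 26, 27, 29, 30, 31, 32, 33, 35, 36, 37, 39, 46, 47, 48, 49, 50, 51, 52, 53, 54,
      55, 56, 58, 59, 62, 63, 64, 66, 67, 72, 75, 76, 77, 78, 79, 80, 81, 82, 83, 84, 85, 87, 88, 89, 91, 92, 93,
      96, 97, 102, 103, 104, 105, 106, 107, 108, 110, 111, 112, 113, 115, 116, 118, 119, 120, 121, 122, 124, 126,
      127])"
  have xs: "i < 128" "i \<noteq> 123" if "i \<in> set xs" for i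
    using that by (auto simp: xs_def)
  have mem: "i \<in> set xs \<longleftrightarrow> i < 128 \<and> pair_of (rep_system i) \<in> ?E" for i
  proof (cases "i < 128")
    case True
    have "i \<in> set xs \<longleftrightarrow> bezoutian (pair_of (rep_system i)) \<and> i \<noteq> 119 \<and> i \<noteq> 121"
      unfolding bezoutian_rep[OF True] bezoutian_indices xs_def set_removeAll by blast
    moreover have "i = 123 \<Longrightarrow> i \<notin> set xs" using xs(2) by blast
    ultimately show ?thesis
      using representable_over_rep(1)[OF True] True pair_of_in_pairs by (auto simp: stratum_nonempty_iff)
  qed (use xs(1) in blast)
  have I: "set xs = {i. i < 128 \<and> pair_of (rep_system i) \<in> ?E}"
    by (intro equalityI subsetI) (simp_all only: mem mem_Collect_eq simp_thms)
  have inv1: "\<forall>Q\<in>?E. Q \<in> pairs \<and> bezout_weak Q"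
    by (simp add: bezoutian_def)
  have inv2: "\<forall>\<sigma> Q. \<sigma> permutes {1..8} \<longrightarrow> Q \<in> ?E \<longrightarrow> act \<sigma> Q \<in> ?E"
  proof (intro allI impI)
    fix \<sigma> :: "nat \<Rightarrow> nat" and Q assume s: "\<sigma> permutes {1..8}" and Q: "Q \<in> ?E"
    hence "Q \<in> pairs" "bezoutian Q" "bezout_weak Q" "representable_over TYPE(complex) Q"
      by (simp_all add: bezoutian_def stratum_nonempty_iff)
    thus "act \<sigma> Q \<in> ?E"
      using bezout_pairs_act[OF s, of Q] representable_over_act[OF s, of Q] by (simp add: stratum_nonempty_iff)
  qed
  have dist: "distinct xs" by (simp add: xs_def)
  have "card ?E = sum_list (map ((!) class_sizes) xs)"
    unfolding card_invariant_set[OF inv1 inv2 I] using dist by (simp add: sum.distinct_set_conv_list)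
  also have "\<dots> = 544748"
    by (simp add: xs_def class_sizes_def)
  finally show "card ?E = 544748" .
  show "card (S8_orbits ?E) = 76"
    unfolding card_orbits_invariant_set[OF inv1 inv2 I] using dist by (simp add: distinct_card) (simp add: xs_def)
qed

text \<open>Stated for any ordered field: the witnesses are integral and the MacLane class is
  excluded by the order alone, so the real and the rational case are two instances.\<close>

lemma representable_counts:
  shows "card {Q \<in> candidate_quatroids. representable_over TYPE(complex) Q} = 779777"
    and "card (S8_orbits {Q \<in> candidate_quatroids. representable_over TYPE(complex) Q}) = 125"
    and "card {Q \<in> candidate_quatroids. representable_over TYPE('k::linordered_field) Q} = 778937"
    and "card (S8_orbits {Q \<in> candidate_quatroids. representable_over TYPE('k) Q}) = 124"
proof -
  have 1: "{i. i < 128 \<and> i \<notin> {119, 121, 123}} = {i. i < 128 \<and> representable_over TYPE(complex) (pair_of (rep_system i))}"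
    using representable_over_rep(1) by blast
  have 2: "{i. i < 128 \<and> i \<notin> {119, 121, 123, 127}} = {i. i < 128 \<and> representable_over TYPE('k) (pair_of (rep_system i))}"
    using representable_over_rep(2)[where 'a = 'k] by blast
  show "card {Q \<in> candidate_quatroids. representable_over TYPE(complex) Q} = 779777"
    by (subst representable_count(1)[OF 1]) (simp_all add: class_sizes_def)
  show "card (S8_orbits {Q \<in> candidate_quatroids. representable_over TYPE(complex) Q}) = 125"
    by (subst representable_count(2)[OF 1]) simp_all
  show "card {Q \<in> candidate_quatroids. representable_over TYPE('k) Q} = 778937"
    by (subst representable_count(1)[OF 2]) (simp_all add: class_sizes_def)
  show "card (S8_orbits {Q \<in> candidate_quatroids. representable_over TYPE('k) Q}) = 124"
    by (subst representable_count(2)[OF 2]) simp_all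
qed

lemma card_strata: "card strata = 779777"
proof -
  have "card strata = card {Q. Q \<in> pairs \<and> stratum Q \<noteq> {}}"
    unfolding strata_def by (rule card_strata_eq) blast
  also have "{Q. Q \<in> pairs \<and> stratum Q \<noteq> {}} = {Q \<in> candidate_quatroids. representable_over TYPE(complex) Q}"
    unfolding stratum_nonempty_iff using representable_candidate candidate_quatroids_def by blast
  finally show ?thesis by (simp add: representable_counts)
qed

theorem corollary3p21:
  shows "card candidate_quatroids = 780617
    \<and> card (S8_orbits candidate_quatroids) = 126
    \<and> card {Q \<in> candidate_quatroids. representable_over TYPE(complex) Q} = 779777
    \<and> card (S8_orbits {Q \<in> candidate_quatroids. representable_over TYPE(complex) Q}) = 125
    \<and> card {Q \<in> candidate_quatroids. representable_over TYPE(real) Q} = 778937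
    \<and> card (S8_orbits {Q \<in> candidate_quatroids. representable_over TYPE(real) Q}) = 124
    \<and> card {Q \<in> candidate_quatroids. representable_over TYPE(rat) Q} = 778937
    \<and> card (S8_orbits {Q \<in> candidate_quatroids. representable_over TYPE(rat) Q}) = 124
    \<and> partition_on configurations strata
    \<and> card strata = 779777
    \<and> card {stratum Q | Q. Q \<in> pairs \<and> bezoutian Q \<and> stratum Q \<noteq> {}} = 544748
    \<and> card (S8_orbits {Q \<in> pairs. bezoutian Q \<and> stratum Q \<noteq> {}}) = 76"
  using candidate_quatroids_count representable_counts(1,2) representable_counts(3,4)[where 'k = real]
    representable_counts(3,4)[where 'k = rat] strata_partition card_strata bezoutian_strata_count
    card_strata_eq[of "\<lambda>Q. Q \<in> pairs \<and> bezoutian Q \<and> stratum Q \<noteq> {}"]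
  by simp

end
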